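(* Let $L$ be a Lie ring over $\mathbb{Z}$, let $D$ be a derivation of $L$ and let $r\in\mathbb{Z}[t]$ be a polynomial of degree $n$ such that $r(D)=0$. If $r(0)\neq 0$ and if $L$ has no $\delta(r)\sigma(r)$-torsion, then $L$ is nilpotent of class $c(L)\le H(n)$.
   Context: For $m\in\mathbb{Z}$, a Lie ring $L$ has no $m$-torsion if the set of $v\in L$ for which there is a $k\in\mathbb{N}$ with $m^k\cdot v=0$ is equal to $\{0\}$. $c(L)$ denotes the nilpotency class. Let $r\in\mathbb{Z}[t]$ be a nonzero polynomial of degree $d$ with leading coefficient $a\in\mathbb{Z}$. If $d\ge 1$, let $\lambda_1,\ldots,\lambda_\ell$ be the distinct roots of $r$ in $\overline{\mathbb{Q}}$ with multiplicities $m_1,\ldots,m_\ell$, and let $m=\max\{m_1,\ldots,m_\ell\}$. The nonzero integers $\delta(r)$ and $\sigma(r)$ are defined by $\delta(r)=r$ and $\sigma(r)=1$ if $d=0$, and for $d\ge 1$ by \[ \delta(r)=a^{1+2d^2}\cdot (m-1)!\cdot\prod_{\substack{1\le i,j\le \ell\\ i\neq j}}(\lambda_i-\lambda_j)^m, \qquad \sigma(r)=a^{2d^3}\cdot\prod_{\substack{1\le i,j\le \ell\\ r(\lambda_i+\lambda_j)\neq 0}}r(\lambda_i+\lambda_j). \] A subset $X$ of an additive abelian group is called arithmetically-free if there are no $\alpha,\beta\in X$ such that $\alpha+k\beta\in X$ for all integers $k\ge 0$. $H$ is the generalized Higman map: $H(n)$ is the least natural number such that every Lie ring $L$ which is graded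 by an abelian group $(A,+)$, i.e. $L=\bigoplus_{a\in A}L_a$ with $[L_a,L_b]\subseteq L_{a+b}$, and whose support $\{a\in A\mid L_a\neq 0\}$ is contained in an arithmetically-free subset of $A$ with at most $n$ elements, is nilpotent of class at most $H(n)$. (Such a number exists for each $n$ by a known theorem of Moens.) *)

theory Defs
  imports
    Complex_Main
    "HOL-Library.Countable_Set"
    "HOL-Library.Extended_Nat"
    "HOL-Computational_Algebra.Polynomial"
    "HOL-Algebra.Generated_Groups"
    "HOL-Algebra.Ring"
begin

section \<open>Lie rings\<close>

text \<open>A Lie ring is a \<^const>\<open>abelian_group\<close> in the sense of \<open>HOL-Algebra\<close> (additive fields of
  the ring record) with the multiplication field as bracket. The field \<^const>\<open>one\<close> plays no role.\<close>

locale lie_ring = abelian_group L for L (structure) +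
  assumes bracket_closed: "\<lbrakk>x \<in> carrier L; y \<in> carrier L\<rbrakk> \<Longrightarrow> x \<otimes> y \<in> carrier L"
    and bracket_add_left: "\<lbrakk>x \<in> carrier L; y \<in> carrier L; z \<in> carrier L\<rbrakk> \<Longrightarrow>
      (x \<oplus> y) \<otimes> z = (x \<otimes> z) \<oplus> (y \<otimes> z)"
    and bracket_add_right: "\<lbrakk>x \<in> carrier L; y \<in> carrier L; z \<in> carrier L\<rbrakk> \<Longrightarrow>
      x \<otimes> (y \<oplus> z) = (x \<otimes> y) \<oplus> (x \<otimes> z)"
    and bracket_self: "x \<in> carrier L \<Longrightarrow> x \<otimes> x = \<zero>"
    and jacobi: "\<lbrakk>x \<in> carrier L; y \<in> carrier L; z \<in> carrier L\<rbrakk> \<Longrightarrow>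
      (x \<otimes> (y \<otimes> z)) \<oplus> ((y \<otimes> (z \<otimes> x)) \<oplus> (z \<otimes> (x \<otimes> y))) = \<zero>"

text \<open>Lower central series, starting with index 0 at \<open>L\<close> itself; so \<open>L\<close> is nilpotent of class
  \<open>c\<close> iff \<open>c\<close> is the first index at which it vanishes (the zero ring has class 0).\<close>

primrec lower_central :: "('a, 'm) ring_scheme \<Rightarrow> nat \<Rightarrow> 'a set" where
  "lower_central L 0 = carrier L"
| "lower_central L (Suc i) =
     generate (add_monoid L) {x \<otimes>\<^bsub>L\<^esub> y | x y. x \<in> lower_central L i \<and> y \<in> carrier L}"

definition lie_nilpotent :: "('a, 'm) ring_scheme \<Rightarrow> bool" where
  "lie_nilpotent L \<longleftrightarrow> (\<exists>c. lower_central L c = {\<zero>\<^bsub>L\<^esub>})"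

definition nilpotency_class :: "('a, 'm) ring_scheme \<Rightarrow> nat" where
  "nilpotency_class L = (LEAST c. lower_central L c = {\<zero>\<^bsub>L\<^esub>})"

definition no_torsion :: "('a, 'm) ring_scheme \<Rightarrow> int \<Rightarrow> bool" where
  "no_torsion L m \<longleftrightarrow> {v \<in> carrier L. \<exists>k::nat. [(m ^ k)] \<cdot>\<^bsub>L\<^esub> v = \<zero>\<^bsub>L\<^esub>} = {\<zero>\<^bsub>L\<^esub>}"

definition lie_derivation :: "('a, 'm) ring_scheme \<Rightarrow> ('a \<Rightarrow> 'a) \<Rightarrow> bool" where
  "lie_derivation L D \<longleftrightarrow>
     D \<in> carrier L \<rightarrow> carrier L \<and>
     (\<forall>x\<in>carrier L. \<forall>y\<in>carrier L. D (x \<oplus>\<^bsub>L\<^esub> y) = D x \<oplus>\<^bsub>L\<^esub> D y) \<and>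
     (\<forall>x\<in>carrier L. \<forall>y\<in>carrier L.
        D (x \<otimes>\<^bsub>L\<^esub> y) = (D x \<otimes>\<^bsub>L\<^esub> y) \<oplus>\<^bsub>L\<^esub> (x \<otimes>\<^bsub>L\<^esub> D y))"

definition poly_operator :: "('a, 'm) ring_scheme \<Rightarrow> int poly \<Rightarrow> ('a \<Rightarrow> 'a) \<Rightarrow> 'a \<Rightarrow> 'a" where
  "poly_operator L r D x = (\<Oplus>\<^bsub>L\<^esub>i\<in>{..degree r}. [coeff r i] \<cdot>\<^bsub>L\<^esub> (D ^^ i) x)"


section \<open>The integers $\delta(r)$ and $\sigma(r)$\<close>

text \<open>The roots are taken in \<open>\<complex>\<close>, which contains an algebraic closure of the rationals.
  \<open>Polynomial.order\<close> is the multiplicity of a root.\<close>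

abbreviation cpoly :: "int poly \<Rightarrow> complex poly" where
  "cpoly r \<equiv> map_poly of_int r"

definition croots :: "int poly \<Rightarrow> complex set" where
  "croots r = {z. poly (cpoly r) z = 0}"

definition max_mult :: "int poly \<Rightarrow> nat" where
  "max_mult r = Max ((\<lambda>z. Polynomial.order z (cpoly r)) ` croots r)"

text \<open>The complex numbers below are integers whenever \<open>r\<close> has positive degree (they are rational
  by Galois invariance, and integral because of the power of the leading coefficient).\<close>

definition delta :: "int poly \<Rightarrow> int" where
  "delta r = (if degree r = 0 then coeff r 0 else
     (THE k. (of_int k :: complex) =
        of_int (lead_coeff r) ^ (1 + 2 * degree r ^ 2) * fact (max_mult r - 1) *
        (\<Prod>(x, y) \<in> {(x, y). x \<in> croots r \<and> y \<in> croots r \<and> x \<noteq> y}. (x - y) ^ max_mult r)))"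

definition sigma :: "int poly \<Rightarrow> int" where
  "sigma r = (if degree r = 0 then 1 else
     (THE k. (of_int k :: complex) =
        of_int (lead_coeff r) ^ (2 * degree r ^ 3) *
        (\<Prod>(x, y) \<in> {(x, y). x \<in> croots r \<and> y \<in> croots r \<and> poly (cpoly r) (x + y) \<noteq> 0}.
           poly (cpoly r) (x + y))))"


section \<open>The generalized Higman map\<close>

definition arithmetically_free :: "('b, 'k) ring_scheme \<Rightarrow> 'b set \<Rightarrow> bool" where
  "arithmetically_free A X \<longleftrightarrow>
     X \<subseteq> carrier A \<and> \<not> (\<exists>\<alpha>\<in>X. \<exists>\<beta>\<in>X. \<forall>k::nat. \<alpha> \<oplus>\<^bsub>A\<^esub> [k] \<cdot>\<^bsub>A\<^esub> \<beta> \<in> X)"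

text \<open>\<open>C a\<close> is the homogeneous component of degree \<open>a\<close>. The second and third conditions on \<open>C\<close> say
  that \<open>L\<close> is the internal direct sum of the \<open>C a\<close>.\<close>

definition lie_grading ::
    "('a, 'm) ring_scheme \<Rightarrow> ('b, 'k) ring_scheme \<Rightarrow> ('b \<Rightarrow> 'a set) \<Rightarrow> bool" where
  "lie_grading L A C \<longleftrightarrow>
     (\<forall>a\<in>carrier A. subgroup (C a) (add_monoid L)) \<and>
     (\<forall>x\<in>carrier L. \<exists>F f. finite F \<and> F \<subseteq> carrier A \<and> f \<in> Pi F C \<and> x = (\<Oplus>\<^bsub>L\<^esub>a\<in>F. f a)) \<and>
     (\<forall>F f. finite F \<longrightarrow> F \<subseteq> carrier A \<longrightarrow> f \<in> Pi F C \<longrightarrow> (\<Oplus>\<^bsub>L\<^esub>a\<in>F. f a) = \<zero>\<^bsub>L\<^esub> \<longrightarrow>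
        (\<forall>a\<in>F. f a = \<zero>\<^bsub>L\<^esub>)) \<and>
     (\<forall>a\<in>carrier A. \<forall>b\<in>carrier A. \<forall>x\<in>C a. \<forall>y\<in>C b. x \<otimes>\<^bsub>L\<^esub> y \<in> C (a \<oplus>\<^bsub>A\<^esub> b))"

definition grading_support ::
    "('a, 'm) ring_scheme \<Rightarrow> ('b, 'k) ring_scheme \<Rightarrow> ('b \<Rightarrow> 'a set) \<Rightarrow> 'b set" where
  "grading_support L A C = {a \<in> carrier A. C a \<noteq> {\<zero>\<^bsub>L\<^esub>}}"

text \<open>A Lie ring together with a grading as in the definition of the Higman map.\<close>

definition higman_graded ::
    "nat \<Rightarrow> ('a, 'm) ring_scheme \<Rightarrow> ('b, 'k) ring_scheme \<Rightarrow> ('b \<Rightarrow> 'a set) \<Rightarrow> bool" where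
  "higman_graded n L A C \<longleftrightarrow> lie_ring L \<and> abelian_group A \<and> lie_grading L A C \<and>
     (\<exists>X. arithmetically_free A X \<and> finite X \<and> card X \<le> n \<and> grading_support L A C \<subseteq> X)"

text \<open>One cannot quantify over all types inside a definition, so the Lie rings and the grading
  groups range over those with carrier a set of natural numbers, i.e. up to isomorphism over
  the countable ones. This is no restriction: see \<open>higman_bound_all_types\<close> below.\<close>

definition higman_bound :: "nat \<Rightarrow> nat \<Rightarrow> bool" where
  "higman_bound n c \<longleftrightarrow>
     (\<forall>(L :: nat ring) (A :: nat ring) C. higman_graded n L A C \<longrightarrow>
        lie_nilpotent L \<and> nilpotency_class L \<le> c)"

text \<open>The least \<open>c\<close> with \<open>higman_bound n c\<close>, as an infimum in \<^typ>\<open>enat\<close>. By a theorem of Moens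
  such \<open>c\<close> exists for every \<open>n\<close>, i.e. \<open>higman n\<close> is a natural number; the definition
  itself does not presuppose that theorem.\<close>

definition higman :: "nat \<Rightarrow> enat" where
  "higman n = Inf (enat ` {c. higman_bound n c})"

lemma higman_eq_Least:
  assumes "\<exists>c. higman_bound n c"
  shows "higman n = enat (LEAST c. higman_bound n c)"
  unfolding higman_def
proof (rule antisym)
  show "Inf (enat ` {c. higman_bound n c}) \<le> enat (LEAST c. higman_bound n c)"
    using LeastI_ex[OF assms] by (auto intro: Inf_lower)
  show "enat (LEAST c. higman_bound n c) \<le> Inf (enat ` {c. higman_bound n c})"
    by (rule Inf_greatest) (auto intro: Least_le)
qed


subsection \<open>Independence of the carrier types\<close>

lemma countable_closure:
  assumes "countable F" "countable U" "countable B"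
  shows "\<exists>S. countable S \<and> F \<subseteq> S \<and> (\<forall>u\<in>U. \<forall>x\<in>S. u x \<in> S) \<and>
    (\<forall>b\<in>B. \<forall>x\<in>S. \<forall>y\<in>S. b x y \<in> S)"
proof -
  define step where "step S = S \<union> (\<Union>u\<in>U. u ` S) \<union> (\<Union>b\<in>B. case_prod b ` (S \<times> S))" for S
  define T where "T = rec_nat F (\<lambda>_. step)"
  have T0: "T 0 = F" and TS: "T (Suc i) = step (T i)" for i
    by (simp_all add: T_def)
  have "countable (T i)" for i
    by (induction i) (auto simp: T0 TS step_def assms)
  hence "countable (\<Union>i. T i)" by simp
  moreover have mono: "T i \<subseteq> T j" if "i \<le> j" for i j
    using that by (rule lift_Suc_mono_le[rotated]) (auto simp: TS step_def)
  have "F \<subseteq> (\<Union>i. T i)" using T0 by blast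
  moreover have "u x \<in> (\<Union>i. T i)" if "u \<in> U" "x \<in> (\<Union>i. T i)" for u x
  proof -
    from that(2) obtain i where "x \<in> T i" by blast
    hence "u x \<in> T (Suc i)" using that(1) by (auto simp: TS step_def)
    thus ?thesis by blast
  qed
  moreover have "b x y \<in> (\<Union>i. T i)" if "b \<in> B" "x \<in> (\<Union>i. T i)" "y \<in> (\<Union>i. T i)" for b x y
  proof -
    from that obtain i j where "x \<in> T i" "y \<in> T j" by blast
    hence "x \<in> T (max i j)" "y \<in> T (max i j)"
      using mono[of i "max i j"] mono[of j "max i j"] by auto
    hence "b x y \<in> T (Suc (max i j))" using that(1) by (force simp: TS step_def)
    thus ?thesis by blast
  qed
  ultimately show ?thesis by (intro exI[of _ "\<Union>i. T i"] conjI ballI)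
qed

definition nat_copy :: "('a, 'm) ring_scheme \<Rightarrow> 'a set \<Rightarrow> nat ring" where
  "nat_copy L S = \<lparr>carrier = to_nat_on S ` S,
     mult = (\<lambda>x y. to_nat_on S (from_nat_into S x \<otimes>\<^bsub>L\<^esub> from_nat_into S y)),
     one = 0, zero = to_nat_on S \<zero>\<^bsub>L\<^esub>,
     add = (\<lambda>x y. to_nat_on S (from_nat_into S x \<oplus>\<^bsub>L\<^esub> from_nat_into S y))\<rparr>"

locale countable_subgroup = abelian_group L for L (structure) +
  fixes S :: "'a set"
  assumes S_sub: "S \<subseteq> carrier L" and S_count: "countable S" and S_zero: "\<zero> \<in> S"
    and S_add: "\<lbrakk>x \<in> S; y \<in> S\<rbrakk> \<Longrightarrow> x \<oplus> y \<in> S" and S_inv: "x \<in> S \<Longrightarrow> \<ominus> x \<in> S"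
begin

abbreviation "K \<equiv> nat_copy L S"
abbreviation "h \<equiv> to_nat_on S"
abbreviation "g \<equiv> from_nat_into S"

lemma carrier_K: "carrier K = h ` S" by (simp add: nat_copy_def)
lemma zero_K: "\<zero>\<^bsub>K\<^esub> = h \<zero>" by (simp add: nat_copy_def)
lemma add_K: "x \<oplus>\<^bsub>K\<^esub> y = h (g x \<oplus> g y)" by (simp add: nat_copy_def)
lemma mult_K: "x \<otimes>\<^bsub>K\<^esub> y = h (g x \<otimes> g y)" by (simp add: nat_copy_def)

lemma gh [simp]: "s \<in> S \<Longrightarrow> g (h s) = s" using S_count by simp
lemma h_in [simp]: "s \<in> S \<Longrightarrow> h s \<in> carrier K" by (simp add: carrier_K)
lemma g_in_S [simp]: "x \<in> carrier K \<Longrightarrow> g x \<in> S" by (auto simp: carrier_K)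
lemma g_in [simp]: "x \<in> carrier K \<Longrightarrow> g x \<in> carrier L" using S_sub by auto
lemma hg [simp]: "x \<in> carrier K \<Longrightarrow> h (g x) = x" by (auto simp: carrier_K)
lemma S_in: "s \<in> S \<Longrightarrow> s \<in> carrier L" using S_sub by auto

lemma g_zero [simp]: "g \<zero>\<^bsub>K\<^esub> = \<zero>" using S_zero by (simp add: zero_K)
lemma g_add: "\<lbrakk>x \<in> carrier K; y \<in> carrier K\<rbrakk> \<Longrightarrow> g (x \<oplus>\<^bsub>K\<^esub> y) = g x \<oplus> g y"
  by (simp add: add_K S_add)
lemma g_inj: "\<lbrakk>x \<in> carrier K; y \<in> carrier K; g x = g y\<rbrakk> \<Longrightarrow> x = y" by (metis hg)

lemma abelian_group_K: "abelian_group K"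
proof (rule abelian_groupI)
  fix x y assume "x \<in> carrier K" "y \<in> carrier K"
  thus "x \<oplus>\<^bsub>K\<^esub> y \<in> carrier K" by (simp add: add_K S_add)
next
  show "\<zero>\<^bsub>K\<^esub> \<in> carrier K" by (simp add: zero_K S_zero)
next
  fix x y z assume *: "x \<in> carrier K" "y \<in> carrier K" "z \<in> carrier K"
  thus "x \<oplus>\<^bsub>K\<^esub> y \<oplus>\<^bsub>K\<^esub> z = x \<oplus>\<^bsub>K\<^esub> (y \<oplus>\<^bsub>K\<^esub> z)"
    by (simp add: add_K S_add a_assoc)
next
  fix x y assume "x \<in> carrier K" "y \<in> carrier K"
  thus "x \<oplus>\<^bsub>K\<^esub> y = y \<oplus>\<^bsub>K\<^esub> x" by (simp add: add_K a_comm)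
next
  fix x assume x: "x \<in> carrier K"
  thus "\<zero>\<^bsub>K\<^esub> \<oplus>\<^bsub>K\<^esub> x = x" by (simp add: add_K)
  show "\<exists>y\<in>carrier K. y \<oplus>\<^bsub>K\<^esub> x = \<zero>\<^bsub>K\<^esub>"
    by (rule bexI[of _ "h (\<ominus> g x)"]) (use x in \<open>simp_all add: add_K zero_K S_inv l_neg\<close>)
qed

lemma g_pow:
  assumes "x \<in> carrier K"
  shows "g ([(k::nat)] \<cdot>\<^bsub>K\<^esub> x) = [k] \<cdot> g x"
proof -
  interpret K: abelian_group K by (rule abelian_group_K)
  show ?thesis
  proof (induction k)
    case 0
    show ?case by (simp add: K.add.nat_pow_0 add.nat_pow_0)
  next
    case (Suc k)
    thus ?case using assms
      by (simp add: K.add.nat_pow_Suc add.nat_pow_Suc g_add K.add.nat_pow_closed)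
  qed
qed

lemma g_finsum:
  assumes "finite F" "f \<in> F \<rightarrow> carrier K"
  shows "g (\<Oplus>\<^bsub>K\<^esub>a\<in>F. f a) = (\<Oplus>a\<in>F. g (f a))"
proof -
  interpret K: abelian_group K by (rule abelian_group_K)
  show ?thesis using assms
  proof (induction F)
    case empty
    show ?case by simp
  next
    case (insert a F)
    have "(\<lambda>a. g (f a)) \<in> F \<rightarrow> carrier L"
      using insert.prems by (simp add: Pi_iff)
    thus ?case using insert
      by (simp add: K.finsum_insert finsum_insert g_add K.finsum_closed Pi_iff)
  qed
qed

lemma g_inv: "x \<in> carrier K \<Longrightarrow> g (\<ominus>\<^bsub>K\<^esub> x) = \<ominus> g x"
proof -
  assume x: "x \<in> carrier K"
  interpret K: abelian_group K by (rule abelian_group_K)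
  have "g (\<ominus>\<^bsub>K\<^esub> x) \<oplus> g x = \<zero>"
    using x by (simp add: g_add[symmetric] K.l_neg del: g_in)
  thus ?thesis using x by (intro minus_equality[symmetric]) auto
qed

end

lemma lie_ring_nat_copy:
  assumes "lie_ring L" "countable_subgroup L S"
    and br: "\<And>x y. x \<in> S \<Longrightarrow> y \<in> S \<Longrightarrow> x \<otimes>\<^bsub>L\<^esub> y \<in> S"
  shows "lie_ring (nat_copy L S)"
proof -
  interpret lie_ring L by fact
  interpret countable_subgroup L S by fact
  interpret K: abelian_group K by (rule abelian_group_K)
  show ?thesis
    by unfold_locales
      (simp_all add: mult_K add_K zero_K br S_add bracket_add_left bracket_add_right bracket_self
        jacobi)
qed

lemma lower_central_mono_hom:
  fixes L :: "('a, 'm) ring_scheme"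
  assumes "lie_ring L" "x \<in> lower_central L i"
  shows "\<exists>F. finite F \<and> F \<subseteq> carrier L \<and> (\<forall>S. countable_subgroup L S \<longrightarrow> F \<subseteq> S \<longrightarrow>
    (\<forall>x\<in>S. \<forall>y\<in>S. x \<otimes>\<^bsub>L\<^esub> y \<in> S) \<longrightarrow>
    x \<in> from_nat_into S ` lower_central (nat_copy L S) i)"
  using assms(2)
proof (induction i arbitrary: x)
  case 0
  show ?case
  proof (intro exI[of _ "{x}"] conjI allI impI)
    fix S assume "countable_subgroup L S" "{x} \<subseteq> S"
    then interpret countable_subgroup L S by simp
    show "x \<in> g ` lower_central K 0"
      using \<open>{x} \<subseteq> S\<close> by (auto intro!: image_eqI[of _ _ "h x"])
  qed (use 0 in auto)
next
  case (Suc i)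
  interpret lie_ring L by fact
  let ?P = "\<lambda>x F. finite F \<and> F \<subseteq> carrier L \<and> (\<forall>S. countable_subgroup L S \<longrightarrow> F \<subseteq> S \<longrightarrow>
    (\<forall>x\<in>S. \<forall>y\<in>S. x \<otimes>\<^bsub>L\<^esub> y \<in> S) \<longrightarrow>
    x \<in> from_nat_into S ` lower_central (nat_copy L S) (Suc i))"
  have low_sub: "lower_central K' j \<subseteq> carrier K'" if "lie_ring K'" for j and K' :: "nat ring"
  proof (induction j)
    case (Suc j)
    interpret K': lie_ring K' by fact
    show ?case
      using Suc K'.add.generate_incl[of "{x \<otimes>\<^bsub>K'\<^esub> y | x y. x \<in> lower_central K' j \<and> y \<in> carrier K'}"]
      by (auto intro: K'.bracket_closed)
  qed simp
  have gen: "\<exists>F. ?P (x \<otimes>\<^bsub>L\<^esub> y) F" if x: "x \<in> lower_central L i" and y: "y \<in> carrier L" for x y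
  proof -
    from Suc.IH[OF x] obtain F where F: "finite F" "F \<subseteq> carrier L"
      and FF: "\<And>S. countable_subgroup L S \<Longrightarrow> F \<subseteq> S \<Longrightarrow> (\<forall>x\<in>S. \<forall>y\<in>S. x \<otimes>\<^bsub>L\<^esub> y \<in> S) \<Longrightarrow>
        x \<in> from_nat_into S ` lower_central (nat_copy L S) i" by metis
    show ?thesis
    proof (intro exI[of _ "insert y F"] conjI allI impI)
      fix S assume S: "countable_subgroup L S" "insert y F \<subseteq> S"
        and br: "\<forall>x\<in>S. \<forall>y\<in>S. x \<otimes>\<^bsub>L\<^esub> y \<in> S"
      interpret countable_subgroup L S by fact
      from FF[OF S(1) _ br] S(2) obtain x' where x': "x' \<in> lower_central K i" "x = g x'" by auto
      have x'K: "x' \<in> carrier K"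
        using low_sub[OF lie_ring_nat_copy[OF assms(1) S(1)]] br x' by blast
      have "h y \<in> carrier K" using S(2) by simp
      hence "x' \<otimes>\<^bsub>K\<^esub> h y \<in> lower_central K (Suc i)"
        unfolding lower_central.simps using x'(1) by (intro generate.incl) blast
      moreover have "g (x' \<otimes>\<^bsub>K\<^esub> h y) = x \<otimes>\<^bsub>L\<^esub> y"
        using S(2) x' br x'K by (simp add: mult_K)
      ultimately show "x \<otimes>\<^bsub>L\<^esub> y \<in> g ` lower_central K (Suc i)" by (metis image_eqI)
    qed (use F y in auto)
  qed
  from Suc.prems have "x \<in> generate (add_monoid L)
      {x \<otimes>\<^bsub>L\<^esub> y | x y. x \<in> lower_central L i \<and> y \<in> carrier L}" by simp
  thus "\<exists>F. ?P x F"
  proof (induction rule: generate.induct)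
    case one
    show ?case
    proof (intro exI[of _ "{}"] conjI allI impI)
      fix S assume "countable_subgroup L S"
      then interpret countable_subgroup L S .
      show "\<one>\<^bsub>add_monoid L\<^esub> \<in> g ` lower_central K (Suc i)"
        using generate.one[of "add_monoid K"] by (auto intro!: image_eqI[of _ _ "\<zero>\<^bsub>K\<^esub>"])
    qed auto
  next
    case (incl z)
    then obtain x y where z: "z = x \<otimes>\<^bsub>L\<^esub> y" "x \<in> lower_central L i" "y \<in> carrier L"
      by (elim CollectE exE conjE)
    show ?case unfolding z(1) by (rule gen[OF z(2,3)])
  next
    case (inv z)
    then obtain x y where z: "z = x \<otimes>\<^bsub>L\<^esub> y" "x \<in> lower_central L i" "y \<in> carrier L"
      by (elim CollectE exE conjE)
    from gen[OF z(2,3)] obtain F where F: "?P z F" unfolding z(1) ..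
    show ?case
    proof (intro exI[of _ F] conjI allI impI)
      fix S assume S: "countable_subgroup L S" "F \<subseteq> S" "\<forall>x\<in>S. \<forall>y\<in>S. x \<otimes>\<^bsub>L\<^esub> y \<in> S"
      interpret countable_subgroup L S by fact
      interpret KL: lie_ring K by (rule lie_ring_nat_copy[OF assms(1) S(1)]) (use S(3) in blast)
      from F S(1,3) S(2) have "z \<in> g ` lower_central K (Suc i)" by simp
      then obtain z' where z': "z' \<in> lower_central K (Suc i)" "z = g z'" by blast
      have z'K: "z' \<in> carrier K" using low_sub[OF KL.lie_ring_axioms] z' by blast
      have "\<ominus>\<^bsub>K\<^esub> z' \<in> lower_central K (Suc i)"
        using KL.add.generate_m_inv_closed[OF _ z'(1)[unfolded lower_central.simps]]
          low_sub[OF KL.lie_ring_axioms, of i] KL.bracket_closed by (auto simp: subset_iff)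
      moreover have "g (\<ominus>\<^bsub>K\<^esub> z') = \<ominus>\<^bsub>L\<^esub> z" using g_inv[OF z'K] z' by simp
      ultimately show "inv\<^bsub>add_monoid L\<^esub> z \<in> g ` lower_central K (Suc i)"
        unfolding a_inv_def[symmetric] by (metis image_eqI)
    qed (use F in auto)
  next
    case (eng z1 z2)
    then obtain F1 F2 where F: "?P z1 F1" "?P z2 F2" by (elim exE)
    show ?case
    proof (intro exI[of _ "F1 \<union> F2"] conjI allI impI)
      fix S assume S: "countable_subgroup L S" "F1 \<union> F2 \<subseteq> S" "\<forall>x\<in>S. \<forall>y\<in>S. x \<otimes>\<^bsub>L\<^esub> y \<in> S"
      interpret countable_subgroup L S by fact
      interpret KL: lie_ring K by (rule lie_ring_nat_copy[OF assms(1) S(1)]) (use S(3) in blast)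
      from F(1) S have "z1 \<in> g ` lower_central K (Suc i)" by simp
      then obtain z1' where z1: "z1' \<in> lower_central K (Suc i)" "z1 = g z1'" by blast
      from F(2) S have "z2 \<in> g ` lower_central K (Suc i)" by simp
      then obtain z2' where z2: "z2' \<in> lower_central K (Suc i)" "z2 = g z2'" by blast
      have zK: "z1' \<in> carrier K" "z2' \<in> carrier K"
        using low_sub[OF KL.lie_ring_axioms] z1 z2 by blast+
      have "z1' \<oplus>\<^bsub>K\<^esub> z2' \<in> lower_central K (Suc i)"
        using generate.eng[OF z1(1)[unfolded lower_central.simps] z2(1)[unfolded lower_central.simps]]
        by simp
      moreover have "g (z1' \<oplus>\<^bsub>K\<^esub> z2') = z1 \<oplus>\<^bsub>L\<^esub> z2" using g_add[OF zK] z1 z2 by simp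
      ultimately have "z1 \<oplus>\<^bsub>L\<^esub> z2 \<in> g ` lower_central K (Suc i)" by (metis image_eqI)
      thus "z1 \<otimes>\<^bsub>add_monoid L\<^esub> z2 \<in> g ` lower_central K (Suc i)" by simp
    qed (use F in auto)
  qed
qed

lemma lower_central_zero_mono:
  assumes "lie_ring L" "lower_central L i = {\<zero>\<^bsub>L\<^esub>}" "i \<le> j"
  shows "lower_central L j = {\<zero>\<^bsub>L\<^esub>}"
  using assms(3)
proof (induction rule: dec_induct)
  case base
  show ?case by fact
next
  case (step k)
  interpret lie_ring L by fact
  have z: "\<zero>\<^bsub>L\<^esub> \<otimes>\<^bsub>L\<^esub> y = \<zero>\<^bsub>L\<^esub>" if "y \<in> carrier L" for y
    using bracket_add_left[of "\<zero>\<^bsub>L\<^esub>" "\<zero>\<^bsub>L\<^esub>" y] that bracket_closed[of "\<zero>\<^bsub>L\<^esub>" y]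
    by (simp add: add.l_cancel_one)
  have "{x \<otimes>\<^bsub>L\<^esub> y | x y. x \<in> lower_central L k \<and> y \<in> carrier L} = {\<zero>\<^bsub>L\<^esub>}"
    unfolding step.IH using z by force
  thus ?case using add.generate_one by simp
qed

lemma lower_central_nilpotency_class:
  assumes "lie_ring L" "lie_nilpotent L" "nilpotency_class L \<le> c"
  shows "lower_central L c = {\<zero>\<^bsub>L\<^esub>}"
proof -
  have "lower_central L (nilpotency_class L) = {\<zero>\<^bsub>L\<^esub>}"
    using assms(2) unfolding lie_nilpotent_def nilpotency_class_def by (rule LeastI_ex)
  thus ?thesis using lower_central_zero_mono[OF assms(1) _ assms(3)] by simp
qed

text \<open>A bound for countable Lie rings graded by countable groups holds over arbitrary types.\<close>

theorem higman_bound_all_types: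
  fixes L :: "('a, 'm) ring_scheme" and A :: "('b, 'k) ring_scheme"
  assumes bound: "higman_bound n c" and gr: "higman_graded n L A C"
  shows "lie_nilpotent L \<and> nilpotency_class L \<le> c"
proof -
  from gr obtain X where lie: "lie_ring L" and A: "abelian_group A" and G: "lie_grading L A C"
    and X: "arithmetically_free A X" "finite X" "card X \<le> n" "grading_support L A C \<subseteq> X"
    unfolding higman_graded_def by blast
  interpret L: lie_ring L by fact
  interpret A: abelian_group A by fact
  have XA: "X \<subseteq> carrier A" using X(1) by (simp add: arithmetically_free_def)
  note G' = G[unfolded lie_grading_def]
  have G1: "subgroup (C a) (add_monoid L)" if "a \<in> carrier A" for a
    using bspec[OF conjunct1[OF G'] that] .
  have G2: "\<exists>F f. finite F \<and> F \<subseteq> carrier A \<and> f \<in> Pi F C \<and> x = (\<Oplus>\<^bsub>L\<^esub>a\<in>F. f a)"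
    if "x \<in> carrier L" for x
    using bspec[OF conjunct1[OF conjunct2[OF G']] that] .
  have G3: "f a = \<zero>\<^bsub>L\<^esub>" if "finite F" "F \<subseteq> carrier A" "f \<in> Pi F C"
    "(\<Oplus>\<^bsub>L\<^esub>a\<in>F. f a) = \<zero>\<^bsub>L\<^esub>" "a \<in> F" for F f a
    using conjunct1[OF conjunct2[OF conjunct2[OF G']]] that by simp
  have G4: "x \<otimes>\<^bsub>L\<^esub> y \<in> C (a \<oplus>\<^bsub>A\<^esub> b)"
    if "a \<in> carrier A" "b \<in> carrier A" "x \<in> C a" "y \<in> C b" for a b x y
    using conjunct2[OF conjunct2[OF conjunct2[OF G']]] that by simp
  have CL: "C a \<subseteq> carrier L" if "a \<in> carrier A" for a
    using subgroup.subset[OF G1[OF that]] by simp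
  have C0: "\<zero>\<^bsub>L\<^esub> \<in> C a" if "a \<in> carrier A" for a
    using subgroup.one_closed[OF G1[OF that]] by simp
  have Cadd: "x \<oplus>\<^bsub>L\<^esub> y \<in> C a" if "a \<in> carrier A" "x \<in> C a" "y \<in> C a" for a x y
    using subgroup.m_closed[OF G1[OF that(1)]] that by simp
  have Cinv: "\<ominus>\<^bsub>L\<^esub> x \<in> C a" if "a \<in> carrier A" "x \<in> C a" for a x
    using subgroup.m_inv_closed[OF G1[OF that(1)]] that by (simp add: a_inv_def)
  have Cout: "C a = {\<zero>\<^bsub>L\<^esub>}" if "a \<in> carrier A" "a \<notin> X" for a
    using X(4) that by (auto simp: grading_support_def)
  have "\<exists>f. f \<in> Pi X C \<and> x = (\<Oplus>\<^bsub>L\<^esub>a\<in>X. f a)" if "x \<in> carrier L" for x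
  proof -
    from G2[OF that] obtain F f where F: "finite F" "F \<subseteq> carrier A" "f \<in> Pi F C"
      "x = (\<Oplus>\<^bsub>L\<^esub>a\<in>F. f a)" by blast
    define f' where "f' a = (if a \<in> F then f a else \<zero>\<^bsub>L\<^esub>)" for a
    have f'C: "f' \<in> Pi (F \<union> X) C" using F(3) C0 XA by (auto simp: f'_def Pi_iff)
    have f'L: "f' \<in> F \<union> X \<rightarrow> carrier L"
    proof (rule Pi_I)
      fix a assume "a \<in> F \<union> X"
      thus "f' a \<in> carrier L" using f'C CL[of a] F(2) XA by (auto simp: Pi_iff)
    qed
    have "x = (\<Oplus>\<^bsub>L\<^esub>a\<in>F. f' a)" unfolding F(4)
      by (rule L.finsum_cong') (use F(3) CL F(2) in \<open>auto simp: f'_def Pi_iff\<close>)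
    also have "\<dots> = (\<Oplus>\<^bsub>L\<^esub>a\<in>F \<union> X. f' a)"
      by (rule L.add.finprod_mono_neutral_cong_left)
        (use F(1) X(2) f'L in \<open>auto simp: f'_def[abs_def]\<close>)
    also have "\<dots> = (\<Oplus>\<^bsub>L\<^esub>a\<in>X. f' a)"
    proof -
      have "\<forall>a\<in>F \<union> X - X. f' a = \<zero>\<^bsub>L\<^esub>"
      proof
        fix a assume a: "a \<in> F \<union> X - X"
        hence "f' a \<in> C a" using f'C by (auto simp: Pi_iff)
        thus "f' a = \<zero>\<^bsub>L\<^esub>" using Cout[of a] F(2) a by auto
      qed
      thus ?thesis
        by (intro L.add.finprod_mono_neutral_cong_right) (use F X(2) f'L in auto)
    qed
    finally show ?thesis using f'C by blast
  qed
  then obtain dec where dec: "\<And>x. x \<in> carrier L \<Longrightarrow> dec x \<in> Pi X C"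
    "\<And>x. x \<in> carrier L \<Longrightarrow> x = (\<Oplus>\<^bsub>L\<^esub>a\<in>X. dec x a)" by metis

  have "x = \<zero>\<^bsub>L\<^esub>" if x: "x \<in> lower_central L c" for x
  proof -
    from lower_central_mono_hom[OF lie x] obtain F where F: "finite F" "F \<subseteq> carrier L"
      and FF: "\<And>S. countable_subgroup L S \<Longrightarrow> F \<subseteq> S \<Longrightarrow> (\<forall>x\<in>S. \<forall>y\<in>S. x \<otimes>\<^bsub>L\<^esub> y \<in> S) \<Longrightarrow>
        x \<in> from_nat_into S ` lower_central (nat_copy L S) c" by metis
    obtain S0 where S0: "countable S0" "insert \<zero>\<^bsub>L\<^esub> F \<subseteq> S0"
      "\<forall>u\<in>insert (\<lambda>x. \<ominus>\<^bsub>L\<^esub> x) ((\<lambda>a x. dec x a) ` X). \<forall>x\<in>S0. u x \<in> S0"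
      "\<forall>b\<in>{(\<lambda>x y. x \<oplus>\<^bsub>L\<^esub> y), (\<lambda>x y. x \<otimes>\<^bsub>L\<^esub> y)}. \<forall>x\<in>S0. \<forall>y\<in>S0. b x y \<in> S0"
      using countable_closure[of "insert \<zero>\<^bsub>L\<^esub> F" "insert (\<lambda>x. \<ominus>\<^bsub>L\<^esub> x) ((\<lambda>a x. dec x a) ` X)"
        "{(\<lambda>x y. x \<oplus>\<^bsub>L\<^esub> y), (\<lambda>x y. x \<otimes>\<^bsub>L\<^esub> y)}"] F X(2) by (auto simp: countable_finite)
    define S where "S = S0 \<inter> carrier L"
    have SS: "countable_subgroup L S"
      by unfold_locales (use S0 in \<open>auto simp: S_def\<close>)
    have FS: "F \<subseteq> S" using S0 F by (auto simp: S_def)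
    have Sbr: "\<forall>x\<in>S. \<forall>y\<in>S. x \<otimes>\<^bsub>L\<^esub> y \<in> S" using S0 L.bracket_closed by (auto simp: S_def)
    have Sdec: "dec x a \<in> S" if "x \<in> S" "a \<in> X" for x a
      using that S0 dec(1)[of x] CL[of a] XA by (auto simp: S_def Pi_iff)
    obtain B0 where B0: "countable B0" "insert \<zero>\<^bsub>A\<^esub> X \<subseteq> B0"
      "\<forall>u\<in>{(\<lambda>x. \<ominus>\<^bsub>A\<^esub> x)}. \<forall>x\<in>B0. u x \<in> B0"
      "\<forall>b\<in>{(\<lambda>x y. x \<oplus>\<^bsub>A\<^esub> y)}. \<forall>x\<in>B0. \<forall>y\<in>B0. b x y \<in> B0"
      using countable_closure[of "insert \<zero>\<^bsub>A\<^esub> X" "{(\<lambda>x. \<ominus>\<^bsub>A\<^esub> x)}" "{(\<lambda>x y. x \<oplus>\<^bsub>A\<^esub> y)}"] X(2)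
      by (auto simp: countable_finite)
    define B where "B = B0 \<inter> carrier A"
    have BB: "countable_subgroup A B"
      by unfold_locales (use B0 in \<open>auto simp: B_def\<close>)
    have XB: "X \<subseteq> B" using B0 XA by (auto simp: B_def)
    interpret S: countable_subgroup L S by fact
    interpret B: countable_subgroup A B by fact
    interpret KL: lie_ring S.K by (rule lie_ring_nat_copy[OF lie SS]) (use Sbr in blast)
    interpret KA: abelian_group B.K by (rule B.abelian_group_K)
    define C' where "C' a = S.h ` (C (B.g a) \<inter> S)" for a
    have C'g: "S.g y \<in> C (B.g a)" "y \<in> carrier S.K" if "y \<in> C' a" for y a
      using that by (auto simp: C'_def)
    have C'I: "y \<in> C' a" if "y \<in> carrier S.K" "S.g y \<in> C (B.g a)" for y a
      unfolding C'_def using that by (intro image_eqI[of _ _ "S.g y"]) auto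
    have grad: "lie_grading S.K B.K C'"
      unfolding lie_grading_def
    proof (intro conjI ballI allI impI)
      fix a assume a: "a \<in> carrier B.K"
      show "subgroup (C' a) (add_monoid S.K)"
      proof (rule KL.add.subgroupI)
        show "C' a \<subseteq> carrier S.K" using C'g(2) by blast
        have "\<zero>\<^bsub>S.K\<^esub> \<in> C' a" by (rule C'I) (use a C0 in auto)
        thus "C' a \<noteq> {}" by blast
        show "\<ominus>\<^bsub>S.K\<^esub> y \<in> C' a" if "y \<in> C' a" for y
          by (rule C'I) (use that a C'g[OF that] Cinv in \<open>auto simp: S.g_inv\<close>)
        show "y \<oplus>\<^bsub>S.K\<^esub> z \<in> C' a" if "y \<in> C' a" "z \<in> C' a" for y z
          by (rule C'I) (use that a C'g[OF that(1)] C'g[OF that(2)] Cadd in \<open>auto simp: S.g_add\<close>)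
      qed
    next
      fix y assume y: "y \<in> carrier S.K"
      define f where "f a = S.h (dec (S.g y) (B.g a))" for a
      have XX: "B.g (B.h a) = a" if "a \<in> X" for a using that XB by auto
      have inj: "inj_on B.h X" using XX by (rule inj_on_inverseI)
      have fC: "f \<in> Pi (B.h ` X) C'"
        using Sdec[of "S.g y"] y dec(1)[of "S.g y"] by (auto simp: f_def C'_def XX Pi_iff)
      have fK: "f \<in> B.h ` X \<rightarrow> carrier S.K" using fC C'g(2) by blast
      have "S.g (\<Oplus>\<^bsub>S.K\<^esub>a\<in>B.h ` X. f a) = (\<Oplus>\<^bsub>L\<^esub>a\<in>B.h ` X. S.g (f a))"
        by (rule S.g_finsum) (use fK X(2) in auto)
      also have "\<dots> = (\<Oplus>\<^bsub>L\<^esub>a\<in>X. S.g (f (B.h a)))"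
        by (rule L.finsum_reindex[OF _ inj]) (use fK in \<open>auto simp: Pi_iff\<close>)
      also have "\<dots> = (\<Oplus>\<^bsub>L\<^esub>a\<in>X. dec (S.g y) a)"
      proof (rule L.finsum_cong')
        show "dec (S.g y) \<in> X \<rightarrow> carrier L" using Sdec[of "S.g y"] y S.S_sub by auto
        show "S.g (f (B.h a)) = dec (S.g y) a" if "a \<in> X" for a
          using that Sdec[of "S.g y"] y by (simp add: f_def XX)
      qed simp
      also have "\<dots> = S.g y" using dec(2)[of "S.g y"] y by simp
      finally have "y = (\<Oplus>\<^bsub>S.K\<^esub>a\<in>B.h ` X. f a)"
        using S.g_inj[OF y KL.finsum_closed[OF fK]] by simp
      thus "\<exists>F f. finite F \<and> F \<subseteq> carrier B.K \<and> f \<in> Pi F C' \<and> y = (\<Oplus>\<^bsub>S.K\<^esub>a\<in>F. f a)"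
        using fC X(2) XB by (intro exI[of _ "B.h ` X"] exI[of _ f]) auto
    next
      fix F f a assume F: "finite F" "F \<subseteq> carrier B.K" "f \<in> Pi F C'"
        "(\<Oplus>\<^bsub>S.K\<^esub>a\<in>F. f a) = \<zero>\<^bsub>S.K\<^esub>" "a \<in> F"
      have fK: "f \<in> F \<rightarrow> carrier S.K" using F(3) C'g(2) by blast
      have inj: "inj_on B.g F" using F(2) B.g_inj by (auto intro!: inj_onI)
      have BF: "B.h (B.g a) = a" if "a \<in> F" for a using that F(2) by auto
      define f' where "f' b = S.g (f (B.h b))" for b
      have f'C: "f' \<in> Pi (B.g ` F) C" using F(3) C'g(1) by (auto simp: f'_def BF Pi_iff)
      have "(\<Oplus>\<^bsub>L\<^esub>b\<in>B.g ` F. f' b) = (\<Oplus>\<^bsub>L\<^esub>a\<in>F. f' (B.g a))"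
        by (rule L.finsum_reindex[OF _ inj]) (use fK in \<open>auto simp: f'_def BF Pi_iff\<close>)
      also have "\<dots> = (\<Oplus>\<^bsub>L\<^esub>a\<in>F. S.g (f a))"
        by (rule L.finsum_cong') (use fK in \<open>auto simp: f'_def BF Pi_iff\<close>)
      also have "\<dots> = S.g (\<Oplus>\<^bsub>S.K\<^esub>a\<in>F. f a)" using S.g_finsum[OF F(1) fK] by simp
      also have "\<dots> = \<zero>\<^bsub>L\<^esub>" using F(4) by simp
      finally have "f' (B.g a) = \<zero>\<^bsub>L\<^esub>"
        using G3[of "B.g ` F" f' "B.g a"] F(1,5) subsetD[OF F(2)] f'C by (auto simp: image_subset_iff)
      hence "S.g (f a) = S.g \<zero>\<^bsub>S.K\<^esub>" using F(5) by (simp add: f'_def BF)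
      thus "f a = \<zero>\<^bsub>S.K\<^esub>" using S.g_inj fK F(5) by blast
    next
      fix a b y z assume ab: "a \<in> carrier B.K" "b \<in> carrier B.K" and yz: "y \<in> C' a" "z \<in> C' b"
      note y = C'g[OF yz(1)] and z = C'g[OF yz(2)]
      show "y \<otimes>\<^bsub>S.K\<^esub> z \<in> C' (a \<oplus>\<^bsub>B.K\<^esub> b)"
        by (rule C'I)
          (use y z ab G4[of "B.g a" "B.g b"] Sbr in \<open>auto simp: S.mult_K B.g_add\<close>)
    qed
    have "arithmetically_free B.K (B.h ` X)"
      unfolding arithmetically_free_def
    proof (intro conjI notI)
      show "B.h ` X \<subseteq> carrier B.K" using XB by auto
      assume "\<exists>\<alpha>\<in>B.h ` X. \<exists>\<beta>\<in>B.h ` X. \<forall>k::nat. \<alpha> \<oplus>\<^bsub>B.K\<^esub> [k] \<cdot>\<^bsub>B.K\<^esub> \<beta> \<in> B.h ` X"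
      then obtain p q where pq: "p \<in> X" "q \<in> X"
        and k: "\<And>k::nat. B.h p \<oplus>\<^bsub>B.K\<^esub> [k] \<cdot>\<^bsub>B.K\<^esub> B.h q \<in> B.h ` X" by blast
      have "p \<oplus>\<^bsub>A\<^esub> [k] \<cdot>\<^bsub>A\<^esub> q \<in> X" for k :: nat
      proof -
        have pB: "p \<in> B" "q \<in> B" using pq XB by auto
        have "B.g (B.h p \<oplus>\<^bsub>B.K\<^esub> [k] \<cdot>\<^bsub>B.K\<^esub> B.h q) = p \<oplus>\<^bsub>A\<^esub> [k] \<cdot>\<^bsub>A\<^esub> q"
          using pB by (simp add: B.g_add B.g_pow KA.add.nat_pow_closed)
        moreover have "B.g (B.h p \<oplus>\<^bsub>B.K\<^esub> [k] \<cdot>\<^bsub>B.K\<^esub> B.h q) \<in> X" using k[of k] XB by auto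
        ultimately show ?thesis by simp
      qed
      thus False using X(1) pq unfolding arithmetically_free_def by blast
    qed
    moreover have "card (B.h ` X) \<le> n" using X(2,3) card_image_le le_trans by blast
    moreover have "grading_support S.K B.K C' \<subseteq> B.h ` X"
    proof
      fix a assume a: "a \<in> grading_support S.K B.K C'"
      hence aK: "a \<in> carrier B.K" by (simp add: grading_support_def)
      have "B.g a \<in> X"
      proof (rule ccontr)
        assume "B.g a \<notin> X"
        hence "C (B.g a) = {\<zero>\<^bsub>L\<^esub>}" using Cout aK by simp
        hence "C' a = {\<zero>\<^bsub>S.K\<^esub>}" using S.S_zero by (auto simp: C'_def S.zero_K)
        thus False using a by (simp add: grading_support_def)
      qed
      thus "a \<in> B.h ` X" using aK by (metis B.hg image_eqI)
    qed
    ultimately have "higman_graded n S.K B.K C'"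
      unfolding higman_graded_def using grad KL.lie_ring_axioms KA.abelian_group_axioms X(2)
      by blast
    hence "lie_nilpotent S.K \<and> nilpotency_class S.K \<le> c"
      using bound unfolding higman_bound_def by blast
    hence "lower_central S.K c = {\<zero>\<^bsub>S.K\<^esub>}"
      using lower_central_nilpotency_class[OF KL.lie_ring_axioms] by blast
    thus ?thesis using FF[OF SS FS Sbr] by auto
  qed
  moreover have "\<zero>\<^bsub>L\<^esub> \<in> lower_central L c"
  proof (cases c)
    case (Suc i)
    thus ?thesis using generate.one[of "add_monoid L"] by simp
  qed simp
  ultimately have "lower_central L c = {\<zero>\<^bsub>L\<^esub>}" by blast
  thus ?thesis unfolding lie_nilpotent_def nilpotency_class_def by (blast intro: Least_le)
qed

end

theory Submission
  imports Defs "HOL-Computational_Algebra.Fundamental_Theorem_Algebra"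
begin

text \<open>Let \<open>a\<close> be the leading coefficient of \<open>r\<close>. The numbers \<open>a \<lambda>\<close>, for \<open>\<lambda>\<close> a root of \<open>r\<close>, are
  algebraic integers and lie in a subring \<open>S\<close> of \<open>\<complex>\<close> that is free of finite rank over \<open>\<int>\<close>. Since
  \<open>S\<close> contains no rational numbers besides the integers, \<open>L\<close> embeds into \<open>L \<otimes> S\<close>. On this Lie ring
  the torsion hypothesis makes multiplication by \<open>a\<close>, by the differences \<open>a \<lambda> - a \<mu>\<close> and, if
  \<open>\<lambda> + \<mu>\<close> is not a root, by \<open>a \<lambda> + a \<mu> - a \<kappa>\<close> injective, for all of these divide a power of \<open>a\<close>
  times \<open>\<delta>(r)\<close> or \<open>\<sigma>(r)\<close>. Hence the generalized eigenspaces of \<open>a D\<close> form a direct sum that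
  contains a multiple of \<open>L \<otimes> S\<close> by a regular scalar and is a Lie subring graded by the roots,
  a finite set without \<open>0\<close> in a torsion-free group, and so an arithmetically free set. This bounds
  the class by \<open>H(n)\<close>.

  That \<open>H(n)\<close> is finite is not presupposed, so nilpotency itself needs a separate argument: by
  Kreknin's method a Lie ring with such a grading is solvable, and it then acts nilpotently on
  itself by descent along the derived series.\<close>


section \<open>Subrings of the complex numbers\<close>

text \<open>The integers \<open>delta r\<close> and \<open>sigma r\<close> are given by definite
  description, so their divisors can be discussed only after the defining complex numbers are known
  to be integers. This is shown without Galois theory, as a conjunction of two facts: the numbers
  are algebraic integers, by a form of Gauss's lemma for products of roots, and they are rational,
  since the values of a rational polynomial at the roots of another one have a rational product, by
  the Euclidean algorithm. \<open>L\<close> may still have torsion prime to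
  \<open>delta r * sigma r\<close>, so there is no passage to a vector space. Linear algebra is done
  with Bezout identities whose right-hand side is a regular constant instead of 1. Differences of
  roots make the eigenspaces independent and large; the values behind \<open>sigma r\<close> make a
  bracket vanish when its degree leaves the set of roots, which keeps the support finite. The
  derivation is scaled by \<open>a\<close> because the roots need not be integral, and a spare
  factor \<open>a\<close> in \<open>sigma r\<close> makes this scaling harmless.\<close>

definition polys_over :: "complex set \<Rightarrow> complex poly set" where
  "polys_over S = {p. \<forall>k. coeff p k \<in> S}"

locale complex_subring =
  fixes S :: "complex set"
  assumes one_in [simp, intro]: "1 \<in> S"
    and diff_in [intro]: "\<lbrakk>x \<in> S; y \<in> S\<rbrakk> \<Longrightarrow> x - y \<in> S"
    and mult_in [intro]: "\<lbrakk>x \<in> S; y \<in> S\<rbrakk> \<Longrightarrow> x * y \<in> S"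
begin

lemma zero_in [simp, intro]: "0 \<in> S"
  using diff_in[of 1 1] by simp

lemma uminus_in [intro]: "x \<in> S \<Longrightarrow> - x \<in> S"
  using diff_in[of 0 x] by simp

lemma add_in [intro]: "\<lbrakk>x \<in> S; y \<in> S\<rbrakk> \<Longrightarrow> x + y \<in> S"
  using diff_in[of x "- y"] by auto

lemma sum_in: "(\<And>i. i \<in> A \<Longrightarrow> f i \<in> S) \<Longrightarrow> sum f A \<in> S"
  by (induction A rule: infinite_finite_induct) auto

lemma prod_in: "(\<And>i. i \<in> A \<Longrightarrow> f i \<in> S) \<Longrightarrow> prod f A \<in> S"
  by (induction A rule: infinite_finite_induct) auto

lemma power_in [intro]: "x \<in> S \<Longrightarrow> x ^ n \<in> S"
  by (induction n) auto

lemma of_nat_in [simp, intro]: "of_nat n \<in> S"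
  by (induction n) auto

lemma of_int_in [simp, intro]: "of_int k \<in> S"
  by (cases k rule: int_cases2) (auto simp del: of_nat_Suc)

lemma poly_eval_in: "\<lbrakk>p \<in> polys_over S; x \<in> S\<rbrakk> \<Longrightarrow> poly p x \<in> S"
  unfolding poly_altdef by (intro sum_in mult_in power_in) (auto simp: polys_over_def)

lemma polys_zero [simp, intro]: "0 \<in> polys_over S"
  by (simp add: polys_over_def)

lemma polys_pCons [intro]: "\<lbrakk>c \<in> S; p \<in> polys_over S\<rbrakk> \<Longrightarrow> pCons c p \<in> polys_over S"
  by (auto simp: polys_over_def coeff_pCons split: nat.split)

lemma polys_pConsD: "pCons c p \<in> polys_over S \<Longrightarrow> c \<in> S \<and> p \<in> polys_over S"
proof -
  assume "pCons c p \<in> polys_over S"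
  hence *: "coeff (pCons c p) k \<in> S" for k by (simp add: polys_over_def)
  show ?thesis using *[of 0] *[of "Suc _"] by (simp add: polys_over_def)
qed

lemma polys_one [simp, intro]: "1 \<in> polys_over S"
  by (auto simp: one_pCons)

lemma polys_diff [intro]: "\<lbrakk>p \<in> polys_over S; q \<in> polys_over S\<rbrakk> \<Longrightarrow> p - q \<in> polys_over S"
  by (auto simp: polys_over_def)

lemma polys_add [intro]: "\<lbrakk>p \<in> polys_over S; q \<in> polys_over S\<rbrakk> \<Longrightarrow> p + q \<in> polys_over S"
  by (auto simp: polys_over_def)

lemma polys_uminus [intro]: "p \<in> polys_over S \<Longrightarrow> - p \<in> polys_over S"
  by (auto simp: polys_over_def)

lemma polys_smult [intro]: "\<lbrakk>c \<in> S; p \<in> polys_over S\<rbrakk> \<Longrightarrow> smult c p \<in> polys_over S"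
  by (auto simp: polys_over_def)

lemma polys_mult [intro]: "\<lbrakk>p \<in> polys_over S; q \<in> polys_over S\<rbrakk> \<Longrightarrow> p * q \<in> polys_over S"
  by (auto simp: polys_over_def coeff_mult intro!: sum_in)

lemma polys_monom [intro]: "c \<in> S \<Longrightarrow> monom c n \<in> polys_over S"
  by (auto simp: polys_over_def)

lemma polys_sum: "(\<And>i. i \<in> A \<Longrightarrow> f i \<in> polys_over S) \<Longrightarrow> sum f A \<in> polys_over S"
  by (induction A rule: infinite_finite_induct) auto

lemma polys_prod: "(\<And>i. i \<in> A \<Longrightarrow> f i \<in> polys_over S) \<Longrightarrow> prod f A \<in> polys_over S"
  by (induction A rule: infinite_finite_induct) auto

lemma polys_power [intro]: "p \<in> polys_over S \<Longrightarrow> p ^ n \<in> polys_over S"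
  by (induction n) auto

lemma polys_pderiv [intro]: "p \<in> polys_over S \<Longrightarrow> pderiv p \<in> polys_over S"
  unfolding polys_over_def by (auto simp: coeff_pderiv intro!: mult_in simp flip: of_nat_Suc)

lemma polys_pcompose: "\<lbrakk>p \<in> polys_over S; q \<in> polys_over S\<rbrakk> \<Longrightarrow> pcompose p q \<in> polys_over S"
proof (induction p)
  case (pCons a p)
  have "a \<in> S" "p \<in> polys_over S" using polys_pConsD pCons.prems(1) by blast+
  thus ?case using pCons by (auto simp: pcompose_pCons)
qed auto

lemma polys_cpoly [simp, intro]: "cpoly p \<in> polys_over S"
  by (simp add: polys_over_def coeff_map_poly)

text \<open>The reason is that \<open>U(\<nu>) - U\<close> is a multiple of \<open>t - \<nu>\<close>.\<close>

lemma eval_power_in_ideal: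
  assumes U: "U \<in> polys_over S" and nu: "nu \<in> S"
  shows "\<exists>A\<in>polys_over S. \<exists>B\<in>polys_over S. [:poly U nu ^ K:] = A * U + B * [:-nu, 1:] ^ K"
proof -
  define q where "q = synthetic_div U nu"
  have eq: "[:poly U nu:] = U - [:-nu, 1:] * q"
    using synthetic_div_correct'[of nu U] unfolding q_def by (simp only: eq_diff_eq add.commute)
  have q: "q \<in> polys_over S"
  proof -
    have "synthetic_div p nu \<in> polys_over S" if "p \<in> polys_over S" for p
      using that
    proof (induction p)
      case (pCons a p)
      have "p \<in> polys_over S" using polys_pConsD pCons.prems by blast
      thus ?case using pCons.IH poly_eval_in[OF _ nu, of p] by (simp add: synthetic_div_pCons polys_pCons)
    qed auto
    thus ?thesis using U by (simp add: q_def)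
  qed
  show ?thesis
  proof (induction K)
    case 0
    have "[:poly U nu ^ 0:] = 0 * U + 1 * [:-nu, 1:] ^ 0" by (simp add: one_pCons)
    thus ?case using polys_zero polys_one by blast
  next
    case (Suc K)
    then obtain A B where AB: "A \<in> polys_over S" "B \<in> polys_over S"
      "[:poly U nu ^ K:] = A * U + B * [:-nu, 1:] ^ K" by (elim bexE)
    define X where "X = [:-nu, 1:]"
    \<comment> \<open>When the identity for \<open>K\<close> is multiplied by
      \<open>U - X * q\<close>, the only product without a factor \<open>U\<close> is
      \<open>- B * q * X ^ Suc K\<close>.\<close>
    have "[:poly U nu ^ Suc K:] = (A * U + B * X ^ K) * (U - X * q)"
      unfolding X_def AB(3)[symmetric] eq[symmetric] by simp
    also have "\<dots> = (A * (U - X * q) + B * X ^ K) * U + (- (B * q)) * X ^ Suc K"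
      by (simp add: algebra_simps)
    finally have eq': "[:poly U nu ^ Suc K:] = (A * (U - [:-nu, 1:] * q) + B * [:-nu, 1:] ^ K) * U
        + (- (B * q)) * [:-nu, 1:] ^ Suc K" by (simp only: X_def)
    show ?case
    proof (intro bexI)
      show "[:poly U nu ^ Suc K:] = (A * (U - [:-nu, 1:] * q) + B * [:-nu, 1:] ^ K) * U
        + (- (B * q)) * [:-nu, 1:] ^ Suc K" by (rule eq')
      have "[:-nu, 1:] \<in> polys_over S" using nu by auto
      thus "A * (U - [:-nu, 1:] * q) + B * [:-nu, 1:] ^ K \<in> polys_over S"
        using AB(1,2) q U by (intro polys_add polys_mult polys_diff polys_power)
      show "- (B * q) \<in> polys_over S" using AB(2) q by (intro polys_uminus polys_mult)
    qed
  qed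
qed

end

interpretation Rats: complex_subring "\<rat>"
  by unfold_locales auto


section \<open>Integrality\<close>

inductive_set int_span :: "complex set \<Rightarrow> complex set" for B where
  zero: "0 \<in> int_span B"
| base: "b \<in> B \<Longrightarrow> b \<in> int_span B"
| diff: "\<lbrakk>x \<in> int_span B; y \<in> int_span B\<rbrakk> \<Longrightarrow> x - y \<in> int_span B"

lemma int_span_uminus: "x \<in> int_span B \<Longrightarrow> - x \<in> int_span B"
  using int_span.diff[OF int_span.zero, of x] by simp

lemma int_span_add: "\<lbrakk>x \<in> int_span B; y \<in> int_span B\<rbrakk> \<Longrightarrow> x + y \<in> int_span B"
  using int_span.diff[OF _ int_span_uminus, of x B y] by simp

lemma int_span_sum: "(\<And>i. i \<in> A \<Longrightarrow> f i \<in> int_span B) \<Longrightarrow> sum f A \<in> int_span B"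
  by (induction A rule: infinite_finite_induct) (auto intro: int_span.zero int_span_add)

lemma int_span_mono: "B \<subseteq> int_span B' \<Longrightarrow> int_span B \<subseteq> int_span B'"
proof
  fix x assume B: "B \<subseteq> int_span B'" and x: "x \<in> int_span B"
  show "x \<in> int_span B'" using x by (induction rule: int_span.induct) (use B in \<open>auto intro: int_span.diff int_span.zero\<close>)
qed

lemma int_span_mult_closed:
  assumes "x \<in> int_span B" "\<And>b. b \<in> B \<Longrightarrow> y * b \<in> int_span B'"
  shows "y * x \<in> int_span B'"
  using assms(1)
  by (induction rule: int_span.induct)
    (simp_all add: right_diff_distrib assms(2) int_span.diff int_span.zero)

lemma int_span_scale: "x \<in> int_span B \<Longrightarrow> of_int k * x \<in> int_span B"
proof -
  assume x: "x \<in> int_span B"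
  have n: "of_nat n * x \<in> int_span B" for n
    by (induction n) (auto simp: algebra_simps intro: int_span.zero int_span_add x)
  show ?thesis
    by (cases k rule: int_cases2) (auto simp del: of_nat_Suc intro: n int_span_uminus)
qed

text \<open>Orders in number fields. The finite generating set of the additive group certifies that
  every element is integral.\<close>

definition complex_order :: "complex set \<Rightarrow> bool" where
  "complex_order S \<longleftrightarrow> (\<exists>B. finite B \<and> S = int_span B) \<and> 1 \<in> S \<and> (\<forall>x\<in>S. \<forall>y\<in>S. x * y \<in> S)"

lemma complex_order_subring: "complex_order S \<Longrightarrow> complex_subring S"
  by unfold_locales (auto simp: complex_order_def intro: int_span.diff)

lemma complex_order_Ints: "complex_order (int_span {1})"
  unfolding complex_order_def
proof (intro conjI ballI)
  show "x * y \<in> int_span {1}" if "x \<in> int_span {1}" "y \<in> int_span {1}" for x y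
    using int_span_mult_closed[OF that(2), of x "{1}"] that(1) by simp
qed (auto intro: int_span.base)

text \<open>The products of a generator of \<open>S\<close> with a generator of \<open>T\<close>
  span a ring: a product of two of them regroups as an element of \<open>S\<close> times an element
  of \<open>T\<close>.\<close>

lemma complex_order_join:
  assumes "complex_order S" "complex_order T"
  shows "\<exists>U. complex_order U \<and> S \<subseteq> U \<and> T \<subseteq> U"
proof -
  obtain B C where B: "finite B" "S = int_span B" "1 \<in> S" "\<And>x y. \<lbrakk>x \<in> S; y \<in> S\<rbrakk> \<Longrightarrow> x * y \<in> S"
    and C: "finite C" "T = int_span C" "1 \<in> T" "\<And>x y. \<lbrakk>x \<in> T; y \<in> T\<rbrakk> \<Longrightarrow> x * y \<in> T"
    using assms unfolding complex_order_def by metis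
  define D where "D = (\<lambda>(b, c). b * c) ` (B \<times> C)"
  have prod: "x * y \<in> int_span D" if "x \<in> S" "y \<in> T" for x y
  proof (rule int_span_mult_closed[of y C])
    fix c assume c: "c \<in> C"
    have "c * x \<in> int_span D"
      by (rule int_span_mult_closed[of x B])
        (use c that B(2) in \<open>auto simp: D_def mult.commute intro!: int_span.base\<close>)
    thus "x * c \<in> int_span D" by (simp add: mult.commute)
  qed (use that C(2) in auto)
  have "complex_order (int_span D)"
    unfolding complex_order_def
  proof (intro conjI ballI)
    show "\<exists>B. finite B \<and> int_span D = int_span B"
      using B(1) C(1) by (intro exI[of _ D]) (simp add: D_def)
    show "1 \<in> int_span D" using prod[OF B(3) C(3)] by simp
    fix x y assume x: "x \<in> int_span D" and y: "y \<in> int_span D"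
    show "x * y \<in> int_span D"
    proof (rule int_span_mult_closed[OF y])
      fix d assume "d \<in> D"
      then obtain b c where d: "b \<in> S" "c \<in> T" "d = b * c"
        unfolding D_def B(2) C(2) by (auto intro: int_span.base)
      have "d * x \<in> int_span D"
      proof (rule int_span_mult_closed[OF x])
        fix e assume "e \<in> D"
        then obtain b' c' where e: "b' \<in> S" "c' \<in> T" "e = b' * c'"
          unfolding D_def B(2) C(2) by (auto intro: int_span.base)
        have "d * e = (b * b') * (c * c')" using d e by simp
        thus "d * e \<in> int_span D" using prod[OF B(4)[OF d(1) e(1)] C(4)[OF d(2) e(2)]] by simp
      qed
      thus "x * d \<in> int_span D" by (simp add: mult.commute)
    qed
  qed
  moreover have "S \<subseteq> int_span D" using prod[OF _ C(3)] by auto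
  moreover have "T \<subseteq> int_span D" using prod[OF B(3)] by auto
  ultimately show ?thesis by blast
qed

text \<open>\<open>S[z]\<close> is spanned by the \<open>b * z ^ k\<close> with \<open>b\<close> a
  generator of \<open>S\<close> and \<open>k < n\<close>; the monic equation brings
  \<open>z ^ n\<close> back into this span.\<close>

lemma complex_order_adjoin:
  assumes S: "complex_order S" and z: "z ^ n = (\<Sum>k<n. s k * z ^ k)" and s: "\<And>k. k < n \<Longrightarrow> s k \<in> S"
  shows "\<exists>T. complex_order T \<and> S \<subseteq> T \<and> z \<in> T"
proof -
  obtain B where B: "finite B" "S = int_span B" "1 \<in> S" "\<And>x y. \<lbrakk>x \<in> S; y \<in> S\<rbrakk> \<Longrightarrow> x * y \<in> S"
    using S unfolding complex_order_def by metis
  have n: "n > 0" using z by (cases n) auto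
  define D where "D = (\<lambda>(b, k). b * z ^ k) ` (B \<times> {..<n})"
  define T where "T = int_span D"
  have 1: "x * z ^ k \<in> T" if "x \<in> S" "k < n" for x k
  proof -
    have "z ^ k * x \<in> int_span D"
      by (rule int_span_mult_closed[of x B])
        (use that B(2) in \<open>auto simp: D_def mult.commute intro!: int_span.base\<close>)
    thus ?thesis by (simp add: T_def mult.commute)
  qed
  have D: "\<exists>b k. b \<in> S \<and> k < n \<and> d = b * z ^ k" if "d \<in> D" for d
    using that unfolding D_def B(2) by (auto intro: int_span.base)
  have 2: "z * t \<in> T" if t: "t \<in> T" for t
    unfolding T_def
  proof (rule int_span_mult_closed[OF t[unfolded T_def]])
    fix d assume "d \<in> D"
    then obtain b k where d: "b \<in> S" "k < n" "d = b * z ^ k" using D by blast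
    show "z * d \<in> int_span D"
    proof (cases "Suc k < n")
      case True
      thus ?thesis using 1[OF d(1) True] by (simp add: T_def d(3) mult_ac)
    next
      case False
      hence "z * d = b * z ^ n" using d by (metis Suc_lessI mult.left_commute power_Suc)
      also have "\<dots> = (\<Sum>k<n. (b * s k) * z ^ k)" by (simp add: z sum_distrib_left mult.assoc)
      also have "\<dots> \<in> int_span D"
        using 1 B(4) s d(1) by (intro int_span_sum) (auto simp: T_def)
      finally show ?thesis .
    qed
  qed
  have 2: "z ^ k * t \<in> T" if "t \<in> T" for t k
    using that by (induction k) (auto simp: mult.assoc intro: 2)
  have 3: "x * t \<in> T" if x: "x \<in> S" and t: "t \<in> T" for x t
    unfolding T_def
  proof (rule int_span_mult_closed[OF t[unfolded T_def]])
    fix d assume "d \<in> D"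
    then obtain b k where d: "b \<in> S" "k < n" "d = b * z ^ k" using D by blast
    show "x * d \<in> int_span D" using 1[OF B(4)[OF x d(1)] d(2)] by (simp add: d(3) T_def mult.assoc)
  qed
  have 4: "t * t' \<in> T" if t: "t \<in> T" and t': "t' \<in> T" for t t'
  proof -
    have "t' * t \<in> T"
      unfolding T_def
    proof (rule int_span_mult_closed[OF t[unfolded T_def]])
      fix d assume "d \<in> D"
      then obtain b k where d: "b \<in> S" "k < n" "d = b * z ^ k" using D by blast
      show "t' * d \<in> int_span D"
        using 3[OF d(1) 2[OF t', of k]] by (simp add: d(3) T_def mult_ac)
    qed
    thus ?thesis by (simp add: mult.commute)
  qed
  have ST: "S \<subseteq> T" using 1[of _ 0] n by auto
  have "complex_order T"
    unfolding complex_order_def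
  proof (intro conjI ballI)
    show "\<exists>B. finite B \<and> T = int_span B"
      using B(1) by (intro exI[of _ D]) (simp add: D_def T_def)
  qed (use 4 ST B(3) in auto)
  moreover have "z \<in> T" using 2[of 1 1] ST B(3) by auto
  ultimately show ?thesis using ST by blast
qed

section \<open>The ring of algebraic integers\<close>

definition alg_ints :: "complex set" where
  "alg_ints = {z. \<exists>S. complex_order S \<and> z \<in> S}"

lemma alg_ints_common_order:
  assumes "finite Z" "Z \<subseteq> alg_ints"
  shows "\<exists>S. complex_order S \<and> Z \<subseteq> S"
  using assms
proof (induction Z)
  case empty
  show ?case using complex_order_Ints by blast
next
  case (insert z Z)
  then obtain S T where "complex_order S" "Z \<subseteq> S" "complex_order T" "z \<in> T"
    by (auto simp: alg_ints_def)
  thus ?case using complex_order_join[of S T] by blast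
qed

text \<open>Integrality is membership in some order, so two integral numbers lie in a common order,
  and their difference and product are found there without constructing a monic polynomial.\<close>

interpretation alg_ints: complex_subring alg_ints
proof
  show "1 \<in> alg_ints" using complex_order_Ints by (auto simp: alg_ints_def intro: int_span.base)
next
  fix x y assume "x \<in> alg_ints" "y \<in> alg_ints"
  then obtain S where S: "complex_order S" "x \<in> S" "y \<in> S"
    using alg_ints_common_order[of "{x, y}"] by auto
  interpret complex_subring S by (rule complex_order_subring) fact
  show "x - y \<in> alg_ints" "x * y \<in> alg_ints" using S by (auto simp: alg_ints_def)
qed

text \<open>The finitely many coefficients lie in one order, and adjoining a root of a monic
  polynomial over an order gives an order again.\<close>

lemma alg_ints_integrally_closed:
  assumes "z ^ n = (\<Sum>k<n. s k * z ^ k)" "\<And>k. k < n \<Longrightarrow> s k \<in> alg_ints"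
  shows "z \<in> alg_ints"
proof -
  obtain S where "complex_order S" "s ` {..<n} \<subseteq> S"
    using alg_ints_common_order[of "s ` {..<n}"] assms(2) by auto
  with complex_order_adjoin[OF _ assms(1), of S] show ?thesis by (auto simp: alg_ints_def)
qed

section \<open>Leading coefficients and products of roots\<close>

text \<open>Multiplying \<open>p(z) = 0\<close> by the power \<open>n - 1\<close> of the coefficient
  \<open>c\<close> of degree \<open>n\<close> gives a monic equation for \<open>c * z\<close>. The
  index \<open>n\<close> may exceed the degree, which suits the induction on coefficients in the
  next lemma.\<close>

lemma lead_coeff_times_root:
  assumes p: "p \<in> polys_over alg_ints" and deg: "degree p \<le> n" and n: "n > 0" and z: "poly p z = 0"
  shows "coeff p n * z \<in> alg_ints"
proof -
  define c where "c = coeff p"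
  have sum0: "(\<Sum>k\<le>n. c k * z ^ k) = 0"
  proof -
    have "(\<Sum>k\<le>n. c k * z ^ k) = (\<Sum>k\<le>degree p. c k * z ^ k)"
      by (rule sum.mono_neutral_right) (use deg in \<open>auto simp: c_def coeff_eq_0\<close>)
    thus ?thesis using z by (simp add: poly_altdef c_def)
  qed
  obtain m where m: "n = Suc m" using n by (cases n) auto
  have "(c n * z) ^ n = c n ^ m * (c n * z ^ n)" by (simp add: m power_mult_distrib mult_ac)
  also have "c n * z ^ n = - (\<Sum>k<n. c k * z ^ k)"
    using sum0 by (simp add: lessThan_Suc_atMost[symmetric] m add_eq_0_iff2)
  also have "c n ^ m * \<dots> = (\<Sum>k<n. - (c k * c n ^ (m - k)) * (c n * z) ^ k)"
    unfolding sum_negf[symmetric] sum_distrib_left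
  proof (rule sum.cong)
    fix k assume "k \<in> {..<n}"
    hence "c n ^ m = c n ^ (m - k) * c n ^ k" using m by (simp flip: power_add)
    thus "c n ^ m * - (c k * z ^ k) = - (c k * c n ^ (m - k)) * (c n * z) ^ k"
      by (simp add: power_mult_distrib mult_ac)
  qed simp
  finally have *: "(c n * z) ^ n = (\<Sum>k<n. - (c k * c n ^ (m - k)) * (c n * z) ^ k)" .
  have "c n * z \<in> alg_ints"
    by (rule alg_ints_integrally_closed[OF *]) (use p in \<open>auto simp: c_def polys_over_def\<close>)
  thus ?thesis by (simp add: c_def)
qed

text \<open>With \<open>a\<close> the coefficient of \<open>t\<^sup>n\<close>, the polynomial \<open>p - a t\<^sup>n\<^sup>-\<^sup>1 (t - z)\<close> has smaller degree
  and integral coefficients.\<close>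

lemma alg_ints_polys_div_root:
  assumes "[:-z, 1:] * q \<in> polys_over alg_ints"
  shows "q \<in> polys_over alg_ints"
proof -
  have "q \<in> polys_over alg_ints"
    if "[:-z, 1:] * q \<in> polys_over alg_ints" "\<And>k. k \<ge> n \<Longrightarrow> coeff q k = 0" for n q
    using that
  proof (induction n arbitrary: q)
    case 0
    thus ?case by (simp add: polys_over_def)
  next
    case (Suc n)
    define p where "p = [:-z, 1:] * q"
    define a where "a = coeff q n"
    have pa: "coeff p (Suc n) = a" using Suc.prems(2) by (simp add: p_def a_def coeff_pCons)
    have "degree q \<le> n" using Suc.prems(2) by (intro degree_le) auto
    hence dp: "degree p \<le> Suc n" unfolding p_def
      by (intro order.trans[OF degree_mult_le]) auto
    have pS: "p \<in> polys_over alg_ints" using Suc.prems(1) by (simp add: p_def)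
    have a: "a \<in> alg_ints" using pS pa by (auto simp: polys_over_def)
    have az: "a * z \<in> alg_ints"
      using lead_coeff_times_root[OF pS dp, of z] pa by (simp add: p_def)
    have "[:-z, 1:] * (q - monom a n) = p - (monom a (Suc n) - monom (a * z) n)"
      by (simp add: p_def algebra_simps smult_diff_right smult_monom monom_Suc add_monom)
    also have "\<dots> \<in> polys_over alg_ints" using pS a az by blast
    finally have "q - monom a n \<in> polys_over alg_ints"
    proof (rule Suc.IH)
      fix k assume "n \<le> k"
      thus "coeff (q - monom a n) k = 0" using Suc.prems(2)[of k] by (cases "k = n") (auto simp: a_def)
    qed
    hence "q - monom a n + monom a n \<in> polys_over alg_ints" using a by blast
    thus ?case by simp
  qed
  from this[of q "Suc (degree q)"] show ?thesis using assms by (simp add: coeff_eq_0)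
qed

text \<open>Dividing \<open>p\<close> by linear factors keeps the coefficients integral. After
  enough divisions, \<open>lead_coeff p\<close> times the product of the \<open>t - z\<close> with
  \<open>z\<close> in \<open>I\<close> remains, and its value at 0 is the claim up to sign.\<close>

lemma lead_coeff_times_prod_roots:
  assumes p: "p \<in> polys_over alg_ints" and I: "finite I" and r: "\<And>z. z \<in> I \<Longrightarrow> poly p z = 0"
  shows "lead_coeff p * (\<Prod>z\<in>I. z) \<in> alg_ints"
proof (cases "p = 0")
  case False
  define R where "R = {z. poly p z = 0}"
  have R: "finite R" using False by (simp add: R_def poly_roots_finite)
  have eq: "smult (lead_coeff p) (\<Prod>z\<in>R. [:-z, 1:] ^ Polynomial.order z p) = p"
    by (simp add: complex_poly_decompose R_def)
  have IR: "I \<subseteq> R" using r by (auto simp: R_def)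
  \<comment> \<open>The factor to be stripped: every root with its multiplicity in \<open>p\<close>,
    less one for the roots in \<open>I\<close>.\<close>
  define g where "g = (\<Prod>z\<in>R. [:-z, 1:] ^ (Polynomial.order z p - (if z \<in> I then 1 else 0)))"
  have "(\<Prod>z\<in>R. [:-z, 1:] ^ Polynomial.order z p) = (\<Prod>z\<in>R. (if z \<in> I then [:-z, 1:] else 1) *
      [:-z, 1:] ^ (Polynomial.order z p - (if z \<in> I then 1 else 0)))"
  proof (rule prod.cong)
    fix z assume "z \<in> R"
    hence "Polynomial.order z p > 0" using False by (simp add: R_def order_root)
    thus "[:-z, 1:] ^ Polynomial.order z p = (if z \<in> I then [:-z, 1:] else 1) *
      [:-z, 1:] ^ (Polynomial.order z p - (if z \<in> I then 1 else 0))"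
      by (cases "Polynomial.order z p") auto
  qed simp
  also have "\<dots> = (\<Prod>z\<in>R. if z \<in> I then [:-z, 1:] else 1) * g"
    by (simp add: g_def prod.distrib)
  also have "(\<Prod>z\<in>R. if z \<in> I then [:-z, 1:] else 1) = (\<Prod>z\<in>I. [:-z, 1:])"
    using R IR by (simp add: prod.If_cases Int_absorb1)
  finally have eq2: "g * smult (lead_coeff p) (\<Prod>z\<in>I. [:-z, 1:]) = p"
    using eq by (simp add: mult.commute)
  have strip: "h \<in> polys_over alg_ints" if "g' * h \<in> polys_over alg_ints"
    "g' = (\<Prod>z\<in>A. [:-z, 1:] ^ e z)" "finite A" for g' h A and e :: "complex \<Rightarrow> nat"
    using that(3,1,2)
  proof (induction A arbitrary: g')
    case (insert z A)
    have "q \<in> polys_over alg_ints" if "[:-z, 1:] ^ k * q \<in> polys_over alg_ints" for k q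
      using that by (induction k) (auto simp del: mult_pCons_left simp: mult.assoc dest!: alg_ints_polys_div_root)
    from this[of "e z" "(\<Prod>z\<in>A. [:-z, 1:] ^ e z) * h"] show ?case
      using insert by (simp add: mult.assoc)
  qed auto
  have "g * smult (lead_coeff p) (\<Prod>z\<in>I. [:-z, 1:]) \<in> polys_over alg_ints"
    unfolding eq2 by (rule p)
  hence *: "smult (lead_coeff p) (\<Prod>z\<in>I. [:-z, 1:]) \<in> polys_over alg_ints"
    by (rule strip[OF _ g_def R])
  have "poly (smult (lead_coeff p) (\<Prod>z\<in>I. [:-z, 1:])) 0 \<in> alg_ints"
    using * by (rule alg_ints.poly_eval_in) auto
  hence "lead_coeff p * (\<Prod>z\<in>I. - z) \<in> alg_ints" by (simp add: poly_prod)
  hence "(-1) ^ card I * (lead_coeff p * (\<Prod>z\<in>I. - z)) \<in> alg_ints" by auto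
  moreover have "(-1) ^ card I * (\<Prod>z\<in>I. - z) = (\<Prod>z\<in>I. z)"
    by (simp add: prod_uminus flip: mult.assoc power_mult_distrib)
  ultimately show ?thesis by (metis mult.left_commute)
qed auto

text \<open>The monomial is cut into \<open>K\<close> layers, each a product of distinct roots that
  costs one factor \<open>lead_coeff p\<close>. Hence the largest exponent counts, and not the total
  degree.\<close>

lemma lead_coeff_power_times_monomial:
  assumes p: "p \<in> polys_over alg_ints" and I: "finite I" and r: "\<And>z. z \<in> I \<Longrightarrow> poly p z = 0"
    and e: "\<And>z. z \<in> I \<Longrightarrow> e z \<le> K"
  shows "lead_coeff p ^ K * (\<Prod>z\<in>I. z ^ e z) \<in> alg_ints"
  using e
proof (induction K arbitrary: e)
  case 0
  thus ?case by simp
next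
  case (Suc K)
  define J where "J = {z\<in>I. e z > 0}"
  have "(\<Prod>z\<in>I. z ^ e z) = (\<Prod>z\<in>I. (if z \<in> J then z else 1) * z ^ (e z - 1))"
    by (rule prod.cong) (auto simp: J_def simp flip: power_Suc)
  also have "\<dots> = (\<Prod>z\<in>J. z) * (\<Prod>z\<in>I. z ^ (e z - 1))"
    using I by (simp add: prod.distrib prod.If_cases J_def Int_def)
  finally have "lead_coeff p ^ Suc K * (\<Prod>z\<in>I. z ^ e z) =
      (lead_coeff p * (\<Prod>z\<in>J. z)) * (lead_coeff p ^ K * (\<Prod>z\<in>I. z ^ (e z - 1)))"
    by simp
  also have "\<dots> \<in> alg_ints"
  proof (rule alg_ints.mult_in)
    show "lead_coeff p * (\<Prod>z\<in>J. z) \<in> alg_ints"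
      using p I r by (intro lead_coeff_times_prod_roots) (auto simp: J_def)
    show "lead_coeff p ^ K * (\<Prod>z\<in>I. z ^ (e z - 1)) \<in> alg_ints"
      by (rule Suc.IH) (use Suc.prems in fastforce)
  qed
  finally show ?case .
qed


section \<open>Bases of orders\<close>

lemma int_span_image:
  "int_span (b ` {..<N}) = range (\<lambda>c :: nat \<Rightarrow> int. \<Sum>i<N. of_int (c i) * b i)" (is "?L = range ?f")
proof
  show "?L \<subseteq> range ?f"
  proof
    fix x assume x: "x \<in> ?L"
    show "x \<in> range ?f"
      using x
    proof (induction rule: int_span.induct)
      case zero
      show ?case by (intro image_eqI[of _ _ "\<lambda>_. 0"]) auto
    next
      case (base x)
      then obtain j where j: "j < N" "x = b j" by auto
      have "(\<Sum>i<N. of_int (if i = j then 1 else 0) * b i) = (\<Sum>i<N. if i = j then b i else 0)"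
        by (intro sum.cong) auto
      also have "\<dots> = x" using j by simp
      finally show ?case by (intro image_eqI[of _ _ "\<lambda>i. if i = j then 1 else 0"]) auto
    next
      case (diff x y)
      then obtain c d where "x = ?f c" "y = ?f d" by blast
      hence "x - y = ?f (\<lambda>i. c i - d i)" by (simp add: sum_subtractf algebra_simps)
      thus ?case by (intro image_eqI[of _ _ "\<lambda>i. c i - d i"]) auto
    qed
  qed
  show "range ?f \<subseteq> ?L"
  proof clarify
    show "?f c \<in> ?L" for c
      by (rule int_span_sum, rule int_span_scale, rule int_span.base) auto
  qed
qed

text \<open>Take a generating family of minimal size together with a relation minimizing \<open>\<Sum>\<bar>c i\<bar>\<close>;
  a step of the Euclidean algorithm on two nonzero coefficients makes the relation smaller.\<close>

lemma complex_order_basis: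
  assumes "complex_order S"
  obtains N :: nat and b :: "nat \<Rightarrow> complex" where
    "S = range (\<lambda>c :: nat \<Rightarrow> int. \<Sum>i<N. of_int (c i) * b i)"
    "\<And>(c :: nat \<Rightarrow> int) i. \<lbrakk>(\<Sum>i<N. of_int (c i) * b i) = 0; i < N\<rbrakk> \<Longrightarrow> c i = 0"
proof -
  obtain B where B: "finite B" "S = int_span B" using assms by (auto simp: complex_order_def)
  define gen where "gen N b \<longleftrightarrow> S = int_span (b ` {..<N})" for N :: nat and b
  have "\<exists>N b. gen N b"
  proof -
    obtain h where "bij_betw h {0..<card B} B" using ex_bij_betw_nat_finite[OF B(1)] by blast
    hence "h ` {..<card B} = B" by (auto simp: bij_betw_def atLeast0LessThan)
    thus ?thesis using B(2) by (intro exI[of _ "card B"] exI[of _ h]) (simp add: gen_def)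
  qed
  then obtain N where N: "\<exists>b. gen N b" and min: "\<And>M b. gen M b \<Longrightarrow> N \<le> M"
    using exists_least_iff[of "\<lambda>N. \<exists>b. gen N b"] by (metis leI)
  define rel where "rel b c \<longleftrightarrow> gen N b \<and> (\<Sum>i<N. of_int (c i) * b i) = 0 \<and> (\<exists>i<N. c i \<noteq> 0)"
    for b and c :: "nat \<Rightarrow> int"
  have norel: "\<not> rel b c" for b c
  proof
    assume "rel b c"
    define size where "size c = (\<Sum>i<N. nat \<bar>c i\<bar>)" for c :: "nat \<Rightarrow> int"
    obtain b c where r: "rel b c" and least: "\<And>b' c'. rel b' c' \<Longrightarrow> size c \<le> size c'"
    proof -
      obtain p where "case p of (b, c) \<Rightarrow> rel b c"
        "\<forall>q. (case q of (b, c) \<Rightarrow> rel b c) \<longrightarrow> size (snd p) \<le> size (snd q)"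
        using ex_has_least_nat[of "case_prod rel" "(b, c)" "size \<circ> snd"] \<open>rel b c\<close> by auto
      thus thesis using that[of "fst p" "snd p"] by (auto simp: case_prod_beta)
    qed
    from r obtain j where j: "j < N" "c j \<noteq> 0" and g: "gen N b"
      and sum0: "(\<Sum>i<N. of_int (c i) * b i) = 0" by (auto simp: rel_def)
    show False
    proof (cases "\<exists>i<N. i \<noteq> j \<and> c i \<noteq> 0")
      case False
      have "(\<Sum>i<N. of_int (c i) * b i) = (\<Sum>i<N. if i = j then of_int (c j) * b j else 0)"
        using False by (intro sum.cong) auto
      \<comment> \<open>A relation with a single nonzero coefficient says that generator
        \<open>j\<close> is 0. It is overwritten by the last generator, which leaves
        \<open>N - 1\<close> of them and contradicts minimality.\<close>
      hence "b j = 0" using sum0 j by simp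
      define b' where "b' = b(j := b (N - 1))"
      have "b ` {..<N} \<subseteq> int_span (b' ` {..<N - 1})"
      proof
        fix x assume "x \<in> b ` {..<N}"
        then obtain i where i: "i < N" "x = b i" by blast
        show "x \<in> int_span (b' ` {..<N - 1})"
        proof (cases "i = j")
          case True
          thus ?thesis using \<open>b j = 0\<close> i by (auto intro: int_span.zero)
        next
          case ij: False
          show ?thesis
          proof (cases "i = N - 1")
            case True
            hence "x = b' j" "j < N - 1" using i ij j(1) by (auto simp: b'_def)
            thus ?thesis by (auto intro: int_span.base)
          next
            case False
            hence "x = b' i" "i < N - 1" using i ij by (auto simp: b'_def)
            thus ?thesis by (auto intro: int_span.base)
          qed
        qed
      qed
      moreover have "b' ` {..<N - 1} \<subseteq> int_span (b ` {..<N})"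
        using j by (auto simp: b'_def intro!: int_span.base)
      ultimately have "gen (N - 1) b'" using g int_span_mono unfolding gen_def by blast
      thus False using min[of "N - 1" b'] j by simp
    next
      case True
      then obtain k where k: "k < N" "k \<noteq> j" "c k \<noteq> 0" by blast
      obtain i l where il: "i < N" "l < N" "i \<noteq> l" "c i \<noteq> 0" "c l \<noteq> 0" "\<bar>c l\<bar> \<le> \<bar>c i\<bar>"
        using j k by (metis linear)
      \<comment> \<open>With this sign, subtracting \<open>s * c l\<close> makes \<open>c i\<close>
        smaller in absolute value, and adding \<open>s * b i\<close> to \<open>b l\<close>
        compensates the change in the relation.\<close>
      define s where "s = sgn (c i) * sgn (c l)"
      have s: "\<bar>c i - s * c l\<bar> < \<bar>c i\<bar>"
        using il by (auto simp: s_def sgn_if abs_if split: if_splits)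
      define c' where "c' = c(i := c i - s * c l)"
      define b' where "b' = b(l := b l + of_int s * b i)"
      have b'l: "b l = b' l - of_int s * b' i" using il by (simp add: b'_def)
      have "b ` {..<N} \<subseteq> int_span (b' ` {..<N})"
      proof
        fix x assume "x \<in> b ` {..<N}"
        then obtain m where m: "m < N" "x = b m" by blast
        have *: "b' m \<in> int_span (b' ` {..<N})" if "m < N" for m using that by (auto intro: int_span.base)
        show "x \<in> int_span (b' ` {..<N})"
        proof (cases "m = l")
          case True
          thus ?thesis using m b'l * il by (auto intro!: int_span.diff int_span_scale)
        next
          case False
          thus ?thesis using m *[of m] by (simp add: b'_def)
        qed
      qed
      moreover have "b' ` {..<N} \<subseteq> int_span (b ` {..<N})"
        using il by (auto simp: b'_def intro!: int_span_add int_span_scale intro: int_span.base)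
      ultimately have g': "gen N b'" using g int_span_mono unfolding gen_def by blast
      have "(\<Sum>m<N. of_int (c' m) * b' m) = (\<Sum>m<N. of_int (c m) * b m +
          ((if m = l then of_int (c l * s) * b i else 0) - (if m = i then of_int (s * c l) * b i else 0)))"
        using il by (intro sum.cong) (auto simp: c'_def b'_def algebra_simps)
      also have "\<dots> = 0" using il sum0 by (simp add: sum.distrib sum_subtractf)
      finally have "rel b' c'" using g' il unfolding rel_def by (auto simp: c'_def)
      moreover have "size c' < size c"
        unfolding size_def
      proof (rule sum_strict_mono_ex1)
        have "nat \<bar>c' i\<bar> < nat \<bar>c i\<bar>" using s by (simp add: c'_def)
        thus "\<exists>m\<in>{..<N}. nat \<bar>c' m\<bar> < nat \<bar>c m\<bar>" using il(1) by blast
        show "\<forall>m\<in>{..<N}. nat \<bar>c' m\<bar> \<le> nat \<bar>c m\<bar>" using s by (auto simp: c'_def)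
      qed auto
      ultimately show False using least by fastforce
    qed
  qed
  from N obtain b where "gen N b" ..
  with norel[of b] show thesis
    using that unfolding rel_def gen_def int_span_image by blast
qed

text \<open>All powers of \<open>q = u / v\<close> lie in one order. Comparing coordinates in
  \<open>v ^ k * q ^ k = u ^ k * 1\<close> shows that \<open>v ^ k\<close> divides every coordinate
  of 1, for all \<open>k\<close>; some coordinate is nonzero, so \<open>v = 1\<close>.\<close>

lemma rational_alg_int_is_int:
  assumes "q \<in> \<rat>" "q \<in> alg_ints"
  shows "q \<in> \<int>"
proof -
  obtain S where S: "complex_order S" "q \<in> S" using assms(2) by (auto simp: alg_ints_def)
  interpret complex_subring S by (rule complex_order_subring) fact
  obtain N b where gen: "S = range (\<lambda>c :: nat \<Rightarrow> int. \<Sum>i<N. of_int (c i) * b i)"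
    and ind: "\<And>(c :: nat \<Rightarrow> int) i. \<lbrakk>(\<Sum>i<N. of_int (c i) * b i) = 0; i < N\<rbrakk> \<Longrightarrow> c i = 0"
    using complex_order_basis[OF S(1)] by blast
  obtain u v where uv: "v > 0" "coprime u v" "q = of_int u / of_int v"
    using assms(1) by (rule Rats_cases')
  obtain e :: "nat \<Rightarrow> int" where e: "1 = (\<Sum>i<N. of_int (e i) * b i)" using one_in gen by blast
  have "\<exists>i<N. e i \<noteq> 0"
  proof (rule ccontr)
    assume "\<not> ?thesis"
    hence "(\<Sum>i<N. of_int (e i) * b i) = 0" by (intro sum.neutral) auto
    thus False using e by simp
  qed
  then obtain i where i: "i < N" "e i \<noteq> 0" by blast
  have dvd: "v ^ k dvd e i" for k
  proof -
    have "q ^ k \<in> S" using S(2) by auto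
    then obtain f :: "nat \<Rightarrow> int" where f: "q ^ k = (\<Sum>i<N. of_int (f i) * b i)" using gen by blast
    have "(\<Sum>i<N. of_int (v ^ k * f i - u ^ k * e i) * b i) = of_int (v ^ k) * q ^ k - of_int (u ^ k)"
      by (simp add: f sum_subtractf left_diff_distrib mult.assoc flip: sum_distrib_left e)
    also have "\<dots> = 0" using uv(1) by (simp add: uv(3) power_divide)
    finally have "v ^ k * f i - u ^ k * e i = 0" 
      using ind[of "\<lambda>i. v ^ k * f i - u ^ k * e i" i] i(1) by blast
    hence "v ^ k dvd u ^ k * e i" by (metis dvd_triv_left eq_iff_diff_eq_0)
    moreover have "coprime (v ^ k) (u ^ k)" using uv(2) by (simp add: coprime_commute)
    ultimately show ?thesis using coprime_dvd_mult_right_iff by blast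
  qed
  have "v = 1"
  proof (rule ccontr)
    assume "v \<noteq> 1"
    define k where "k = nat \<bar>e i\<bar>"
    have "\<bar>e i\<bar> = int k" by (simp add: k_def)
    also have "\<dots> < 2 ^ k" using of_nat_less_two_power by blast
    also have "\<dots> \<le> v ^ k" using uv(1) \<open>v \<noteq> 1\<close> by (intro power_mono) auto
    also have "\<dots> \<le> \<bar>e i\<bar>" using dvd_imp_le_int[OF i(2) dvd[of k]] uv(1) by (simp add: power_abs)
    finally show False by simp
  qed
  thus ?thesis using uv(3) by simp
qed


section \<open>Rationality\<close>

lemma rational_poly_division:
  assumes q: "q \<in> polys_over \<rat>" "q \<noteq> 0" and p: "p \<in> polys_over \<rat>"
  shows "\<exists>h\<in>polys_over \<rat>. p - h * q = 0 \<or> degree (p - h * q) < degree q"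
  using p
proof (induction "degree p" arbitrary: p rule: less_induct)
  case less
  show ?case
  proof (cases "p = 0 \<or> degree p < degree q")
    case True
    thus ?thesis by (intro bexI[of _ 0]) auto
  next
    case False
    hence dle: "degree q \<le> degree p" and p0: "p \<noteq> 0" by auto
    define m where "m = monom (lead_coeff p / lead_coeff q) (degree p - degree q)"
    have c: "lead_coeff p \<in> \<rat>" "lead_coeff q \<in> \<rat>" using less.prems q by (auto simp: polys_over_def)
    have m: "m \<in> polys_over \<rat>" unfolding m_def using c by (intro Rats.polys_monom) auto
    have m0: "lead_coeff p / lead_coeff q \<noteq> 0" using p0 q(2) by simp
    have "degree (m * q) \<le> degree p"
      using order.trans[OF degree_mult_le, of m q "degree p"] dle m0
      by (simp add: m_def degree_monom_eq)
    hence dd: "degree (p - m * q) \<le> degree p" by (intro degree_diff_le) auto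
    have "coeff (p - m * q) (degree p) = 0" using dle q(2)
      by (simp add: m_def coeff_monom_mult)
    hence *: "p - m * q = 0 \<or> degree (p - m * q) < degree p"
      using eq_zero_or_degree_less[OF dd] by blast
    show ?thesis
    proof (cases "p - m * q = 0")
      case True
      thus ?thesis using m by blast
    next
      case False
      hence "degree (p - m * q) < degree p" using * by blast
      moreover have "p - m * q \<in> polys_over \<rat>" using less.prems m q by blast
      ultimately obtain h where h: "h \<in> polys_over \<rat>"
        "p - m * q - h * q = 0 \<or> degree (p - m * q - h * q) < degree q"
        using less.hyps by blast
      have "p - (m + h) * q = p - m * q - h * q" by (simp add: algebra_simps)
      hence "p - (m + h) * q = 0 \<or> degree (p - (m + h) * q) < degree q" using h(2) by (simp only:)
      thus ?thesis using h(1) m by blast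
    qed
  qed
qed

section \<open>Resultants and squarefree parts over the rationals\<close>

lemma prod_mset_diff_swap:
  fixes A B :: "complex multiset"
  shows "(\<Prod>x\<in>#A. \<Prod>y\<in>#B. x - y) = (-1) ^ (size A * size B) * (\<Prod>y\<in>#B. \<Prod>x\<in>#A. y - x)"
proof (induction A)
  case (add x A)
  have "(\<Prod>y\<in>#B. x - y) = (-1) ^ size B * (\<Prod>y\<in>#B. y - x)"
    by (induction B) (auto simp: algebra_simps)
  thus ?case using add by (simp add: prod_mset.distrib power_add mult_ac)
qed (simp add: prod_mset.neutral_const)

lemma poly_eq_prod_proots:
  fixes p :: "complex poly"
  shows "poly p x = lead_coeff p * (\<Prod>y\<in>#proots p. x - y)"
proof -
  have *: "poly (\<Prod>y\<in>#A. [:-y, 1:]) x = (\<Prod>y\<in>#A. x - y)" for A :: "complex multiset"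
    by (induction A) (auto simp: left_diff_distrib)
  show ?thesis
    by (subst complex_poly_decompose_multiset[of p, symmetric]) (simp only: poly_smult *)
qed

text \<open>The product of the values of \<open>g\<close> at the roots of \<open>f\<close> is, up to sign and leading
  coefficients, the product of the values of \<open>f mod g\<close> at the roots of \<open>g\<close>.\<close>

lemma prod_values_at_roots_rational:
  assumes "g \<in> polys_over \<rat>" "f \<in> polys_over \<rat>" "f \<noteq> 0"
  shows "(\<Prod>x\<in>#proots f. poly g x) \<in> \<rat>"
  using assms
proof (induction "degree g" arbitrary: f g rule: less_induct)
  case less
  have const: "(\<Prod>x\<in>#A. c) \<in> \<rat>" if "c \<in> \<rat>" for c :: complex and A :: "complex multiset"
    using that by (induction A) auto
  show ?case
  proof (cases "degree g = 0")
    case True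
    then obtain c where "g = [:c:]" by (metis degree_eq_zeroE)
    moreover from this have "c \<in> \<rat>" using less.prems(1) Rats.polys_pConsD by blast
    moreover have "poly [:c:] = (\<lambda>_. c)" by auto
    ultimately show ?thesis using const by metis
  next
    case False
    hence g0: "g \<noteq> 0" by auto
    obtain h where h: "h \<in> polys_over \<rat>" "f - h * g = 0 \<or> degree (f - h * g) < degree g"
      using rational_poly_division[OF less.prems(1) g0 less.prems(2)] by blast
    define f' where "f' = f - h * g"
    have f': "f' \<in> polys_over \<rat>" "degree f' < degree g"
      using h less.prems False by (auto simp: f'_def)
    let ?F = "proots f" and ?G = "proots g"
    have lc: "lead_coeff f \<in> \<rat>" "lead_coeff g \<in> \<rat>" using less.prems by (auto simp: polys_over_def)
    have val: "(\<Prod>y\<in>#A. poly p y) = (\<Prod>y\<in>#A. lead_coeff p) * (\<Prod>y\<in>#A. \<Prod>x\<in>#proots p. y - x)"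
      for p :: "complex poly" and A
      by (subst poly_eq_prod_proots) (simp add: prod_mset.distrib)
    have "(\<Prod>y\<in>#?G. poly f y) = (\<Prod>y\<in>#?G. poly f' y)"
      using g0 by (intro arg_cong[of _ _ prod_mset] image_mset_cong) (simp add: f'_def)
    also have "\<dots> \<in> \<rat>" using less.hyps[OF f'(2) f'(1) less.prems(1) g0] .
    finally have 1: "(\<Prod>y\<in>#?G. lead_coeff f) * (\<Prod>y\<in>#?G. \<Prod>x\<in>#?F. y - x) \<in> \<rat>"
      by (simp only: val)
    have "(\<Prod>y\<in>#?G. lead_coeff f) \<noteq> 0" using less.prems(3) by (simp add: prod_mset_zero_iff)
    hence "(\<Prod>y\<in>#?G. \<Prod>x\<in>#?F. y - x) =
        ((\<Prod>y\<in>#?G. lead_coeff f) * (\<Prod>y\<in>#?G. \<Prod>x\<in>#?F. y - x)) / (\<Prod>y\<in>#?G. lead_coeff f)"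
      by simp
    also have "\<dots> \<in> \<rat>" using 1 const[OF lc(1), of ?G] by (rule Rats_divide)
    finally have "(\<Prod>y\<in>#?G. \<Prod>x\<in>#?F. y - x) \<in> \<rat>" .
    hence "(-1) ^ (size ?F * size ?G) * (\<Prod>y\<in>#?G. \<Prod>x\<in>#?F. y - x) \<in> \<rat>"
      by (intro Rats_mult Rats_power) auto
    thus ?thesis using const[OF lc(2), of ?F]
      by (simp only: val prod_mset_diff_swap[where A = ?F and B = ?G] Rats_mult)
  qed
qed

lemma prod_values_at_simple_roots_rational:
  assumes "g \<in> polys_over \<rat>" "q \<in> polys_over \<rat>" "rsquarefree q"
  shows "(\<Prod>x | poly q x = 0. poly g x) \<in> \<rat>"
proof -
  have q: "q \<noteq> 0" using assms(3) by (simp add: rsquarefree_def)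
  have "proots q = mset_set {x. poly q x = 0}"
    by (rule multiset_eqI)
      (use assms(3) q in \<open>auto simp: count_mset_set' poly_roots_finite rsquarefree_root_order order_0I\<close>)
  thus ?thesis using prod_values_at_roots_rational[OF assms(1,2) q] by (simp add: prod_unfold_prod_mset)
qed

text \<open>\<open>delta r\<close> and \<open>sigma r\<close> run over the distinct roots, so a
  rational polynomial with the same roots, all simple, is wanted. It is \<open>p\<close> divided by
  its greatest common divisor with \<open>pderiv p\<close>, found as an element of least degree in
  the ideal of rational combinations.\<close>

lemma exists_squarefree_part:
  assumes p: "p \<in> polys_over \<rat>" and deg: "degree p > 0"
  shows "\<exists>q\<in>polys_over \<rat>. rsquarefree q \<and> (\<forall>z. poly q z = 0 \<longleftrightarrow> poly p z = 0)"
proof -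
  define I where "I = {u * p + v * pderiv p | u v. u \<in> polys_over \<rat> \<and> v \<in> polys_over \<rat>}"
  have p0: "p \<noteq> 0" "pderiv p \<noteq> 0" using deg by (auto simp: pderiv_eq_0_iff)
  have pI: "p \<in> I"
    unfolding I_def by (rule CollectI, rule exI[of _ 1], rule exI[of _ 0]) auto
  have p'I: "pderiv p \<in> I"
    unfolding I_def by (rule CollectI, rule exI[of _ 0], rule exI[of _ 1]) auto
  obtain d where d: "d \<in> I" "d \<noteq> 0" and min: "\<And>e. \<lbrakk>e \<in> I; e \<noteq> 0\<rbrakk> \<Longrightarrow> degree d \<le> degree e"
    using ex_has_least_nat[of "\<lambda>d. d \<in> I \<and> d \<noteq> 0" p degree] pI p0 by blast
  obtain u v where uv: "u \<in> polys_over \<rat>" "v \<in> polys_over \<rat>" "d = u * p + v * pderiv p"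
    using d(1) by (auto simp: I_def)
  have dR: "d \<in> polys_over \<rat>" using uv p by blast
  have dvd: "\<exists>h\<in>polys_over \<rat>. e = h * d" if eI: "e \<in> I" for e
  proof -
    obtain u' v' where e: "u' \<in> polys_over \<rat>" "v' \<in> polys_over \<rat>" "e = u' * p + v' * pderiv p"
      using eI by (auto simp: I_def)
    have eR: "e \<in> polys_over \<rat>" using e p by blast
    obtain h where h: "h \<in> polys_over \<rat>" "e - h * d = 0 \<or> degree (e - h * d) < degree d"
      using rational_poly_division[OF dR d(2) eR] by blast
    have "e - h * d = (u' - h * u) * p + (v' - h * v) * pderiv p"
      unfolding e(3) uv(3) by (simp add: algebra_simps)
    hence "e - h * d \<in> I" using e(1,2) h(1) uv(1,2) unfolding I_def by blast
    hence "e - h * d = 0" using min h(2) by fastforce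
    thus ?thesis using h(1) by (intro bexI[of _ h]) auto
  qed
  obtain q e where q: "q \<in> polys_over \<rat>" "p = q * d" "pderiv p = e * d"
    using dvd[OF pI] dvd[OF p'I] by blast
  show ?thesis
    using poly_squarefree_decomp[OF p0(2) q(2,3) uv(3)] q(1) by blast
qed

text \<open>Division by \<open>t - s\<close> for a point \<open>s\<close> of \<open>A\<close> leaves
  a quotient of smaller degree with rational values on the rest of \<open>A\<close>. This recovers
  the coefficients of polynomials that are known only through their values.\<close>

lemma poly_rational_values_imp_rational_coeffs:
  assumes "infinite A" "A \<subseteq> \<rat>" "\<And>x. x \<in> A \<Longrightarrow> poly p x \<in> \<rat>"
  shows "p \<in> polys_over \<rat>"
  using assms
proof (induction "degree p" arbitrary: p A)
  case 0
  then obtain c where c: "p = [:c:]" by (metis degree_eq_zeroE)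
  obtain x where "x \<in> A" using 0(2) by (metis finite.emptyI all_not_in_conv)
  thus ?case using 0(4)[of x] c by auto
next
  case (Suc n)
  obtain s where s: "s \<in> A" using Suc(3) by (metis finite.emptyI all_not_in_conv)
  define h where "h = synthetic_div p s"
  have ph: "[:-s, 1:] * h + [:poly p s:] = p" by (simp only: h_def synthetic_div_correct')
  have "h \<in> polys_over \<rat>"
  proof (rule Suc.hyps(1)[of h "A - {s}"])
    show "n = degree h" using Suc(2) by (simp add: h_def degree_synthetic_div)
    show "poly h x \<in> \<rat>" if x: "x \<in> A - {s}" for x
    proof -
      have "poly p x = (x - s) * poly h x + poly p s"
        by (subst ph[symmetric]) (simp add: algebra_simps)
      hence "poly h x = (poly p x - poly p s) / (x - s)" using x by (simp add: field_simps)
      thus ?thesis using x s Suc(4,5) by (metis DiffD1 Rats_diff Rats_divide subsetD)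
    qed
  qed (use Suc(3,4) in auto)
  moreover have "s \<in> \<rat>" "poly p s \<in> \<rat>" using s Suc by auto
  ultimately have "[:-s, 1:] * h + [:poly p s:] \<in> polys_over \<rat>"
    by (intro Rats.polys_add Rats.polys_mult Rats.polys_pCons) auto
  thus ?case by (simp only: ph)
qed

lemma infinite_Rats: "infinite (\<rat> :: complex set)"
proof -
  have "of_nat ` (UNIV :: nat set) \<subseteq> (\<rat> :: complex set)" by auto
  moreover have "infinite (of_nat ` (UNIV :: nat set) :: complex set)"
    by (simp add: finite_image_iff inj_on_def)
  ultimately show ?thesis using finite_subset by blast
qed


section \<open>The integers \<open>\<delta>(r)\<close> and \<open>\<sigma>(r)\<close>\<close>

locale nonconstant_int_poly =
  fixes r :: "int poly"
  assumes degree_pos: "degree r > 0"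
begin

abbreviation "R \<equiv> cpoly r"
abbreviation "C \<equiv> croots r"
abbreviation "a \<equiv> complex_of_int (lead_coeff r)"
abbreviation "d \<equiv> degree r"

lemma r_nz: "r \<noteq> 0"
  using degree_pos by auto

lemma degree_R [simp]: "degree R = d"
  by (simp add: degree_map_poly r_nz)

lemma lead_coeff_R [simp]: "coeff R d = a"
  by (simp add: coeff_map_poly)

lemma R_nz: "R \<noteq> 0"
  using degree_R degree_pos by (metis degree_0 less_numeral_extra(3))

lemma a_nz: "a \<noteq> 0"
  using r_nz by simp

lemma finite_C [simp, intro]: "finite C"
  unfolding croots_def using R_nz by (rule poly_roots_finite)

lemma C_root: "z \<in> C \<Longrightarrow> poly R z = 0"
  by (simp add: croots_def)

lemma card_C: "card C \<le> d"
  unfolding croots_def using card_poly_roots_bound[OF R_nz] by simp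

lemma C_nonempty: "C \<noteq> {}"
proof -
  have "\<not> constant (poly R)" using degree_pos by (simp add: constant_degree)
  thus ?thesis using fundamental_theorem_of_algebra by (auto simp: croots_def)
qed

lemma max_mult_le: "max_mult r \<le> d"
  unfolding max_mult_def
  by (subst Max_le_iff) (use C_nonempty order_degree[OF R_nz] in auto)

section \<open>The discriminant: integrality and rationality\<close>

definition pairs :: "(complex \<times> complex) set" where
  "pairs = {(x, y). x \<in> C \<and> y \<in> C \<and> x \<noteq> y}"

definition disc :: complex where
  "disc = (\<Prod>(x, y)\<in>pairs. x - y)"

lemma finite_pairs [simp]: "finite pairs"
  by (rule finite_subset[of _ "C \<times> C"]) (auto simp: pairs_def)

text \<open>When the product is expanded, each factor contributes one of its two roots, so the
  exponent of a root is at most the number of its occurrences in the factors.\<close>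

lemma prod_diff_in_span:
  assumes "finite A" "A \<subseteq> C \<times> C"
  shows "(\<Prod>(x, y)\<in>A. x - y) \<in> int_span {(\<Prod>z\<in>C. z ^ f z) | f.
    \<forall>z. f z \<le> (\<Sum>(x, y)\<in>A. of_bool (x = z) + of_bool (y = z))}"
  using assms
proof (induction A)
  case empty
  have "1 = (\<Prod>z\<in>C. z ^ (0 :: nat))" by simp
  thus ?case by (auto intro!: int_span.base exI[of _ "\<lambda>_. 0"])
next
  case (insert p A)
  obtain x y where p: "p = (x, y)" by (cases p)
  have xy: "x \<in> C" "y \<in> C" using insert.prems p by auto
  let ?E = "\<lambda>A z. \<Sum>(x, y)\<in>A. of_bool (x = z) + of_bool (y = z) :: nat"
  let ?M = "\<lambda>A. {(\<Prod>z\<in>C. z ^ f z) | f. \<forall>z. f z \<le> ?E A z}"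
  have E: "?E (insert p A) z = of_bool (x = z) + of_bool (y = z) + ?E A z" for z
    using insert.hyps p by simp
  have mono: "w * (\<Prod>z\<in>C. z ^ f z) = (\<Prod>z\<in>C. z ^ (f z + of_bool (w = z)))" if "w \<in> C" for w and f :: "complex \<Rightarrow> nat"
  proof -
    have "(\<Prod>z\<in>C. z ^ (f z + of_bool (w = z))) = (\<Prod>z\<in>C. z ^ f z * (if w = z then z else 1))"
      by (intro prod.cong) auto
    also have "\<dots> = (\<Prod>z\<in>C. z ^ f z) * w" using that by (simp add: prod.distrib)
    finally show ?thesis by simp
  qed
  have "(x - y) * (\<Prod>(x, y)\<in>A. x - y) \<in> int_span (?M (insert p A))"
  proof (rule int_span_mult_closed[of _ "?M A"])
    show "(\<Prod>(x, y)\<in>A. x - y) \<in> int_span (?M A)" using insert by auto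
    fix b assume "b \<in> ?M A"
    then obtain f where f: "b = (\<Prod>z\<in>C. z ^ f z)" "\<And>z. f z \<le> ?E A z" by blast
    have in_M: "w * b \<in> ?M (insert p A)" if w: "w \<in> C" "\<And>z. of_bool (w = z) \<le> (of_bool (x = z) + of_bool (y = z) :: nat)" for w
    proof (rule CollectI, intro exI conjI allI)
      show "w * b = (\<Prod>z\<in>C. z ^ (f z + of_bool (w = z)))" using mono[OF w(1)] f(1) by simp
      show "f z + of_bool (w = z) \<le> ?E (insert p A) z" for z
        unfolding E using add_mono[OF f(2)[of z] w(2)[of z]] by simp
    qed
    have "x * b \<in> int_span (?M (insert p A))" "y * b \<in> int_span (?M (insert p A))"
      by (intro int_span.base in_M xy; simp)+
    thus "(x - y) * b \<in> int_span (?M (insert p A))"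
      unfolding left_diff_distrib by (rule int_span.diff)
  qed
  thus ?case using insert.hyps p by simp
qed

text \<open>Counted over all of \<open>C \<times> C\<close>, a root occurs \<open>2 * card C\<close>
  times, so \<open>a ^ (2 * d)\<close> makes every monomial of the expansion integral.\<close>

lemma disc_integral: "a ^ (2 * d) * disc \<in> alg_ints"
proof -
  have deg: "(\<Sum>(x, y)\<in>pairs. of_bool (x = z) + of_bool (y = z)) \<le> 2 * d" for z
  proof -
    have "(\<Sum>(x, y)\<in>pairs. of_bool (x = z) + of_bool (y = z) :: nat)
        \<le> (\<Sum>(x, y)\<in>C \<times> C. of_bool (x = z) + of_bool (y = z))"
      by (rule sum_mono2) (auto simp: pairs_def)
    also have "\<dots> = (\<Sum>x\<in>C. \<Sum>y\<in>C. of_bool (x = z) + of_bool (y = z))"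
      by (rule sum.cartesian_product[symmetric])
    also have "\<dots> = (\<Sum>x\<in>C. of_bool (x = z)) * card C + card C * (\<Sum>y\<in>C. of_bool (y = z))"
      by (simp add: sum.distrib mult.commute flip: sum_distrib_left sum_distrib_right)
    also have "\<dots> \<le> 1 * card C + card C * 1"
    proof -
      have "(\<Sum>x\<in>C. of_bool (x = z) :: nat) \<le> 1"
        by (simp add: of_bool_def sum.delta)
      thus ?thesis by (intro add_mono mult_right_mono mult_left_mono) auto
    qed
    also have "\<dots> \<le> 2 * d" using card_C by simp
    finally show ?thesis .
  qed
  have "disc \<in> int_span {(\<Prod>z\<in>C. z ^ f z) | f.
    \<forall>z. f z \<le> (\<Sum>(x, y)\<in>pairs. of_bool (x = z) + of_bool (y = z))}"
    unfolding disc_def by (rule prod_diff_in_span) (auto simp: pairs_def finite_pairs[unfolded pairs_def])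
  thus ?thesis
  proof (induction rule: int_span.induct)
    case (base b)
    then obtain f where f: "b = (\<Prod>z\<in>C. z ^ f z)"
      "\<And>z. f z \<le> (\<Sum>(x, y)\<in>pairs. of_bool (x = z) + of_bool (y = z))" by blast
    have "lead_coeff R ^ (2 * d) * (\<Prod>z\<in>C. z ^ f z) \<in> alg_ints"
      by (rule lead_coeff_power_times_monomial) (auto intro: C_root le_trans[OF f(2) deg])
    thus ?case by (simp add: f(1))
  next
    case (diff x y)
    thus ?case by (metis alg_ints.diff_in right_diff_distrib)
  qed auto
qed

lemma exists_squarefree:
  obtains q where "q \<in> polys_over \<rat>" "rsquarefree q" "{z. poly q z = 0} = C"
  using exists_squarefree_part[of R] degree_pos by (auto simp: croots_def)

text \<open>For squarefree \<open>q\<close> with roots \<open>C\<close> and leading coefficient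
  \<open>c\<close>, the derivative at a root \<open>x\<close> is \<open>c\<close> times the product
  of the \<open>x - y\<close> over the other roots \<open>y\<close>. So \<open>disc\<close> is, up
  to a power of \<open>c\<close>, the product of the values of \<open>pderiv q\<close> at the
  roots.\<close>

lemma disc_rational: "disc \<in> \<rat>"
proof -
  obtain q where q: "q \<in> polys_over \<rat>" "rsquarefree q" "{z. poly q z = 0} = C"
    by (rule exists_squarefree)
  define c where "c = lead_coeff q"
  have c: "c \<in> \<rat>" "c \<noteq> 0" using q(1,2) by (auto simp: c_def polys_over_def rsquarefree_def)
  have qd: "smult c (\<Prod>z\<in>C. [:-z, 1:]) = q"
    using complex_poly_decompose_rsquarefree[OF q(2)] by (simp add: q(3) c_def)
  have "poly (pderiv q) x = c * (\<Prod>y\<in>C - {x}. x - y)" if x: "x \<in> C" for x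
  proof -
    define g where "g = smult c (\<Prod>z\<in>C - {x}. [:-z, 1:])"
    have qg: "q = [:-x, 1:] * g"
      unfolding g_def qd[symmetric] using prod.remove[OF finite_C x, of "\<lambda>z. [:-z, 1:]"] by simp
    have "poly (pderiv q) x = poly g x"
      unfolding qg pderiv_mult by (simp add: pderiv_pCons)
    thus ?thesis by (simp add: g_def poly_prod)
  qed
  hence "(\<Prod>x\<in>C. poly (pderiv q) x) = c ^ card C * (\<Prod>x\<in>C. \<Prod>y\<in>C - {x}. x - y)"
    by (simp add: prod.distrib)
  also have "(\<Prod>x\<in>C. \<Prod>y\<in>C - {x}. x - y) = disc"
  proof -
    have "pairs = Sigma C (\<lambda>x. C - {x})" by (auto simp: pairs_def)
    thus ?thesis unfolding disc_def by (simp add: prod.Sigma)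
  qed
  finally have "disc = (\<Prod>x\<in>C. poly (pderiv q) x) / c ^ card C" using c by simp
  also have "(\<Prod>x\<in>C. poly (pderiv q) x) \<in> \<rat>"
    using prod_values_at_simple_roots_rational[OF Rats.polys_pderiv[OF q(1)] q(1,2)] q(3) by simp
  hence "(\<Prod>x\<in>C. poly (pderiv q) x) / c ^ card C \<in> \<rat>" using c by (intro Rats_divide Rats_power)
  finally show ?thesis .
qed

text \<open>The number on the right is rational and an algebraic integer, hence an integer, so the
  description by \<open>THE\<close> denotes it.\<close>

lemma of_int_delta:
  "of_int (delta r) = a ^ (1 + 2 * d ^ 2) * fact (max_mult r - 1) * disc ^ max_mult r"
proof -
  let ?m = "max_mult r"
  define w where "w = a ^ (1 + 2 * d ^ 2) * fact (?m - 1) * disc ^ ?m"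
  \<comment> \<open>Integrality of the power of \<open>disc\<close> costs
    \<open>a ^ (2 * d * max_mult r)\<close>, and a multiplicity is at most \<open>d\<close>; the
    exponent \<open>1 + 2 * d ^ 2\<close> covers this.\<close>
  have le: "2 * d * ?m \<le> 1 + 2 * d ^ 2"
  proof -
    have "2 * d * ?m \<le> 2 * d * d" by (intro mult_le_mono2 max_mult_le)
    thus ?thesis unfolding power2_eq_square by linarith
  qed
  have "w = a ^ (1 + 2 * d ^ 2 - 2 * d * ?m) * of_nat (fact (?m - 1)) * (a ^ (2 * d) * disc) ^ ?m"
    using le by (simp add: w_def power_mult_distrib flip: power_mult power_add)
  also have "\<dots> \<in> alg_ints" 
    by (intro alg_ints.mult_in[OF _ alg_ints.power_in[OF disc_integral]]
        alg_ints.mult_in[OF alg_ints.power_in] alg_ints.of_nat_in alg_ints.of_int_in)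
  finally have "w \<in> alg_ints" .
  moreover have "fact (?m - 1) \<in> (\<rat> :: complex set)" by (metis Rats_of_nat of_nat_fact)
  hence "w \<in> \<rat>" unfolding w_def using disc_rational
    by (intro Rats_mult Rats_power) auto
  ultimately obtain k where k: "w = of_int k" using rational_alg_int_is_int Ints_cases by metis
  have "delta r = (THE k. (of_int k :: complex) = w)"
    using degree_pos unfolding delta_def w_def disc_def pairs_def prod_power_distrib
    by (simp add: case_prod_unfold prod_power_distrib)
  also have "\<dots> = k" unfolding k by (rule the_equality) simp_all
  finally show ?thesis using k w_def by simp
qed

section \<open>Values at sums of two roots\<close>

definition sum_pairs :: "(complex \<times> complex) set" where
  "sum_pairs = {(x, y). x \<in> C \<and> y \<in> C \<and> poly R (x + y) \<noteq> 0}"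

lemma sum_pairs_subset: "sum_pairs \<subseteq> C \<times> C"
  by (auto simp: sum_pairs_def)

lemma finite_sum_pairs [simp]: "finite sum_pairs"
  using finite_subset[OF sum_pairs_subset] by simp

definition sum_prod :: complex where
  "sum_prod = (\<Prod>(x, y)\<in>sum_pairs. poly R (x + y))"

text \<open>The pairs with \<open>r(x + y) = 0\<close> are left out, so the product is not itself a
  norm. An indeterminate repairs this: the product of \<open>T - r(x + y)\<close> over all pairs is
  rational for rational \<open>T\<close> and equals a power of \<open>T\<close>, from the omitted
  pairs, times a polynomial \<open>G(T)\<close>; up to sign, \<open>G(0)\<close> is the product in
  question.\<close>

lemma sum_prod_rational: "sum_prod \<in> \<rat>"
proof -
  obtain q where q: "q \<in> polys_over \<rat>" "rsquarefree q" "{z. poly q z = 0} = C"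
    by (rule exists_squarefree)
  have norm: "(\<Prod>x\<in>C. poly g x) \<in> \<rat>" if "g \<in> polys_over \<rat>" for g
    using prod_values_at_simple_roots_rational[OF that q(1,2)] q(3) by simp
  \<comment> \<open>At a rational \<open>x\<close> the product over \<open>y\<close> is rational. As
    a polynomial in \<open>x\<close> it therefore has rational coefficients, so that the product
    over the roots \<open>x\<close> can be taken in turn.\<close>
  have inner: "(\<Prod>y\<in>C. [:T:] - pcompose R [:y, 1:]) \<in> polys_over \<rat>" if T: "T \<in> \<rat>" for T
  proof (rule poly_rational_values_imp_rational_coeffs[OF infinite_Rats order.refl])
    fix x :: complex assume x: "x \<in> \<rat>"
    have "poly (\<Prod>y\<in>C. [:T:] - pcompose R [:y, 1:]) x = (\<Prod>y\<in>C. poly ([:T:] - pcompose R [:x, 1:]) y)"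
      by (simp add: poly_prod poly_pcompose add.commute)
    also have "\<dots> \<in> \<rat>"
      using T x by (intro norm Rats.polys_diff Rats.polys_pcompose Rats.polys_pCons Rats.polys_cpoly) auto
    finally show "poly (\<Prod>y\<in>C. [:T:] - pcompose R [:y, 1:]) x \<in> \<rat>" .
  qed
  define F where "F T = (\<Prod>(x, y)\<in>C \<times> C. T - poly R (x + y))" for T
  have F: "F T \<in> \<rat>" if T: "T \<in> \<rat>" for T
  proof -
    have "F T = (\<Prod>x\<in>C. poly (\<Prod>y\<in>C. [:T:] - pcompose R [:y, 1:]) x)"
      by (simp add: F_def poly_prod poly_pcompose add.commute flip: prod.cartesian_product)
    also have "\<dots> \<in> \<rat>" by (intro norm inner T)
    finally show ?thesis .
  qed
  define G where "G = (\<Prod>(x, y)\<in>sum_pairs. [:- poly R (x + y), 1:])"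
  have G: "poly G T = (\<Prod>(x, y)\<in>sum_pairs. T - poly R (x + y))" for T
    by (simp add: G_def poly_prod case_prod_unfold)
  have FG: "F T = T ^ card (C \<times> C - sum_pairs) * poly G T" for T
  proof -
    have "F T = (\<Prod>(x, y)\<in>C \<times> C - sum_pairs. T - poly R (x + y)) * (\<Prod>(x, y)\<in>sum_pairs. T - poly R (x + y))"
      unfolding F_def by (rule prod.subset_diff[OF sum_pairs_subset]) simp
    also have "(\<Prod>(x, y)\<in>C \<times> C - sum_pairs. T - poly R (x + y)) = (\<Prod>p\<in>C \<times> C - sum_pairs. T)"
      by (intro prod.cong) (auto simp: sum_pairs_def)
    finally show ?thesis by (simp add: G)
  qed
  have "G \<in> polys_over \<rat>"
  proof (rule poly_rational_values_imp_rational_coeffs[of "\<rat> - {0}"])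
    show "poly G T \<in> \<rat>" if T: "T \<in> \<rat> - {0}" for T
    proof -
      have "poly G T = F T / T ^ card (C \<times> C - sum_pairs)" using T by (simp add: FG)
      thus ?thesis using T F[of T] by simp
    qed
  qed (use infinite_Rats in auto)
  hence "poly G 0 \<in> \<rat>" by (rule Rats.poly_eval_in) auto
  also have "poly G 0 = (-1) ^ card sum_pairs * sum_prod"
    by (simp add: G sum_prod_def case_prod_unfold prod_uminus)
  finally have *: "(-1) ^ card sum_pairs * sum_prod \<in> \<rat>" .
  have "(-1) ^ card sum_pairs * ((-1) ^ card sum_pairs * sum_prod) \<in> \<rat>"
    by (rule Rats_mult[OF Rats_power *]) auto
  thus ?thesis by (simp flip: mult.assoc power_mult_distrib)
qed

lemma scaled_root_integral: "z \<in> C \<Longrightarrow> a * z \<in> alg_ints"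
  using lead_coeff_times_root[of R d z] degree_pos C_root by auto

lemma scaled_value_integral:
  assumes "a * z \<in> alg_ints"
  shows "a ^ d * poly R z \<in> alg_ints"
proof -
  have "a ^ d * poly R z = (\<Sum>k\<le>d. of_int (coeff r k) * a ^ (d - k) * (a * z) ^ k)"
    unfolding poly_altdef sum_distrib_left degree_R
  proof (rule sum.cong)
    fix k assume "k \<in> {..d}"
    hence "a ^ d = a ^ (d - k) * a ^ k" by (simp flip: power_add)
    thus "a ^ d * (coeff R k * z ^ k) = of_int (coeff r k) * a ^ (d - k) * (a * z) ^ k"
      by (simp add: coeff_map_poly power_mult_distrib mult_ac)
  qed simp
  also have "\<dots> \<in> alg_ints"
    by (intro alg_ints.sum_in alg_ints.mult_in[OF _ alg_ints.power_in[OF assms]]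
        alg_ints.mult_in[OF _ alg_ints.power_in] alg_ints.of_int_in)
  finally show ?thesis .
qed

text \<open>The inequality is strict because \<open>d > 0\<close>; this frees one factor
  \<open>a\<close> from the exponent \<open>2 * d ^ 3\<close>.\<close>

lemma card_sum_pairs: "d * card sum_pairs < 2 * d ^ 3"
proof -
  have "card sum_pairs \<le> card C * card C"
    using card_mono[OF _ sum_pairs_subset] by (simp add: card_cartesian_product)
  also have "\<dots> \<le> d * d" using card_C by (intro mult_le_mono)
  finally have "d * card sum_pairs \<le> d ^ 3" by (simp add: power3_eq_cube mult.assoc)
  also have "\<dots> < 2 * d ^ 3" using degree_pos by simp
  finally show ?thesis .
qed

text \<open>The exponent \<open>2 d\<^sup>3\<close> exceeds what integrality needs, so \<open>\<sigma>(r)\<close> is a multiple of the leading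
  coefficient.\<close>

lemma of_int_sigma:
  "of_int (sigma r) = a ^ (2 * d ^ 3) * sum_prod" "lead_coeff r dvd sigma r"
proof -
  define w where "w = a ^ (2 * d ^ 3 - 1) * sum_prod"
  have e: "2 * d ^ 3 - 1 = (2 * d ^ 3 - 1 - d * card sum_pairs) + d * card sum_pairs"
    using card_sum_pairs by simp
  have "a ^ (d * card sum_pairs) * sum_prod = (\<Prod>(x, y)\<in>sum_pairs. a ^ d * poly R (x + y))"
    by (simp add: sum_prod_def case_prod_unfold prod.distrib power_mult)
  also have "\<dots> \<in> alg_ints"
  proof (rule alg_ints.prod_in, clarify)
    fix x y assume "(x, y) \<in> sum_pairs"
    hence "a * (x + y) \<in> alg_ints" unfolding distrib_left
      by (intro alg_ints.add_in scaled_root_integral) (auto simp: sum_pairs_def)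
    thus "a ^ d * poly R (x + y) \<in> alg_ints" by (rule scaled_value_integral)
  qed
  finally have "a ^ (2 * d ^ 3 - 1 - d * card sum_pairs) * (a ^ (d * card sum_pairs) * sum_prod) \<in> alg_ints"
    by (rule alg_ints.mult_in[OF alg_ints.power_in[OF alg_ints.of_int_in]])
  hence "w \<in> alg_ints" unfolding w_def by (subst e) (simp add: power_add mult.assoc)
  moreover have "w \<in> \<rat>" unfolding w_def using sum_prod_rational by (intro Rats_mult Rats_power) auto
  ultimately obtain k where k: "w = of_int k" using rational_alg_int_is_int Ints_cases by metis
  have "Suc (2 * d ^ 3 - 1) = 2 * d ^ 3" using card_sum_pairs by simp
  hence aw: "a ^ (2 * d ^ 3) * sum_prod = of_int (lead_coeff r * k)"
    using k unfolding w_def by (metis mult.assoc of_int_mult power_Suc)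
  have "sigma r = (THE k. (of_int k :: complex) = a ^ (2 * d ^ 3) * sum_prod)"
    using degree_pos unfolding sigma_def sum_prod_def sum_pairs_def by simp
  also have "\<dots> = lead_coeff r * k" unfolding aw by (rule the_equality) (simp_all del: of_int_mult)
  finally have s: "sigma r = lead_coeff r * k" .
  show "of_int (sigma r) = a ^ (2 * d ^ 3) * sum_prod" unfolding aw s ..
  show "lead_coeff r dvd sigma r" by (simp add: s)
qed

end


section \<open>Nilpotency of graded Lie rings\<close>

inductive_set add_span :: "('a, 'm) ring_scheme \<Rightarrow> 'a set \<Rightarrow> 'a set"
  for L (structure) and B where
  zero: "\<zero> \<in> add_span L B"
| base: "b \<in> B \<Longrightarrow> b \<in> add_span L B"
| diff: "\<lbrakk>x \<in> add_span L B; y \<in> add_span L B\<rbrakk> \<Longrightarrow> x \<ominus> y \<in> add_span L B"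

context abelian_group
begin

lemma add_span_closed: "\<lbrakk>x \<in> add_span G B; B \<subseteq> carrier G\<rbrakk> \<Longrightarrow> x \<in> carrier G"
  by (induction rule: add_span.induct) auto

lemma add_span_uminus: "\<lbrakk>x \<in> add_span G B; B \<subseteq> carrier G\<rbrakk> \<Longrightarrow> \<ominus> x \<in> add_span G B"
  using add_span.diff[OF add_span.zero, of x G B] add_span_closed[of x B] by (simp add: a_minus_def)

lemma add_span_add:
  assumes "x \<in> add_span G B" "y \<in> add_span G B" "B \<subseteq> carrier G"
  shows "x \<oplus> y \<in> add_span G B"
  using add_span.diff[OF assms(1) add_span_uminus[OF assms(2,3)]] add_span_closed[OF assms(2,3)]
  by (simp add: a_minus_def)

lemma diff_zero [simp]: "x \<in> carrier G \<Longrightarrow> x \<ominus> \<zero> = x"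
  by (simp add: a_minus_def)

lemma diff_self [simp]: "x \<in> carrier G \<Longrightarrow> x \<ominus> x = \<zero>"
  by (simp add: a_minus_def r_neg)

lemma diff_trans:
  assumes "a \<in> carrier G" "b \<in> carrier G" "c \<in> carrier G"
  shows "(a \<ominus> b) \<oplus> (b \<ominus> c) = a \<ominus> c"
  using assms by (simp add: a_minus_def a_assoc r_neg1 r_neg2)

lemma eq_minusI: "\<lbrakk>a \<oplus> b = c; a \<in> carrier G; b \<in> carrier G\<rbrakk> \<Longrightarrow> a = c \<ominus> b"
  by (auto simp: a_minus_def a_assoc r_neg)

lemma generate_eq_add_span:
  assumes "B \<subseteq> carrier G"
  shows "generate (add_monoid G) B = add_span G B"
proof
  show "generate (add_monoid G) B \<subseteq> add_span G B"
  proof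
    fix x assume "x \<in> generate (add_monoid G) B"
    thus "x \<in> add_span G B"
    proof induction
      case (inv h)
      thus ?case using add_span_uminus[OF add_span.base assms, of h] by (simp add: a_inv_def)
    qed (use assms in \<open>auto intro: add_span.zero add_span.base add_span_add\<close>)
  qed
  show "add_span G B \<subseteq> generate (add_monoid G) B"
  proof
    fix x assume "x \<in> add_span G B"
    thus "x \<in> generate (add_monoid G) B"
    proof induction
      case zero
      show ?case using generate.one[of "add_monoid G"] by simp
    next
      case (diff x y)
      have "\<ominus> y \<in> generate (add_monoid G) B"
        using add.generate_m_inv_closed[OF assms diff.IH(2)] by (simp add: a_inv_def)
      thus ?case using generate.eng[OF diff.IH(1)] by (simp add: a_minus_def)
    qed (auto intro: generate.incl)
  qed
qed

end

context lie_ring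
begin

lemma bracket_zero [simp]:
  assumes "x \<in> carrier L"
  shows "\<zero> \<otimes> x = \<zero>" "x \<otimes> \<zero> = \<zero>"
  using bracket_add_left[of \<zero> \<zero> x] bracket_add_right[of x \<zero> \<zero>] assms
    bracket_closed[of \<zero> x] bracket_closed[of x \<zero>] by (simp_all add: add.l_cancel_one)

lemma bracket_uminus:
  assumes "x \<in> carrier L" "y \<in> carrier L"
  shows "(\<ominus> x) \<otimes> y = \<ominus> (x \<otimes> y)" "x \<otimes> (\<ominus> y) = \<ominus> (x \<otimes> y)"
proof -
  have "(\<ominus> x) \<otimes> y \<oplus> x \<otimes> y = \<zero>"
    using assms bracket_add_left[of "\<ominus> x" x y] by (simp add: l_neg)
  thus "(\<ominus> x) \<otimes> y = \<ominus> (x \<otimes> y)" using assms by (simp add: bracket_closed minus_equality)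
  have "x \<otimes> (\<ominus> y) \<oplus> x \<otimes> y = \<zero>"
    using assms bracket_add_right[of x "\<ominus> y" y] by (simp add: l_neg)
  thus "x \<otimes> (\<ominus> y) = \<ominus> (x \<otimes> y)" using assms by (simp add: bracket_closed minus_equality)
qed

lemma bracket_diff:
  assumes "x \<in> carrier L" "y \<in> carrier L" "z \<in> carrier L"
  shows "(x \<ominus> y) \<otimes> z = x \<otimes> z \<ominus> y \<otimes> z" "z \<otimes> (x \<ominus> y) = z \<otimes> x \<ominus> z \<otimes> y"
  using assms by (simp_all add: a_minus_def bracket_add_left bracket_add_right bracket_uminus)

lemma bracket_swap:
  assumes "x \<in> carrier L" "y \<in> carrier L"
  shows "y \<otimes> x = \<ominus> (x \<otimes> y)"
proof -
  have "(x \<oplus> y) \<otimes> (x \<oplus> y) = (x \<otimes> x \<oplus> y \<otimes> x) \<oplus> (x \<otimes> y \<oplus> y \<otimes> y)"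
    using assms bracket_add_right[of "x \<oplus> y" x y] bracket_add_left[of x y x] bracket_add_left[of x y y]
    by simp
  hence "y \<otimes> x \<oplus> x \<otimes> y = \<zero>"
    using assms bracket_self bracket_closed by simp
  thus ?thesis using assms by (simp add: bracket_closed minus_equality)
qed

text \<open>The Jacobi identity as a rule for right multiplications: it rewrites brackets as
  combinations of left-normed ones.\<close>

lemma bracket_bracket:
  assumes "v \<in> carrier L" "x \<in> carrier L" "y \<in> carrier L"
  shows "v \<otimes> (x \<otimes> y) = (v \<otimes> x) \<otimes> y \<ominus> (v \<otimes> y) \<otimes> x"
proof -
  note cl = assms bracket_closed
  have 1: "x \<otimes> (y \<otimes> v) = (v \<otimes> y) \<otimes> x"
    using cl by (simp add: bracket_swap[of v y] bracket_uminus bracket_swap[of x "v \<otimes> y"])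
  have 2: "y \<otimes> (v \<otimes> x) = \<ominus> ((v \<otimes> x) \<otimes> y)"
    using cl by (simp add: bracket_swap[of "v \<otimes> x" y])
  have "v \<otimes> (x \<otimes> y) \<oplus> ((v \<otimes> y) \<otimes> x \<oplus> \<ominus> ((v \<otimes> x) \<otimes> y)) = \<zero>"
    using jacobi[OF assms] by (simp only: 1 2)
  hence "v \<otimes> (x \<otimes> y) = \<ominus> ((v \<otimes> y) \<otimes> x \<oplus> \<ominus> ((v \<otimes> x) \<otimes> y))"
    using cl by (simp add: minus_equality)
  thus ?thesis using cl by (simp add: minus_add a_minus_def a_comm)
qed

lemma add_span_bracket_left:
  assumes "x \<in> add_span L B" "B \<subseteq> carrier L" "y \<in> carrier L" "\<And>b. b \<in> B \<Longrightarrow> b \<otimes> y \<in> add_span L B'"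
  shows "x \<otimes> y \<in> add_span L B'"
  using assms(1)
proof induction
  case (diff u v)
  hence "u \<in> carrier L" "v \<in> carrier L" using add_span_closed assms(2) by auto
  thus ?case using diff.IH assms(3) by (simp add: bracket_diff add_span.diff)
qed (use assms in \<open>auto intro: add_span.zero\<close>)

lemma add_span_bracket_right:
  assumes "x \<in> add_span L B" "B \<subseteq> carrier L" "y \<in> carrier L" "\<And>b. b \<in> B \<Longrightarrow> y \<otimes> b \<in> add_span L B'"
  shows "y \<otimes> x \<in> add_span L B'"
  using assms(1)
proof induction
  case (diff u v)
  hence "u \<in> carrier L" "v \<in> carrier L" using add_span_closed assms(2) by auto
  thus ?case using diff.IH assms(3) by (simp add: bracket_diff add_span.diff)
qed (use assms in \<open>auto intro: add_span.zero\<close>)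

lemma brackets_closed:
  "X \<subseteq> carrier L \<Longrightarrow> {x \<otimes> y | x y. x \<in> X \<and> y \<in> carrier L} \<subseteq> carrier L"
  using bracket_closed by blast

lemma lower_central_closed: "lower_central L n \<subseteq> carrier L"
  by (induction n) (simp_all add: add.generate_incl brackets_closed)

lemma lower_central_Suc_eq_add_span:
  "lower_central L (Suc n) = add_span L {x \<otimes> y | x y. x \<in> lower_central L n \<and> y \<in> carrier L}"
  by (simp add: generate_eq_add_span brackets_closed lower_central_closed)

lemma zero_in_lower_central: "\<zero> \<in> lower_central L n"
proof (cases n)
  case (Suc k)
  show ?thesis unfolding Suc lower_central_Suc_eq_add_span by (rule add_span.zero)
qed simp

text \<open>Left-normed brackets. A letter carries its degree along with the ring element, since the
  element need not determine it: zero lies in every component. Sorting by degree is then a filter on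
  lists.\<close>

definition word :: "'a \<Rightarrow> ('g \<times> 'a) list \<Rightarrow> 'a" where
  "word v ys = foldl (\<lambda>v y. v \<otimes> snd y) v ys"

lemma word_simps [simp]:
  "word v [] = v" "word v (y # ys) = word (v \<otimes> snd y) ys" "word v (ys @ zs) = word (word v ys) zs"
  by (simp_all add: word_def)

lemma word_closed: "\<lbrakk>v \<in> carrier L; snd ` set ys \<subseteq> carrier L\<rbrakk> \<Longrightarrow> word v ys \<in> carrier L"
  by (induction ys arbitrary: v) (auto intro: bracket_closed)

lemma word_zero: "snd ` set ys \<subseteq> carrier L \<Longrightarrow> word \<zero> ys = \<zero>"
  by (induction ys) auto

lemma word_diff:
  "\<lbrakk>v \<in> carrier L; w \<in> carrier L; snd ` set ys \<subseteq> carrier L\<rbrakk> \<Longrightarrow> word (v \<ominus> w) ys = word v ys \<ominus> word w ys"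
  by (induction ys arbitrary: v w) (auto simp: bracket_diff bracket_closed)

end

section \<open>Solvability by Kreknin's method\<close>

text \<open>The positive cone of a total order on the complex numbers that is compatible with
  addition: by real part, then by imaginary part.\<close>

definition lex_pos :: "complex \<Rightarrow> bool" where
  "lex_pos z \<longleftrightarrow> Re z > 0 \<or> (Re z = 0 \<and> Im z > 0)"

text \<open>This plays the role of the order \<open>1, \<dots>, n - 1\<close> on the degrees in Kreknin's theorem for
  gradings by the integers modulo \<open>n\<close>, where \<open>n - k\<close> represents the negative degree \<open>- k\<close>.\<close>

definition kreknin_less :: "complex \<Rightarrow> complex \<Rightarrow> bool" where
  "kreknin_less x y \<longleftrightarrow> (lex_pos x \<and> \<not> lex_pos y) \<or> ((lex_pos x \<longleftrightarrow> lex_pos y) \<and> lex_pos (y - x))"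

lemma lex_pos_cases: "z \<noteq> 0 \<Longrightarrow> lex_pos z \<longleftrightarrow> \<not> lex_pos (- z)"
  by (auto simp: lex_pos_def complex_eq_iff)

lemma lex_pos_add: "\<lbrakk>lex_pos x; lex_pos y\<rbrakk> \<Longrightarrow> lex_pos (x + y)"
  by (auto simp: lex_pos_def)

lemma not_lex_pos_0: "\<not> lex_pos 0"
  by (simp add: lex_pos_def)

lemma kreknin_less_asym: "kreknin_less x y \<Longrightarrow> \<not> kreknin_less y x"
  using lex_pos_add[of "y - x" "x - y"] not_lex_pos_0 by (auto simp: kreknin_less_def)

lemma kreknin_less_trans: "\<lbrakk>kreknin_less x y; kreknin_less y z\<rbrakk> \<Longrightarrow> kreknin_less x z"
  using lex_pos_add[of "y - x" "z - y"] by (auto simp: kreknin_less_def)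

lemma kreknin_less_total: "x \<noteq> y \<Longrightarrow> kreknin_less x y \<or> kreknin_less y x"
  using lex_pos_cases[of "y - x"] by (auto simp: kreknin_less_def)

text \<open>As for residues modulo \<open>n\<close> represented by \<open>1, ..., n - 1\<close>: a
  sum that lies below one summand has wrapped around, and then it lies below the other one as
  well.\<close>

lemma kreknin_less_summand:
  assumes "kreknin_less (b + u) u" "b \<noteq> 0" "u \<noteq> 0" "b + u \<noteq> 0"
  shows "kreknin_less (b + u) b"
proof (cases "lex_pos (b + u)")
  case True
  show ?thesis
  proof (cases "lex_pos u")
    case True
    hence "lex_pos (- b)" using assms(1) \<open>lex_pos (b + u)\<close> by (simp add: kreknin_less_def)
    thus ?thesis using \<open>lex_pos (b + u)\<close> lex_pos_cases[OF assms(2)] by (simp add: kreknin_less_def)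
  next
    case False
    hence "lex_pos (- u)" using lex_pos_cases[OF assms(3)] by blast
    moreover from this have "lex_pos b" using lex_pos_add[OF \<open>lex_pos (b + u)\<close>, of "- u"] by simp
    ultimately show ?thesis using \<open>lex_pos (b + u)\<close> by (simp add: kreknin_less_def)
  qed
next
  case False
  hence "\<not> lex_pos u" "lex_pos (- b)" using assms(1) by (auto simp: kreknin_less_def)
  thus ?thesis using False lex_pos_cases[OF assms(2)] lex_pos_cases[OF assms(3)] by (simp add: kreknin_less_def)
qed

locale finitely_graded_lie_ring = lie_ring L for L (structure) +
  fixes X :: "complex set" and C :: "complex \<Rightarrow> 'a set"
  assumes finite_X: "finite X" and zero_notin_X: "0 \<notin> X"
    and C_closed: "C a \<subseteq> carrier L"
    and C_zero: "\<zero> \<in> C a"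
    and C_diff: "\<lbrakk>x \<in> C a; y \<in> C a\<rbrakk> \<Longrightarrow> x \<ominus> y \<in> C a"
    and C_outside: "a \<notin> X \<Longrightarrow> C a = {\<zero>}"
    and C_bracket: "\<lbrakk>x \<in> C a; y \<in> C b\<rbrakk> \<Longrightarrow> x \<otimes> y \<in> C (a + b)"
    and C_generates: "carrier L \<subseteq> add_span L (\<Union>a\<in>X. C a)"
begin

definition graded_subring :: "(complex \<Rightarrow> 'a set) \<Rightarrow> bool" where
  "graded_subring P \<longleftrightarrow> (\<forall>a. P a \<subseteq> C a \<and> \<zero> \<in> P a) \<and> (\<forall>a. \<forall>x\<in>P a. \<forall>y\<in>P a. x \<ominus> y \<in> P a) \<and>
    (\<forall>a b. \<forall>x\<in>P a. \<forall>y\<in>P b. x \<otimes> y \<in> P (a + b))"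

lemma graded_subringD:
  assumes "graded_subring P"
  shows "x \<in> P a \<Longrightarrow> x \<in> C a" "x \<in> P a \<Longrightarrow> x \<in> carrier L" "\<zero> \<in> P a"
    "\<lbrakk>x \<in> P a; y \<in> P a\<rbrakk> \<Longrightarrow> x \<ominus> y \<in> P a" "\<lbrakk>x \<in> P a; y \<in> P b\<rbrakk> \<Longrightarrow> x \<otimes> y \<in> P (a + b)"
    "\<lbrakk>x \<in> P a; a \<notin> X\<rbrakk> \<Longrightarrow> x = \<zero>"
  using assms C_closed C_outside unfolding graded_subring_def by blast+

lemma graded_subring_C: "graded_subring C"
  using C_zero C_diff C_bracket by (simp add: graded_subring_def)

definition derived :: "(complex \<Rightarrow> 'a set) \<Rightarrow> complex \<Rightarrow> 'a set" where
  "derived P a = add_span L {x \<otimes> y | x y. \<exists>b c. x \<in> P b \<and> y \<in> P c \<and> b + c = a}"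

lemma derived_subset:
  assumes "graded_subring P"
  shows "derived P a \<subseteq> P a"
proof
  fix x assume "x \<in> derived P a"
  thus "x \<in> P a" unfolding derived_def
    by induction (use graded_subringD[OF assms] in auto)
qed

lemma derivedI: "\<lbrakk>x \<in> P b; y \<in> P c\<rbrakk> \<Longrightarrow> x \<otimes> y \<in> derived P (b + c)"
  unfolding derived_def by (rule add_span.base) blast

lemma graded_subring_derived:
  assumes P: "graded_subring P"
  shows "graded_subring (derived P)"
  unfolding graded_subring_def
proof (intro conjI allI ballI)
  fix a
  show "derived P a \<subseteq> C a" using derived_subset[OF P] graded_subringD(1)[OF P] by blast
  show "\<zero> \<in> derived P a" by (simp add: derived_def add_span.zero)
  show "x \<ominus> y \<in> derived P a" if "x \<in> derived P a" "y \<in> derived P a" for x y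
    using that by (simp add: derived_def add_span.diff)
  show "x \<otimes> y \<in> derived P (a + b)" if "x \<in> derived P a" "y \<in> derived P b" for x y b
    using that derived_subset[OF P] by (blast intro: derivedI)
qed

lemma graded_subring_derived_pow: "graded_subring P \<Longrightarrow> graded_subring ((derived ^^ n) P)"
  by (induction n) (auto intro: graded_subring_derived)

lemma derived_pow_subset: "graded_subring P \<Longrightarrow> (derived ^^ n) P a \<subseteq> P a"
  by (induction n) (use derived_subset graded_subring_derived_pow in fastforce)+

text \<open>Homogeneous elements of the subring generated by the components of \<open>P\<close> with
  degrees in \<open>U\<close>. The degree is an argument of the predicate, so that induction sees
  the degrees of both factors of a bracket.\<close>

inductive gen :: "(complex \<Rightarrow> 'a set) \<Rightarrow> complex set \<Rightarrow> complex \<Rightarrow> 'a \<Rightarrow> bool" for P U where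
  zero: "gen P U a \<zero>"
| base: "\<lbrakk>u \<in> U; x \<in> P u\<rbrakk> \<Longrightarrow> gen P U u x"
| diff: "\<lbrakk>gen P U a x; gen P U a y\<rbrakk> \<Longrightarrow> gen P U a (x \<ominus> y)"
| bracket: "\<lbrakk>gen P U a x; gen P U b y\<rbrakk> \<Longrightarrow> gen P U (a + b) (x \<otimes> y)"

lemma gen_in: "\<lbrakk>gen P U a x; graded_subring P\<rbrakk> \<Longrightarrow> x \<in> P a"
  by (induction rule: gen.induct) (auto intro: graded_subringD)

lemma gen_mono:
  assumes "gen Q U a x" "\<And>u y. \<lbrakk>u \<in> U; y \<in> Q u\<rbrakk> \<Longrightarrow> gen P V u y"
  shows "gen P V a x"
  using assms(1) by (induction rule: gen.induct) (auto intro: gen.intros assms(2))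

lemma gen_empty: "gen P {} a x \<Longrightarrow> x = \<zero>"
  by (induction rule: gen.induct) (auto simp: a_minus_def)

text \<open>By induction on the generation of \<open>u\<close>. If \<open>u\<close> is a bracket,
  the Jacobi identity moves its two factors onto \<open>v\<close> one after the other while the
  total degree stays \<open>z\<close>. What remains are brackets with single generators, where the
  closure condition on \<open>U\<close> applies.\<close>

lemma bracket_gen:
  assumes P: "graded_subring P" and U: "\<And>u b. \<lbrakk>u \<in> U; b \<in> X; b + u = z\<rbrakk> \<Longrightarrow> b \<in> U"
    and u: "gen P (insert z U) c u"
  shows "\<And>b v. \<lbrakk>v \<in> P b; b + c = z\<rbrakk> \<Longrightarrow> gen P U z (v \<otimes> u)"
  using u
proof (induction rule: gen.induct)
  case (zero c)
  thus ?case using graded_subringD(2)[OF P] by (auto intro: gen.zero)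
next
  case (base c x)
  have xc: "x \<in> carrier L" using base P graded_subringD(2) by blast
  show ?case
  proof (cases "b \<in> X")
    case True
    \<comment> \<open>A generator of degree \<open>z\<close> would force \<open>b = 0\<close>, which
      is not in \<open>X\<close>.\<close>
    hence "c \<noteq> z" using base.prems zero_notin_X by auto
    hence cU: "c \<in> U" using base.hyps by simp
    hence "b \<in> U" using U[of c b] True base.prems by blast
    thus ?thesis using gen.bracket[OF gen.base gen.base, of b U v P c x] cU base by simp
  next
    case False
    hence "v = \<zero>" using graded_subringD(6)[OF P] base.prems by blast
    thus ?thesis using xc by (simp add: gen.zero)
  qed
next
  case (diff c x y)
  have "x \<in> carrier L" "y \<in> carrier L" "v \<in> carrier L"
    using gen_in[OF _ P] diff graded_subringD(2)[OF P] by blast+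
  thus ?case using diff by (simp add: bracket_diff gen.diff)
next
  case (bracket c x e y)
  have x: "x \<in> P c" "y \<in> P e" using gen_in[OF _ P] bracket.hyps by blast+
  have "v \<otimes> (x \<otimes> y) = (v \<otimes> x) \<otimes> y \<ominus> (v \<otimes> y) \<otimes> x"
    using x bracket.prems graded_subringD(2)[OF P] by (intro bracket_bracket) blast+
  moreover have "gen P U z ((v \<otimes> x) \<otimes> y)"
    using graded_subringD(5)[OF P bracket.prems(1) x(1)] bracket.prems(2)
    by (intro bracket.IH(2)[of "v \<otimes> x" "b + c"]) (auto simp: add.assoc)
  moreover have "gen P U z ((v \<otimes> y) \<otimes> x)"
    using graded_subringD(5)[OF P bracket.prems(1) x(2)] bracket.prems(2)
    by (intro bracket.IH(1)[of "v \<otimes> y" "b + e"]) (auto simp: add_ac)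
  ultimately show ?case by (simp add: gen.diff)
qed

text \<open>The induction step of Kreknin's theorem: with \<open>N\<close> the \<open>n\<close>-th derived subring, the component
  of degree \<open>z\<close> of \<open>[N, N]\<close> already lies in the subring generated by the remaining degrees.\<close>

lemma kreknin_step:
  assumes n: "\<And>P a x. \<lbrakk>graded_subring P; x \<in> (derived ^^ n) P a\<rbrakk> \<Longrightarrow> gen P (insert z U) a x"
    and U: "\<And>u b. \<lbrakk>u \<in> U; b \<in> X; b + u = z\<rbrakk> \<Longrightarrow> b \<in> U"
    and P: "graded_subring P" and x: "x \<in> (derived ^^ (n + Suc n)) P a"
  shows "gen P U a x"
proof -
  define N where "N = (derived ^^ n) P"
  have N: "graded_subring N" using graded_subring_derived_pow[OF P] by (simp add: N_def)
  have NP: "N a \<subseteq> P a" for a using derived_pow_subset[OF P] by (simp add: N_def)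
  have key: "gen P U z y" if "y \<in> derived N z" for y
    using that unfolding derived_def
  proof induction
    case (base w)
    then obtain v u b c where w: "w = v \<otimes> u" "v \<in> N b" "u \<in> N c" "b + c = z" by blast
    have u: "gen P (insert z U) c u" using n[OF P] w(3) by (simp add: N_def)
    show ?case unfolding w(1)
      by (rule bracket_gen[OF P _ u, of v b]) (use U w NP in blast)+
  qed (auto intro: gen.intros)
  \<comment> \<open>The hypothesis for \<open>n\<close> is used a second time, now inside
    \<open>derived N\<close>. Of the generators it provides, those of degree \<open>z\<close> are
    replaced by means of \<open>key\<close>.\<close>
  have "x \<in> (derived ^^ n) (derived N) a" using x by (simp add: N_def funpow_add funpow_swap1)
  hence "gen (derived N) (insert z U) a x" by (rule n[OF graded_subring_derived[OF N]])
  thus ?thesis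
  proof (rule gen_mono)
    fix u y assume "u \<in> insert z U" "y \<in> derived N u"
    thus "gen P U u y" using key derived_subset[OF N] NP by (blast intro: gen.base)
  qed
qed

text \<open>Degrees are removed in increasing order with respect to \<open>kreknin_less\<close>
  until none is left. Each removal turns \<open>n\<close> into \<open>2 * n + 1\<close>, so
  \<open>2 ^ card X - 1\<close> derived steps suffice.\<close>

lemma solvable: "\<exists>n. \<forall>a. (derived ^^ n) C a = {\<zero>}"
proof -
  have "\<exists>U n. U \<subseteq> X \<and> card U + m = card X \<and> (\<forall>x\<in>X - U. \<forall>u\<in>U. kreknin_less x u) \<and>
      (\<forall>P a x. graded_subring P \<longrightarrow> x \<in> (derived ^^ n) P a \<longrightarrow> gen P U a x)"
    if "m \<le> card X" for m
    using that
  proof (induction m)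
    case 0
    have "gen P X a x" if "graded_subring P" "x \<in> P a" for P a x
      using graded_subringD(6)[OF that] that(2) by (cases "a \<in> X") (auto intro: gen.intros)
    thus ?case by (intro exI[of _ X] exI[of _ 0]) auto
  next
    case (Suc m)
    then obtain U n where U: "U \<subseteq> X" "card U + m = card X" "\<And>x u. \<lbrakk>x \<in> X - U; u \<in> U\<rbrakk> \<Longrightarrow> kreknin_less x u"
      and n: "\<And>P a x. \<lbrakk>graded_subring P; x \<in> (derived ^^ n) P a\<rbrakk> \<Longrightarrow> gen P U a x"
      by (metis Suc_leD)
    have finU: "finite U" using U(1) finite_X finite_subset by blast
    have "U \<noteq> {}" using U(2) Suc.prems by auto
    then obtain z where z: "z \<in> U" "\<And>u. \<lbrakk>u \<in> U; u \<noteq> z\<rbrakk> \<Longrightarrow> \<not> kreknin_less u z"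
      using Finite_Set.bex_min_element[OF finU, of kreknin_less] kreknin_less_asym kreknin_less_trans
      by (metis (no_types, lifting) asymp_on_def transp_on_def)
    have zmin: "kreknin_less z u" if "u \<in> U" "u \<noteq> z" for u using that z kreknin_less_total by blast
    define V where "V = U - {z}"
    have UV: "U = insert z V" using z(1) by (auto simp: V_def)
    have V: "b \<in> V" if u: "u \<in> V" "b \<in> X" "b + u = z" for u b
    proof -
      have nz: "b \<noteq> 0" "u \<noteq> 0" "z \<noteq> 0" using zero_notin_X u U(1) z(1) by (auto simp: V_def)
      have "kreknin_less z u" using zmin u(1) by (auto simp: V_def)
      \<comment> \<open>The sum \<open>z = b + u\<close> lies below \<open>u\<close>, hence below
        \<open>b\<close>. The degrees removed before all lie below \<open>z\<close>, so
        \<open>b\<close> is still in \<open>U\<close>.\<close>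
      hence zb: "kreknin_less z b" using kreknin_less_summand[of b u] nz u(3) by simp
      hence "b \<in> U" using U(3)[of b z] kreknin_less_asym u(2) z(1) by blast
      moreover have "b \<noteq> z" using nz u(3) by auto
      ultimately show ?thesis by (simp add: V_def)
    qed
    have "card V + Suc m = card X" using U(2) z(1) finU by (simp add: V_def card_Diff_singleton)
      (metis Suc_pred add_Suc_right add_Suc card_gt_0_iff empty_iff)
    moreover have "\<forall>x\<in>X - V. \<forall>u\<in>V. kreknin_less x u" using U(3) zmin by (auto simp: V_def)
    moreover have "gen P V a x" if "graded_subring P" "x \<in> (derived ^^ (n + Suc n)) P a" for P a x
      by (rule kreknin_step[where n = n and z = z and P = P]) (use n[unfolded UV] V that in blast)+
    ultimately show ?case using U(1) by (intro exI[of _ V] exI[of _ "n + Suc n"]) (auto simp: V_def)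
  qed
  from this[OF order_refl] obtain U n where U: "U \<subseteq> X" "card U + card X = card X"
    and n: "\<forall>P a x. graded_subring P \<longrightarrow> x \<in> (derived ^^ n) P a \<longrightarrow> gen P U a x" by blast
  have "U = {}" using U finite_subset[OF U(1) finite_X] by simp
  hence "(derived ^^ n) C a \<subseteq> {\<zero>}" for a using n graded_subring_C gen_empty by blast
  moreover have "\<zero> \<in> (derived ^^ n) C a" for a
    using graded_subring_derived_pow[OF graded_subring_C] graded_subringD(3) by blast
  ultimately show ?thesis by blast
qed

section \<open>From solvability to nilpotency\<close>

definition letters :: "(complex \<Rightarrow> 'a set) \<Rightarrow> (complex \<times> 'a) set" where
  "letters P = {(a, y). a \<in> X \<and> y \<in> P a}"

lemma letters_closed: "\<lbrakk>graded_subring P; set ys \<subseteq> letters P\<rbrakk> \<Longrightarrow> snd ` set ys \<subseteq> carrier L"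
  using graded_subringD(2) by (fastforce simp: letters_def)

text \<open>The first entry ranges over the components of the whole ring and not only over
  \<open>P\<close>: if all words of some length vanish, then \<open>P\<close> acts nilpotently on
  \<open>L\<close>.\<close>

definition words :: "(complex \<Rightarrow> 'a set) \<Rightarrow> nat \<Rightarrow> 'a set" where
  "words P n = {word v ys | v ys. v \<in> (\<Union>b\<in>X. C b) \<and> set ys \<subseteq> letters P \<and> length ys = n}"

lemma words_closed: "graded_subring P \<Longrightarrow> words P n \<subseteq> carrier L"
  using letters_closed C_closed by (fastforce simp: words_def intro: word_closed)

lemma word_homogeneous:
  assumes "graded_subring P" "v \<in> C b" "set ys \<subseteq> letters P"
  shows "word v ys \<in> C (b + sum_list (map fst ys))"
  using assms(2,3)
proof (induction ys arbitrary: v b)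
  case (Cons y ys)
  have "v \<otimes> snd y \<in> C (b + fst y)"
    using Cons.prems graded_subringD(1)[OF assms(1)] by (intro C_bracket) (auto simp: letters_def)
  from Cons.IH[OF this] Cons.prems show ?case by (simp add: add.assoc)
qed simp

lemma span_words_bracket_letter:
  assumes P: "graded_subring P" and x: "x \<in> add_span L (words P n)" and y: "y \<in> P a"
  shows "x \<otimes> y \<in> add_span L (words P (Suc n))"
proof (rule add_span_bracket_left[OF x words_closed[OF P]])
  show yc: "y \<in> carrier L" using y P graded_subringD(2) by blast
  fix w assume w: "w \<in> words P n"
  show "w \<otimes> y \<in> add_span L (words P (Suc n))"
  proof (cases "a \<in> X")
    case True
    from w obtain v ys where "w = word v ys" "v \<in> (\<Union>b\<in>X. C b)" "set ys \<subseteq> letters P" "length ys = n"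
      by (auto simp: words_def)
    hence "w \<otimes> y \<in> words P (Suc n)"
      unfolding words_def using True y
      by (intro CollectI exI[of _ v] exI[of _ "ys @ [(a, y)]"]) (auto simp: letters_def)
    thus ?thesis by (rule add_span.base)
  next
    case False
    hence "y = \<zero>" using y P graded_subringD(6) by blast
    moreover have "w \<in> carrier L" using w words_closed[OF P] by blast
    ultimately show ?thesis by (simp add: add_span.zero)
  qed
qed

text \<open>Pulling \<open>y\<close> to the left through a word creates letters
  \<open>m \<otimes> y\<close>, which stay in \<open>derived Y\<close> because it is an ideal of
  \<open>Y\<close>; at the left end \<open>y\<close> is absorbed by the first entry. No letter from
  \<open>derived Y\<close> is lost.\<close>

lemma span_words_derived_invariant:
  assumes Y: "graded_subring Y" and x: "x \<in> add_span L (words (derived Y) n)" and y: "y \<in> Y a"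
  shows "x \<otimes> y \<in> add_span L (words (derived Y) n)"
  using x
proof (induction n arbitrary: x)
  case 0
  note M = graded_subring_derived[OF Y]
  show ?case
  proof (rule add_span_bracket_left[OF 0 words_closed[OF M]])
    show "y \<in> carrier L" using y Y graded_subringD(2) by blast
    fix w assume "w \<in> words (derived Y) 0"
    then obtain b where b: "b \<in> X" "w \<in> C b" by (auto simp: words_def)
    have wy: "w \<otimes> y \<in> C (b + a)" using b y graded_subringD(1)[OF Y] by (intro C_bracket) auto
    show "w \<otimes> y \<in> add_span L (words (derived Y) 0)"
    proof (cases "b + a \<in> X")
      case True
      thus ?thesis using wy by (intro add_span.base) (auto simp: words_def)
    next
      case False
      thus ?thesis using wy C_outside by (auto intro: add_span.zero)
    qed
  qed
next
  case (Suc n)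
  note M = graded_subring_derived[OF Y]
  have yc: "y \<in> carrier L" using y Y graded_subringD(2) by blast
  show ?case
  proof (rule add_span_bracket_left[OF Suc.prems words_closed[OF M] yc])
    fix w assume "w \<in> words (derived Y) (Suc n)"
    then obtain v ys where w: "w = word v ys" "v \<in> (\<Union>b\<in>X. C b)" "set ys \<subseteq> letters (derived Y)"
      "length ys = Suc n" by (auto simp: words_def)
    then obtain zs m where ys: "ys = zs @ [m]" by (metis length_Suc_conv_rev)
    define u where "u = word v zs"
    have u: "u \<in> words (derived Y) n" using w ys by (auto simp: words_def u_def)
    have uc: "u \<in> carrier L" using u words_closed[OF M] by blast
    obtain e where e: "snd m \<in> derived Y e" using w(3) ys by (auto simp: letters_def)
    have mc: "snd m \<in> carrier L" using e M graded_subringD(2) by blast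
    have "u \<otimes> (snd m \<otimes> y) = (u \<otimes> snd m) \<otimes> y \<ominus> (u \<otimes> y) \<otimes> snd m"
      by (rule bracket_bracket[OF uc mc yc])
    hence "w \<otimes> y = u \<otimes> (snd m \<otimes> y) \<oplus> (u \<otimes> y) \<otimes> snd m"
      using uc mc yc bracket_closed by (simp add: w(1) ys u_def[symmetric] a_minus_def a_assoc l_neg)
    moreover have "u \<otimes> (snd m \<otimes> y) \<in> add_span L (words (derived Y) (Suc n))"
    proof (rule span_words_bracket_letter[OF M add_span.base[OF u]])
      show "snd m \<otimes> y \<in> derived Y (e + a)" using e y derived_subset[OF Y] by (blast intro: derivedI)
    qed
    moreover have "(u \<otimes> y) \<otimes> snd m \<in> add_span L (words (derived Y) (Suc n))"
      by (rule span_words_bracket_letter[OF M Suc.IH[OF add_span.base[OF u]] e])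
    ultimately show "w \<otimes> y \<in> add_span L (words (derived Y) (Suc n))"
      using add_span_add words_closed[OF M] by simp
  qed
qed

lemma word_invariant:
  assumes "graded_subring Y" "x \<in> add_span L (words (derived Y) n)" "set ys \<subseteq> letters Y"
  shows "word x ys \<in> add_span L (words (derived Y) n)"
  using assms(2,3)
proof (induction ys arbitrary: x)
  case (Cons y ys)
  obtain a where "snd y \<in> Y a" using Cons.prems by (auto simp: letters_def)
  with Cons show ?case using span_words_derived_invariant[OF assms(1)] by simp
qed simp

text \<open>Swapping two adjacent letters of \<open>Y\<close> costs a word in which their bracket is
  one more letter from \<open>derived Y\<close>. So letters of \<open>Y\<close> commute modulo the
  next layer.\<close>

lemma word_move:
  assumes Y: "graded_subring Y" and x: "x \<in> add_span L (words (derived Y) n)"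
    and ys: "set (y # ys) \<subseteq> letters Y"
  shows "word x (y # ys) \<ominus> word x (ys @ [y]) \<in> add_span L (words (derived Y) (Suc n))"
  using x ys
proof (induction ys arbitrary: x)
  case Nil
  note M = graded_subring_derived[OF Y]
  have "word x [y] \<in> carrier L"
    using add_span_closed[OF Nil(1) words_closed[OF M]] letters_closed[OF Y Nil(2)] by (rule word_closed)
  thus ?case by (simp add: add_span.zero)
next
  case (Cons z ys)
  note M = graded_subring_derived[OF Y]
  obtain a b where a: "snd y \<in> Y a" and b: "snd z \<in> Y b" using Cons.prems by (auto simp: letters_def)
  have cl: "x \<in> carrier L" "snd y \<in> carrier L" "snd z \<in> carrier L" "snd ` set ys \<subseteq> carrier L"
    using add_span_closed[OF Cons.prems(1) words_closed[OF M]] letters_closed[OF Y Cons.prems(2)] by auto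
  let ?V = "add_span L (words (derived Y) (Suc n))"
  have "x \<otimes> (snd y \<otimes> snd z) \<in> ?V"
    by (rule span_words_bracket_letter[OF M Cons.prems(1) derivedI[where b = a and c = b]]) fact+
  hence "word ((x \<otimes> snd y) \<otimes> snd z \<ominus> (x \<otimes> snd z) \<otimes> snd y) ys \<in> ?V"
    using bracket_bracket[OF cl(1-3)] Cons.prems(2) by (intro word_invariant[OF Y]) auto
  hence 1: "word x (y # z # ys) \<ominus> word x (z # y # ys) \<in> ?V"
    using cl by (simp add: word_diff bracket_closed)
  have 2: "word (x \<otimes> snd z) (y # ys) \<ominus> word (x \<otimes> snd z) (ys @ [y]) \<in> ?V"
    using Cons.prems by (intro Cons.IH span_words_derived_invariant[OF Y _ b]) auto
  have "word x (y # z # ys) \<ominus> word x ((z # ys) @ [y]) =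
      (word x (y # z # ys) \<ominus> word x (z # y # ys)) \<oplus>
      (word (x \<otimes> snd z) (y # ys) \<ominus> word (x \<otimes> snd z) (ys @ [y]))"
    using cl by (simp add: diff_trans word_closed bracket_closed)
  thus ?case using add_span_add[OF 1 2 words_closed[OF M]] by simp
qed

lemma word_partition:
  assumes Y: "graded_subring Y" and x: "x \<in> add_span L (words (derived Y) n)"
    and ys: "set ys \<subseteq> letters Y"
  shows "word x ys \<ominus> word x (filter p ys @ filter (\<lambda>y. \<not> p y) ys)
    \<in> add_span L (words (derived Y) (Suc n))"
  using x ys
proof (induction ys arbitrary: x)
  case Nil
  note M = graded_subring_derived[OF Y]
  show ?case using add_span_closed[OF Nil(1) words_closed[OF M]] by (simp add: add_span.zero)
next
  case (Cons y ys)
  note M = graded_subring_derived[OF Y]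
  obtain a where a: "snd y \<in> Y a" using Cons.prems by (auto simp: letters_def)
  let ?V = "add_span L (words (derived Y) (Suc n))"
  let ?F = "filter p ys" and ?G = "filter (\<lambda>y. \<not> p y) ys"
  have cl: "x \<in> carrier L" "snd y \<in> carrier L" "snd ` set ys \<subseteq> carrier L"
    using add_span_closed[OF Cons.prems(1) words_closed[OF M]] letters_closed[OF Y Cons.prems(2)] by auto
  hence cl': "snd ` set ?F \<subseteq> carrier L" "snd ` set ?G \<subseteq> carrier L" by auto
  have 1: "word (x \<otimes> snd y) ys \<ominus> word (x \<otimes> snd y) (?F @ ?G) \<in> ?V"
    using Cons.prems by (intro Cons.IH span_words_derived_invariant[OF Y _ a]) auto
  show ?case
  proof (cases "p y")
    case True
    thus ?thesis using 1 by simp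
  next
    case False
    have "set (y # ?F) \<subseteq> letters Y" "set ?G \<subseteq> letters Y" using Cons.prems(2) by auto
    hence "word (word x (y # ?F) \<ominus> word x (?F @ [y])) ?G \<in> ?V"
      by (intro word_invariant[OF Y] word_move[OF Y Cons.prems(1)])
    hence 2: "word (x \<otimes> snd y) (?F @ ?G) \<ominus> word x (?F @ y # ?G) \<in> ?V"
      using cl cl' by (simp add: word_diff bracket_closed word_closed)
    have "word x (y # ys) \<ominus> word x (?F @ y # ?G) =
      (word (x \<otimes> snd y) ys \<ominus> word (x \<otimes> snd y) (?F @ ?G)) \<oplus>
      (word (x \<otimes> snd y) (?F @ ?G) \<ominus> word x (?F @ y # ?G))"
      using cl cl' by (simp add: diff_trans word_closed bracket_closed)
    thus ?thesis using add_span_add[OF 1 2 words_closed[OF M]] False by simp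
  qed
qed

text \<open>Torsion-freeness of the complex numbers: bracketing \<open>card X\<close> times with elements of the
  same degree leaves the support.\<close>

lemma word_same_degree:
  assumes P: "graded_subring P" and v: "v \<in> C b" and ys: "set ys \<subseteq> letters P"
    and a: "\<And>y. y \<in> set ys \<Longrightarrow> fst y = a" and len: "length ys \<ge> card X" "ys \<noteq> []"
  shows "word v ys = \<zero>"
proof -
  have "hd ys \<in> set ys" using len(2) by simp
  hence "a \<in> X" using a ys by (force simp: letters_def)
  hence a0: "a \<noteq> 0" using zero_notin_X by auto
  have "\<not> (\<lambda>k. b + of_nat k * a) ` {..card X} \<subseteq> X"
  proof
    assume "(\<lambda>k. b + of_nat k * a) ` {..card X} \<subseteq> X"
    hence "card ((\<lambda>k. b + of_nat k * a) ` {..card X}) \<le> card X" by (rule card_mono[OF finite_X])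
    moreover have "inj_on (\<lambda>k. b + of_nat k * a) {..card X}" using a0 by (auto simp: inj_on_def)
    ultimately show False by (simp add: card_image)
  qed
  then obtain k where k: "k \<le> card X" "b + of_nat k * a \<notin> X" by auto
  have sub: "set (take k ys) \<subseteq> letters P" "set (drop k ys) \<subseteq> letters P"
    using ys set_take_subset set_drop_subset by fast+
  have "map fst (take k ys) = replicate k a"
    using a k(1) len(1) by (intro nth_equalityI) auto
  hence "word v (take k ys) \<in> C (b + of_nat k * a)"
    using word_homogeneous[OF P v sub(1)] by (simp add: sum_list_replicate)
  hence "word v (take k ys) = \<zero>" using C_outside[OF k(2)] by blast
  moreover have "word v ys = word (word v (take k ys)) (drop k ys)"
    by (metis append_take_drop_id word_simps(3))
  ultimately show ?thesis using word_zero[OF letters_closed[OF P sub(2)]] by simp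
qed

text \<open>Among \<open>card X * card X + 1\<close> letters some degree occurs more than
  \<open>card X\<close> times. Collected in front, these letters kill the word, so only the cost of
  the rearrangement is left, which lies in the next layer.\<close>

lemma long_word:
  assumes Y: "graded_subring Y" and x: "x \<in> add_span L (words (derived Y) n)"
    and ys: "set ys \<subseteq> letters Y" and len: "length ys = Suc (card X * card X)"
  shows "word x ys \<in> add_span L (words (derived Y) (Suc n))"
proof -
  note M = graded_subring_derived[OF Y]
  have ysc: "snd ` set ys \<subseteq> carrier L" using letters_closed[OF Y ys] .
  have "\<exists>a. length (filter (\<lambda>y. fst y = a) ys) > card X"
  proof (rule ccontr)
    assume *: "\<not> ?thesis"
    have "length ys = (\<Sum>a\<in>X. length (filter (\<lambda>y. fst y = a) ys))"
    proof -
      have "(\<Sum>a\<in>X. length (filter (\<lambda>y. fst y = a) zs)) = length zs" if "fst ` set zs \<subseteq> X"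
        for zs :: "(complex \<times> 'a) list"
        using that
      proof (induction zs)
        case (Cons z zs)
        have "(\<Sum>a\<in>X. length (filter (\<lambda>y. fst y = a) (z # zs))) =
            (\<Sum>a\<in>X. (if a = fst z then 1 else 0) + length (filter (\<lambda>y. fst y = a) zs))"
          by (intro sum.cong) auto
        also have "\<dots> = 1 + length zs" using Cons finite_X by (simp add: sum.distrib)
        finally show ?case by simp
      qed simp
      moreover have "fst ` set ys \<subseteq> X" using ys by (auto simp: letters_def)
      ultimately show ?thesis by simp
    qed
    also have "\<dots> \<le> (\<Sum>a\<in>X. card X)" using * by (intro sum_mono) (auto simp: not_less)
    finally show False using len by simp
  qed
  then obtain a where a: "length (filter (\<lambda>y. fst y = a) ys) > card X" by blast
  let ?F = "filter (\<lambda>y. fst y = a) ys" and ?G = "filter (\<lambda>y. fst y \<noteq> a) ys"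
  have "?F \<noteq> []" using a by auto
  have hom: "word w ys \<in> add_span L (words (derived Y) (Suc n))" if w: "w \<in> words (derived Y) n" for w
  proof -
    obtain v zs b where v: "w = word v zs" "v \<in> C b" "set zs \<subseteq> letters (derived Y)"
      using w by (auto simp: words_def)
    have "word w ?F = \<zero>"
      unfolding v(1)
      by (rule word_same_degree[OF Y word_homogeneous[OF M v(2,3)], where a = a])
        (use ys a \<open>?F \<noteq> []\<close> in auto)
    moreover have "snd ` set ?G \<subseteq> snd ` set ys" by (intro image_mono) auto
    ultimately have "word w (?F @ ?G) = \<zero>" using ysc by (simp add: word_zero)
    moreover have "word w ys \<in> carrier L"
      using words_closed[OF M] w ysc by (intro word_closed) auto
    ultimately show ?thesis
      using word_partition[OF Y add_span.base[OF w] ys, of "\<lambda>y. fst y = a"] by simp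
  qed
  show ?thesis
    using x
  proof induction
    case zero
    show ?case using word_zero[OF ysc] by (simp add: add_span.zero)
  next
    case (diff x y)
    thus ?case using ysc add_span_closed[OF _ words_closed[OF M]] by (simp add: word_diff add_span.diff)
  qed (rule hom)
qed

text \<open>Each block of \<open>l\<close> letters from \<open>Y\<close> yields one more letter from
  \<open>derived Y\<close>, so \<open>c\<close> blocks reach the layer that vanishes.\<close>

lemma acts_nilpotently_step:
  assumes Y: "graded_subring Y" and c: "words (derived Y) c \<subseteq> {\<zero>}"
  shows "\<exists>e. words Y e \<subseteq> {\<zero>}"
proof -
  define l where "l = Suc (card X * card X)"
  have step: "word x ys \<in> add_span L (words (derived Y) (n + k))"
    if "x \<in> add_span L (words (derived Y) n)" "set ys \<subseteq> letters Y" "length ys = k * l" for x ys n k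
    using that
  proof (induction k arbitrary: x ys n)
    case (Suc k)
    have "ys = take l ys @ drop l ys" by simp
    hence "word x ys = word (word x (take l ys)) (drop l ys)" by (metis word_simps(3))
    moreover have "word x (take l ys) \<in> add_span L (words (derived Y) (Suc n))"
      using Suc.prems set_take_subset[of l ys]
      by (intro long_word[OF Y]) (auto simp: l_def)
    ultimately show ?case
      using Suc.IH[of "word x (take l ys)" "Suc n" "drop l ys"] Suc.prems set_drop_subset[of l ys]
      by auto
  qed simp
  have zero: "x = \<zero>" if "x \<in> add_span L (words (derived Y) c)" for x
    using that by induction (use c in auto)
  have "words Y (c * l) \<subseteq> {\<zero>}"
  proof
    fix w assume "w \<in> words Y (c * l)"
    then obtain v ys where w: "w = word v ys" "v \<in> (\<Union>b\<in>X. C b)" "set ys \<subseteq> letters Y" "length ys = c * l"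
      by (auto simp: words_def)
    have "v \<in> add_span L (words (derived Y) 0)" using w(2) by (intro add_span.base) (auto simp: words_def)
    from step[OF this w(3,4)] show "w \<in> {\<zero>}" using zero w(1) by simp
  qed
  thus ?thesis ..
qed

lemma lower_central_words: "lower_central L n \<subseteq> add_span L (words C n)"
proof (induction n)
  case 0
  have "words C 0 = (\<Union>b\<in>X. C b)" by (auto simp: words_def)
  thus ?case using C_generates by simp
next
  case (Suc n)
  have homc: "(\<Union>b\<in>X. C b) \<subseteq> carrier L" using C_closed by blast
  let ?B = "{x \<otimes> y | x y. x \<in> lower_central L n \<and> y \<in> carrier L}"
  have B: "?B \<subseteq> add_span L (words C (Suc n))"
  proof clarify
    fix x y assume x: "x \<in> lower_central L n" and y: "y \<in> carrier L"
    show "x \<otimes> y \<in> add_span L (words C (Suc n))"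
    proof (rule add_span_bracket_right[OF _ homc])
      show "y \<in> add_span L (\<Union>b\<in>X. C b)" using y C_generates by blast
      show "x \<in> carrier L" using x lower_central_closed by blast
      fix b assume "b \<in> (\<Union>b\<in>X. C b)"
      thus "x \<otimes> b \<in> add_span L (words C (Suc n))"
        using span_words_bracket_letter[OF graded_subring_C] x Suc.IH by blast
    qed
  qed
  show ?case
  proof
    fix x assume "x \<in> lower_central L (Suc n)"
    hence "x \<in> add_span L ?B" by (simp only: lower_central_Suc_eq_add_span)
    thus "x \<in> add_span L (words C (Suc n))"
      by induction (use B in \<open>auto intro: add_span.zero add_span.diff\<close>)
  qed
qed

text \<open>The derived series is climbed from its vanishing term back to \<open>C\<close>:
  nilpotent action passes from \<open>derived Y\<close> to \<open>Y\<close>. For \<open>C\<close>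
  itself, the vanishing of all words of some length is nilpotency.\<close>

theorem nilpotent: "lie_nilpotent L"
proof -
  obtain n where n: "\<And>a. (derived ^^ n) C a = {\<zero>}" using solvable by blast
  have "\<exists>e. words ((derived ^^ (n - k)) C) e \<subseteq> {\<zero>}" if "k \<le> n" for k
    using that
  proof (induction k)
    case 0
    have "word v [y] = \<zero>" if "v \<in> (\<Union>b\<in>X. C b)" "y \<in> letters ((derived ^^ n) C)" for v y
    proof -
      have "v \<in> carrier L" using that(1) C_closed by blast
      thus ?thesis using that(2) n by (auto simp: letters_def)
    qed
    moreover have "\<exists>v y. w = word v [y] \<and> v \<in> (\<Union>b\<in>X. C b) \<and> y \<in> letters ((derived ^^ n) C)"
      if w1: "w \<in> words ((derived ^^ n) C) 1" for w
    proof -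
      obtain v ys where w: "w = word v ys" "v \<in> (\<Union>b\<in>X. C b)" "set ys \<subseteq> letters ((derived ^^ n) C)"
        "length ys = 1" using w1 by (auto simp: words_def)
      then obtain y where "ys = [y]" by (cases ys) auto
      with w(1,3) have "w = word v [y]" "y \<in> letters ((derived ^^ n) C)" by simp_all
      with w(2) show ?thesis by blast
    qed
    ultimately have "words ((derived ^^ n) C) 1 \<subseteq> {\<zero>}" by blast
    thus ?case by auto
  next
    case (Suc k)
    hence "derived ((derived ^^ (n - Suc k)) C) = (derived ^^ (n - k)) C"
      by (metis Suc_diff_Suc Suc_le_lessD comp_apply funpow.simps(2))
    thus ?case using Suc acts_nilpotently_step[OF graded_subring_derived_pow[OF graded_subring_C]]
      by (metis Suc_leD)
  qed
  from this[of n] obtain e where e: "words C e \<subseteq> {\<zero>}" by auto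
  have "x = \<zero>" if "x \<in> add_span L (words C e)" for x
    using that by induction (use e in auto)
  hence "lower_central L e \<subseteq> {\<zero>}" using lower_central_words by blast
  thus ?thesis unfolding lie_nilpotent_def using zero_in_lower_central by blast
qed

end


section \<open>Lie rings over orders with a derivation\<close>

lemma (in abelian_group) additive_map:
  assumes f: "\<And>x. x \<in> carrier G \<Longrightarrow> f x \<in> carrier G"
    and add: "\<And>x y. \<lbrakk>x \<in> carrier G; y \<in> carrier G\<rbrakk> \<Longrightarrow> f (x \<oplus> y) = f x \<oplus> f y"
  shows "f \<zero> = \<zero>" "x \<in> carrier G \<Longrightarrow> f (\<ominus> x) = \<ominus> f x"
    "\<lbrakk>x \<in> carrier G; y \<in> carrier G\<rbrakk> \<Longrightarrow> f (x \<ominus> y) = f x \<ominus> f y"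
proof -
  show 0: "f \<zero> = \<zero>" using add[of \<zero> \<zero>] f[of \<zero>] by (simp add: add.l_cancel_one)
  show neg: "f (\<ominus> x) = \<ominus> f x" if "x \<in> carrier G" for x
    using add[of "\<ominus> x" x] 0 that f by (simp add: l_neg minus_equality)
  show "f (x \<ominus> y) = f x \<ominus> f y" if "x \<in> carrier G" "y \<in> carrier G"
    using that by (simp add: a_minus_def add neg)
qed

context lie_ring
begin

lemma lie_subring:
  assumes H: "H \<subseteq> carrier L" "\<zero> \<in> H" "\<And>x y. \<lbrakk>x \<in> H; y \<in> H\<rbrakk> \<Longrightarrow> x \<ominus> y \<in> H"
    "\<And>x y. \<lbrakk>x \<in> H; y \<in> H\<rbrakk> \<Longrightarrow> x \<otimes> y \<in> H"
  shows "lie_ring (L\<lparr>carrier := H\<rparr>)"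
    "\<And>x y. \<lbrakk>x \<in> H; y \<in> H\<rbrakk> \<Longrightarrow> x \<ominus>\<^bsub>L\<lparr>carrier := H\<rparr>\<^esub> y = x \<ominus> y"
    "\<And>F f. f \<in> F \<rightarrow> H \<Longrightarrow> (\<Oplus>\<^bsub>L\<lparr>carrier := H\<rparr>\<^esub>a\<in>F. f a) = (\<Oplus>a\<in>F. f a)"
proof -
  let ?K = "L\<lparr>carrier := H\<rparr>"
  have inv: "\<ominus> x \<in> H" if "x \<in> H" for x
    using H(3)[OF H(2) that] that H(1) by (simp add: a_minus_def subset_iff)
  have add: "x \<oplus> y \<in> H" if "x \<in> H" "y \<in> H" for x y
    using H(3)[OF that(1) inv[OF that(2)]] that H(1) by (simp add: a_minus_def subset_iff)
  have Hc: "x \<in> carrier L" if "x \<in> H" for x using that H(1) by blast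
  have ag: "abelian_group ?K"
  proof (rule abelian_groupI)
    fix x assume x: "x \<in> carrier ?K"
    show "\<exists>y\<in>carrier ?K. y \<oplus>\<^bsub>?K\<^esub> x = \<zero>\<^bsub>?K\<^esub>"
      using x inv Hc by (intro bexI[of _ "\<ominus> x"]) (auto simp: l_neg)
  qed (use H(2) add Hc in \<open>auto simp: a_ac\<close>)
  interpret K: abelian_group ?K by (rule ag)
  show lr: "lie_ring ?K"
    by unfold_locales (use H(4) Hc bracket_add_left bracket_add_right bracket_self jacobi in auto)
  show "x \<ominus>\<^bsub>?K\<^esub> y = x \<ominus> y" if "x \<in> H" "y \<in> H" for x y
  proof -
    have "\<ominus>\<^bsub>?K\<^esub> y = \<ominus> y"
      by (rule K.minus_equality) (use that inv Hc in \<open>auto simp: l_neg\<close>)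
    thus ?thesis by (simp add: a_minus_def)
  qed
  show "(\<Oplus>\<^bsub>?K\<^esub>a\<in>F. f a) = (\<Oplus>a\<in>F. f a)" if "f \<in> F \<rightarrow> H" for F and f :: "'z \<Rightarrow> 'a"
    using that
  proof (induction F rule: infinite_finite_induct)
    case (insert x F)
    hence "f \<in> F \<rightarrow> H" "f \<in> F \<rightarrow> carrier L" "f x \<in> H" "f x \<in> carrier L" using Hc by (auto simp: Pi_iff)
    thus ?case using insert by (simp add: finsum_insert K.finsum_insert)
  qed (simp_all add: finsum_infinite K.finsum_infinite)
qed

end

text \<open>A Lie algebra over \<open>S\<close> with an \<open>S\<close>-linear derivation. The
  scalars are taken from the type \<open>complex\<close>, so the laws for \<open>scal\<close> that
  involve arbitrary scalars carry conditions of membership in \<open>S\<close>.\<close>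

locale order_lie_ring = lie_ring M + complex_subring S for M (structure) and S +
  fixes scal :: "complex \<Rightarrow> 'a \<Rightarrow> 'a" and dd :: "'a \<Rightarrow> 'a"
  assumes scal_closed: "\<lbrakk>\<alpha> \<in> S; v \<in> carrier M\<rbrakk> \<Longrightarrow> scal \<alpha> v \<in> carrier M"
    and scal_add_vec: "\<lbrakk>\<alpha> \<in> S; v \<in> carrier M; w \<in> carrier M\<rbrakk> \<Longrightarrow> scal \<alpha> (v \<oplus> w) = scal \<alpha> v \<oplus> scal \<alpha> w"
    and scal_add: "\<lbrakk>\<alpha> \<in> S; \<beta> \<in> S; v \<in> carrier M\<rbrakk> \<Longrightarrow> scal (\<alpha> + \<beta>) v = scal \<alpha> v \<oplus> scal \<beta> v"
    and scal_mult: "\<lbrakk>\<alpha> \<in> S; \<beta> \<in> S; v \<in> carrier M\<rbrakk> \<Longrightarrow> scal (\<alpha> * \<beta>) v = scal \<alpha> (scal \<beta> v)"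
    and scal_one: "v \<in> carrier M \<Longrightarrow> scal 1 v = v"
    and scal_bracket: "\<lbrakk>\<alpha> \<in> S; v \<in> carrier M; w \<in> carrier M\<rbrakk> \<Longrightarrow> scal \<alpha> (v \<otimes> w) = scal \<alpha> v \<otimes> w"
    and dd_closed: "v \<in> carrier M \<Longrightarrow> dd v \<in> carrier M"
    and dd_add: "\<lbrakk>v \<in> carrier M; w \<in> carrier M\<rbrakk> \<Longrightarrow> dd (v \<oplus> w) = dd v \<oplus> dd w"
    and dd_scal: "\<lbrakk>\<alpha> \<in> S; v \<in> carrier M\<rbrakk> \<Longrightarrow> dd (scal \<alpha> v) = scal \<alpha> (dd v)"
    and dd_bracket: "\<lbrakk>v \<in> carrier M; w \<in> carrier M\<rbrakk> \<Longrightarrow> dd (v \<otimes> w) = (dd v \<otimes> w) \<oplus> (v \<otimes> dd w)"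
begin

lemma scal_zero_vec [simp]: "\<alpha> \<in> S \<Longrightarrow> scal \<alpha> \<zero> = \<zero>"
  by (rule additive_map(1)[where f = "scal \<alpha>"]) (simp_all add: scal_closed scal_add_vec)

lemma scal_uminus: "\<lbrakk>\<alpha> \<in> S; v \<in> carrier M\<rbrakk> \<Longrightarrow> scal \<alpha> (\<ominus> v) = \<ominus> scal \<alpha> v"
  by (rule additive_map(2)[where f = "scal \<alpha>"]) (simp_all add: scal_closed scal_add_vec)

lemma scal_diff:
  "\<lbrakk>\<alpha> \<in> S; v \<in> carrier M; w \<in> carrier M\<rbrakk> \<Longrightarrow> scal \<alpha> (v \<ominus> w) = scal \<alpha> v \<ominus> scal \<alpha> w"
  by (rule additive_map(3)[where f = "scal \<alpha>"]) (simp_all add: scal_closed scal_add_vec)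

lemma dd_zero [simp]: "dd \<zero> = \<zero>"
  by (rule additive_map(1)[where f = dd]) (simp_all add: dd_closed dd_add)

lemma scal_zero [simp]: "v \<in> carrier M \<Longrightarrow> scal 0 v = \<zero>"
  using scal_add[of 0 0 v] scal_closed[of 0 v] by (simp add: add.l_cancel_one)

lemma scal_bracket_right:
  assumes "\<alpha> \<in> S" "v \<in> carrier M" "w \<in> carrier M"
  shows "scal \<alpha> (v \<otimes> w) = v \<otimes> scal \<alpha> w"
  using assms bracket_closed scal_closed
  by (simp add: bracket_swap[of w v] bracket_swap[of "scal \<alpha> w" v] scal_uminus scal_bracket)

section \<open>Polynomials in the derivation\<close>

text \<open>The operator \<open>p(dd)\<close> by Horner's scheme, which matches induction along
  \<open>pCons\<close>.\<close>

definition act :: "complex poly \<Rightarrow> 'a \<Rightarrow> 'a" where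
  "act p v = fold_coeffs (\<lambda>\<alpha> w. scal \<alpha> v \<oplus> dd w) p \<zero>"

lemma act_0 [simp]: "act 0 v = \<zero>"
  by (simp add: act_def)

lemma act_pCons: "v \<in> carrier M \<Longrightarrow> act (pCons \<alpha> p) v = scal \<alpha> v \<oplus> dd (act p v)"
  by (cases "p = 0"; cases "\<alpha> = 0") (simp_all add: act_def)

lemma act_closed: "\<lbrakk>p \<in> polys_over S; v \<in> carrier M\<rbrakk> \<Longrightarrow> act p v \<in> carrier M"
proof (induction p)
  case (pCons \<alpha> p)
  thus ?case using polys_pConsD[OF pCons.prems(1)] by (simp add: act_pCons scal_closed dd_closed)
qed simp

lemma act_add_vec:
  "\<lbrakk>p \<in> polys_over S; v \<in> carrier M; w \<in> carrier M\<rbrakk> \<Longrightarrow> act p (v \<oplus> w) = act p v \<oplus> act p w"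
proof (induction p)
  case (pCons \<alpha> p)
  thus ?case using polys_pConsD[OF pCons.prems(1)]
    by (simp add: act_pCons scal_closed dd_closed act_closed dd_add scal_add_vec a_ac)
qed simp

lemma act_zero_vec [simp]: "p \<in> polys_over S \<Longrightarrow> act p \<zero> = \<zero>"
  by (rule additive_map(1)[where f = "act p"]) (simp_all add: act_closed act_add_vec)

lemma act_diff:
  "\<lbrakk>p \<in> polys_over S; v \<in> carrier M; w \<in> carrier M\<rbrakk> \<Longrightarrow> act p (v \<ominus> w) = act p v \<ominus> act p w"
  by (rule additive_map(3)[where f = "act p"]) (simp_all add: act_closed act_add_vec)

lemma act_add:
  "\<lbrakk>p \<in> polys_over S; q \<in> polys_over S; v \<in> carrier M\<rbrakk> \<Longrightarrow> act (p + q) v = act p v \<oplus> act q v"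
proof (induction p arbitrary: q)
  case 0
  thus ?case by (simp add: act_closed)
next
  case (pCons \<alpha> p)
  obtain \<beta> q' where q: "q = pCons \<beta> q'" by (cases q)
  have "\<alpha> \<in> S" "p \<in> polys_over S" "\<beta> \<in> S" "q' \<in> polys_over S"
    using polys_pConsD pCons.prems(1,2) q by blast+
  thus ?case using pCons.prems(3) pCons.IH
    by (simp add: q act_pCons scal_add dd_add scal_closed dd_closed act_closed a_ac)
qed

lemma act_smult:
  "\<lbrakk>\<alpha> \<in> S; p \<in> polys_over S; v \<in> carrier M\<rbrakk> \<Longrightarrow> act (smult \<alpha> p) v = scal \<alpha> (act p v)"
proof (induction p)
  case (pCons \<beta> p)
  have "\<beta> \<in> S" "p \<in> polys_over S" using polys_pConsD pCons.prems(2) by blast+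
  thus ?case using pCons.prems pCons.IH
    by (simp add: act_pCons scal_add_vec dd_scal scal_mult scal_closed dd_closed act_closed)
qed simp

lemma act_mult:
  "\<lbrakk>p \<in> polys_over S; q \<in> polys_over S; v \<in> carrier M\<rbrakk> \<Longrightarrow> act (p * q) v = act p (act q v)"
proof (induction p)
  case (pCons \<alpha> p)
  have *: "\<alpha> \<in> S" "p \<in> polys_over S" using polys_pConsD pCons.prems(1) by blast+
  have "pCons 0 (p * q) \<in> polys_over S" using *(2) pCons.prems(2) by blast
  thus ?case using pCons.prems pCons.IH *
    by (simp add: act_pCons act_add act_smult polys_smult act_closed dd_closed)
qed simp

lemma act_const [simp]: "v \<in> carrier M \<Longrightarrow> \<alpha> \<in> S \<Longrightarrow> act [:\<alpha>:] v = scal \<alpha> v"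
  by (simp add: act_pCons scal_closed)

lemma act_one [simp]: "v \<in> carrier M \<Longrightarrow> act 1 v = v"
  by (simp add: one_pCons scal_one)

lemma act_monom: "\<lbrakk>\<alpha> \<in> S; v \<in> carrier M\<rbrakk> \<Longrightarrow> act (monom \<alpha> k) v = scal \<alpha> ((dd ^^ k) v)"
proof (induction k)
  case (Suc k)
  have "(dd ^^ k) v \<in> carrier M" by (induction k) (use Suc.prems dd_closed in auto)
  thus ?case using Suc by (simp add: monom_Suc act_pCons dd_scal dd_closed scal_closed)
qed (simp add: monom_0)

lemma act_sum:
  assumes "finite I" "\<And>i. i \<in> I \<Longrightarrow> p i \<in> polys_over S" "v \<in> carrier M"
  shows "act (\<Sum>i\<in>I. p i) v = (\<Oplus>i\<in>I. act (p i) v)"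
  using assms(1,2)
proof (induction I)
  case (insert i I)
  thus ?case using assms(3)
    by (simp add: act_add polys_sum finsum_insert act_closed Pi_iff)
qed simp

lemma act_finsum:
  assumes "finite I" "f \<in> I \<rightarrow> carrier M" "p \<in> polys_over S"
  shows "act p (\<Oplus>i\<in>I. f i) = (\<Oplus>i\<in>I. act p (f i))"
  using assms(1,2)
proof (induction I)
  case (insert i I)
  thus ?case using assms(3)
    by (simp add: act_add_vec finsum_insert act_closed Pi_iff)
qed (simp add: assms(3))

section \<open>Regular scalars and Bezout identities\<close>

text \<open>The scalars that can be cancelled in \<open>M\<close>, a substitute for division. They
  are closed under products and under divisors within \<open>S\<close>, which is how the torsion
  hypothesis reaches the differences of roots.\<close>

definition regular :: "complex set" where
  "regular = {\<alpha> \<in> S. \<forall>v\<in>carrier M. scal \<alpha> v = \<zero> \<longrightarrow> v = \<zero>}"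

lemma regular_in: "\<alpha> \<in> regular \<Longrightarrow> \<alpha> \<in> S"
  by (simp add: regular_def)

lemma regular_one: "1 \<in> regular"
  by (simp add: regular_def scal_one)

lemma regular_mult: "\<lbrakk>\<alpha> \<in> regular; \<beta> \<in> regular\<rbrakk> \<Longrightarrow> \<alpha> * \<beta> \<in> regular"
  unfolding regular_def mem_Collect_eq by (metis mult_in scal_closed scal_mult)

lemma regular_power: "\<alpha> \<in> regular \<Longrightarrow> \<alpha> ^ n \<in> regular"
  by (induction n) (auto simp: regular_one regular_mult)

lemma regular_prod: "(\<And>i. i \<in> I \<Longrightarrow> f i \<in> regular) \<Longrightarrow> prod f I \<in> regular"
  by (induction I rule: infinite_finite_induct) (auto simp: regular_one regular_mult)

lemma regular_divisor:
  assumes "\<alpha> * \<beta> \<in> regular" "\<alpha> \<in> S" "\<beta> \<in> S"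
  shows "\<alpha> \<in> regular"
proof -
  have "v = \<zero>" if "v \<in> carrier M" "scal \<alpha> v = \<zero>" for v
  proof -
    have "scal (\<alpha> * \<beta>) v = \<zero>"
      using assms that scal_mult[of \<beta> \<alpha> v] by (simp add: mult.commute)
    thus ?thesis using assms(1) that(1) unfolding regular_def by blast
  qed
  thus ?thesis using assms(2) by (simp add: regular_def)
qed

abbreviation lin :: "complex \<Rightarrow> complex poly" where
  "lin \<mu> \<equiv> [:-\<mu>, 1:]"

lemma lin_polys: "\<mu> \<in> S \<Longrightarrow> lin \<mu> ^ k \<in> polys_over S"
  by (intro polys_power polys_pCons uminus_in) auto

text \<open>The ideal generated by \<open>U\<close> and \<open>lin \<nu> ^ K\<close> contains a
  power of the constant \<open>U(\<nu>)\<close>. Both generators annihilate \<open>v\<close>, so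
  this regular constant does, too.\<close>

lemma killed_by_coprime:
  assumes U: "U \<in> polys_over S" "act U v = \<zero>" and nu: "\<nu> \<in> S" "act (lin \<nu> ^ K) v = \<zero>"
    and reg: "poly U \<nu> \<in> regular" and v: "v \<in> carrier M"
  shows "v = \<zero>"
proof -
  obtain A B where AB: "A \<in> polys_over S" "B \<in> polys_over S" "[:poly U \<nu> ^ K:] = A * U + B * lin \<nu> ^ K"
    using eval_power_in_ideal[OF U(1) nu(1), of K] by (elim bexE)
  have "scal (poly U \<nu> ^ K) v = act [:poly U \<nu> ^ K:] v"
    using v regular_in[OF reg] by (simp add: power_in)
  also have "\<dots> = act (A * U) v \<oplus> act (B * lin \<nu> ^ K) v"
    unfolding AB(3) using AB(1,2) U(1) lin_polys[OF nu(1)] v by (intro act_add polys_mult)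
  also have "\<dots> = act A (act U v) \<oplus> act B (act (lin \<nu> ^ K) v)"
    using AB(1,2) U(1) lin_polys[OF nu(1)] v by (simp only: act_mult)
  also have "\<dots> = \<zero>" using U(2) nu(2) AB(1,2) by simp
  finally show ?thesis using regular_power[OF reg, of K] v by (auto simp: regular_def)
qed

text \<open>The partition of unity of the Chinese remainder theorem, up to a regular constant. A new
  factor \<open>lin \<nu> ^ e\<close> is joined by expressing a power of \<open>U(\<nu>)\<close>
  through it and the product \<open>U\<close> of the old factors; \<open>U(\<nu>)\<close> is a
  product of powers of differences.\<close>

lemma linear_powers_comaximal:
  assumes "finite I" "I \<noteq> {}" "I \<subseteq> S"
    and "\<And>i j. \<lbrakk>i \<in> I; j \<in> I; i \<noteq> j\<rbrakk> \<Longrightarrow> i - j \<in> regular"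
  shows "\<exists>c\<in>regular. \<exists>p. (\<forall>i\<in>I. p i \<in> polys_over S) \<and> (\<Sum>i\<in>I. p i * (\<Prod>j\<in>I - {i}. lin j ^ e)) = [:c:]"
  using assms
proof (induction I rule: finite_ne_induct)
  case (singleton i)
  show ?case by (intro bexI[of _ 1] exI[of _ "\<lambda>_. 1"]) (auto simp: regular_one one_pCons)
next
  case (insert \<nu> I)
  have "\<exists>c\<in>regular. \<exists>p. (\<forall>i\<in>I. p i \<in> polys_over S) \<and> (\<Sum>i\<in>I. p i * (\<Prod>j\<in>I - {i}. lin j ^ e)) = [:c:]"
    using insert.prems by (intro insert.IH) auto
  then obtain c p where c: "c \<in> regular" and p: "\<forall>i\<in>I. p i \<in> polys_over S"
    "(\<Sum>i\<in>I. p i * (\<Prod>j\<in>I - {i}. lin j ^ e)) = [:c:]" by blast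
  define U where "U = (\<Prod>j\<in>I. lin j ^ e)"
  have U: "U \<in> polys_over S" unfolding U_def using insert.prems(1) by (intro polys_prod lin_polys) auto
  have nu: "\<nu> \<in> S" using insert.prems(1) by simp
  have "poly U \<nu> = (\<Prod>j\<in>I. (\<nu> - j) ^ e)" by (simp add: U_def poly_prod)
  also have "\<dots> \<in> regular"
  proof (intro regular_prod regular_power)
    show "\<nu> - j \<in> regular" if "j \<in> I" for j using that insert by (intro insert.prems(2)) auto
  qed
  finally have reg: "poly U \<nu> \<in> regular" .
  obtain A B where AB: "A \<in> polys_over S" "B \<in> polys_over S" "[:poly U \<nu> ^ e:] = A * U + B * lin \<nu> ^ e"
    using eval_power_in_ideal[OF U nu, of e] by (elim bexE)
  \<comment> \<open>The term \<open>A * U\<close> supplies the summand for \<open>\<nu>\<close>; in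
    the other term, the factor \<open>lin \<nu> ^ e\<close> completes the product of linear powers
    in each old summand.\<close>
  define q where "q i = (if i = \<nu> then [:c:] * A else B * p i)" for i
  have "(\<Sum>i\<in>insert \<nu> I. q i * (\<Prod>j\<in>insert \<nu> I - {i}. lin j ^ e))
      = [:c:] * A * U + (\<Sum>i\<in>I. q i * (\<Prod>j\<in>insert \<nu> I - {i}. lin j ^ e))"
    using insert.hyps by (simp add: q_def U_def)
  also have "(\<Sum>i\<in>I. q i * (\<Prod>j\<in>insert \<nu> I - {i}. lin j ^ e))
      = (\<Sum>i\<in>I. (B * lin \<nu> ^ e) * (p i * (\<Prod>j\<in>I - {i}. lin j ^ e)))"
  proof (rule sum.cong)
    fix i assume i: "i \<in> I"
    hence "insert \<nu> I - {i} = insert \<nu> (I - {i})" "i \<noteq> \<nu>" using insert.hyps by auto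
    moreover have "(\<Prod>j\<in>insert \<nu> (I - {i}). lin j ^ e) = lin \<nu> ^ e * (\<Prod>j\<in>I - {i}. lin j ^ e)"
      using insert.hyps by (intro prod.insert) auto
    ultimately show "q i * (\<Prod>j\<in>insert \<nu> I - {i}. lin j ^ e)
        = (B * lin \<nu> ^ e) * (p i * (\<Prod>j\<in>I - {i}. lin j ^ e))"
      by (simp only: q_def if_False) (simp only: mult_ac)
  qed simp
  also have "\<dots> = (B * lin \<nu> ^ e) * [:c:]" by (simp only: p(2) flip: sum_distrib_left)
  also have "[:c:] * A * U + (B * lin \<nu> ^ e) * [:c:] = [:c:] * (A * U + B * lin \<nu> ^ e)"
    by (simp only: distrib_left mult_ac)
  also have "\<dots> = [:c * poly U \<nu> ^ e:]" by (simp only: AB(3)[symmetric]) simp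
  finally have eq: "(\<Sum>i\<in>insert \<nu> I. q i * (\<Prod>j\<in>insert \<nu> I - {i}. lin j ^ e)) = [:c * poly U \<nu> ^ e:]" .
  have "\<forall>i\<in>insert \<nu> I. q i \<in> polys_over S"
    using AB p(1) regular_in[OF c] by (auto simp: q_def simp del: mult_pCons_left intro!: polys_mult)
  thus ?case using eq regular_mult[OF c regular_power[OF reg]] by blast
qed

section \<open>Generalized eigenspaces\<close>

text \<open>No bound is put on the exponent, since exponents add up under brackets.\<close>

definition eig :: "complex \<Rightarrow> 'a set" where
  "eig \<mu> = {v \<in> carrier M. \<exists>K. act (lin \<mu> ^ K) v = \<zero>}"

lemma act_lin_power_mono:
  assumes "\<mu> \<in> S" "v \<in> carrier M" "act (lin \<mu> ^ K) v = \<zero>" "K \<le> K'"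
  shows "act (lin \<mu> ^ K') v = \<zero>"
proof -
  have "act (lin \<mu> ^ K') v = act (lin \<mu> ^ (K' - K) * lin \<mu> ^ K) v"
    using assms(4) by (simp flip: power_add)
  also have "\<dots> = act (lin \<mu> ^ (K' - K)) (act (lin \<mu> ^ K) v)"
    using assms(1,2) by (intro act_mult lin_polys)
  also have "\<dots> = \<zero>" using assms lin_polys by simp
  finally show ?thesis .
qed

lemma eig_closed: "eig \<mu> \<subseteq> carrier M"
  by (auto simp: eig_def)

lemma zero_in_eig: "\<mu> \<in> S \<Longrightarrow> \<zero> \<in> eig \<mu>"
  by (auto simp: eig_def intro!: exI[of _ 0])

lemma eig_diff:
  assumes "\<mu> \<in> S" "v \<in> eig \<mu>" "w \<in> eig \<mu>"
  shows "v \<ominus> w \<in> eig \<mu>"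
proof -
  obtain K K' where K: "act (lin \<mu> ^ K) v = \<zero>" "act (lin \<mu> ^ K') w = \<zero>" and vw: "v \<in> carrier M" "w \<in> carrier M"
    using assms(2,3) by (auto simp: eig_def)
  have "act (lin \<mu> ^ max K K') v = \<zero>" "act (lin \<mu> ^ max K K') w = \<zero>"
    using act_lin_power_mono[OF assms(1)] K vw by (meson max.cobounded1 max.cobounded2)+
  hence "act (lin \<mu> ^ max K K') (v \<ominus> w) = \<zero>"
    using vw lin_polys[OF assms(1), of "max K K'"] by (simp add: act_diff)
  thus ?thesis using vw by (auto simp: eig_def)
qed

lemma act_lin: "\<lbrakk>\<mu> \<in> S; v \<in> carrier M\<rbrakk> \<Longrightarrow> act (lin \<mu>) v = scal (- \<mu>) v \<oplus> dd v"
  by (simp add: act_pCons scal_one scal_closed dd_closed uminus_in)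

text \<open>The Leibniz rule, with the scalar \<open>\<rho> + \<mu>\<close> distributed over the two
  factors.\<close>

lemma act_lin_bracket:
  assumes "\<rho> \<in> S" "\<mu> \<in> S" "v \<in> carrier M" "w \<in> carrier M"
  shows "act (lin (\<rho> + \<mu>)) (v \<otimes> w) = act (lin \<rho>) v \<otimes> w \<oplus> v \<otimes> act (lin \<mu>) w"
proof -
  have S: "- \<rho> \<in> S" "- \<mu> \<in> S" using assms uminus_in by auto
  have "act (lin (\<rho> + \<mu>)) (v \<otimes> w) = scal (- \<rho> + - \<mu>) (v \<otimes> w) \<oplus> dd (v \<otimes> w)"
    using assms act_lin[of "\<rho> + \<mu>" "v \<otimes> w"] bracket_closed by (simp add: add_in)
  also have "\<dots> = (scal (- \<rho>) v \<otimes> w \<oplus> v \<otimes> scal (- \<mu>) w) \<oplus> (dd v \<otimes> w \<oplus> v \<otimes> dd w)"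
    using assms S scal_add[OF S, of "v \<otimes> w"] bracket_closed scal_bracket[OF S(1), of v w]
      scal_bracket_right[OF S(2), of v w] by (simp add: dd_bracket)
  also have "\<dots> = act (lin \<rho>) v \<otimes> w \<oplus> v \<otimes> act (lin \<mu>) w"
    using assms S act_lin[of \<rho> v] act_lin[of \<mu> w]
    by (simp add: bracket_add_left bracket_add_right bracket_closed scal_closed dd_closed a_ac del: minus_add_distrib)
  finally show ?thesis .
qed

text \<open>Each application of \<open>lin (\<rho> + \<mu>)\<close> lowers one of the exponents
  \<open>K\<close> and \<open>K'\<close> by one, and exponent 0 means that the vector itself is 0.
  So \<open>K + K'\<close> applications suffice.\<close>

lemma eig_bracket:
  assumes S: "\<rho> \<in> S" "\<mu> \<in> S" and "v \<in> eig \<rho>" "w \<in> eig \<mu>"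
  shows "v \<otimes> w \<in> eig (\<rho> + \<mu>)"
proof -
  have "act (lin (\<rho> + \<mu>) ^ n) (v \<otimes> w) = \<zero>"
    if "K + K' = n" "v \<in> carrier M" "w \<in> carrier M" "act (lin \<rho> ^ K) v = \<zero>" "act (lin \<mu> ^ K') w = \<zero>"
    for n K K' v w
    using that
  proof (induction n arbitrary: K K' v w)
    case 0
    thus ?case by simp
  next
    case (Suc n)
    have lS: "lin \<rho> \<in> polys_over S" "lin \<mu> \<in> polys_over S" "lin (\<rho> + \<mu>) \<in> polys_over S"
      using lin_polys[of _ 1] S add_in by auto
    have P: "lin (\<rho> + \<mu>) ^ n \<in> polys_over S" using lin_polys S add_in by blast
    have 1: "act (lin (\<rho> + \<mu>) ^ n) (act (lin \<rho>) v \<otimes> w) = \<zero>"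
    proof (cases K)
      case 0
      hence "v = \<zero>" using Suc.prems by simp
      thus ?thesis using P Suc.prems lS by simp
    next
      case (Suc k)
      have "act (lin \<rho> ^ k) (act (lin \<rho>) v) = act (lin \<rho> ^ k * lin \<rho>) v"
        using Suc.prems lS lin_polys[OF S(1)] by (simp only: act_mult)
      hence "act (lin \<rho> ^ k) (act (lin \<rho>) v) = \<zero>"
        using Suc.prems(4) Suc by (simp only: power_Suc mult.commute)
      thus ?thesis using Suc Suc.prems act_closed[OF lS(1)] by (intro Suc.IH[of k K']) auto
    qed
    have 2: "act (lin (\<rho> + \<mu>) ^ n) (v \<otimes> act (lin \<mu>) w) = \<zero>"
    proof (cases K')
      case 0
      hence "w = \<zero>" using Suc.prems by simp
      thus ?thesis using P Suc.prems lS by simp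
    next
      case (Suc k)
      have "act (lin \<mu> ^ k) (act (lin \<mu>) w) = act (lin \<mu> ^ k * lin \<mu>) w"
        using Suc.prems lS lin_polys[OF S(2)] by (simp only: act_mult)
      hence "act (lin \<mu> ^ k) (act (lin \<mu>) w) = \<zero>"
        using Suc.prems(5) Suc by (simp only: power_Suc mult.commute)
      thus ?thesis using Suc Suc.prems act_closed[OF lS(2)] by (intro Suc.IH[of K k]) auto
    qed
    have "act (lin (\<rho> + \<mu>) ^ Suc n) (v \<otimes> w) = act (lin (\<rho> + \<mu>) ^ n) (act (lin (\<rho> + \<mu>)) (v \<otimes> w))"
      using Suc.prems lS P bracket_closed by (simp only: power_Suc2 act_mult)
    also have "\<dots> = act (lin (\<rho> + \<mu>) ^ n) (act (lin \<rho>) v \<otimes> w) \<oplus> act (lin (\<rho> + \<mu>) ^ n) (v \<otimes> act (lin \<mu>) w)"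
      unfolding act_lin_bracket[OF S Suc.prems(2,3)]
      using Suc.prems lS P bracket_closed act_closed by (intro act_add_vec) auto
    finally show ?case using 1 2 by simp
  qed
  thus ?thesis using assms(3,4) bracket_closed by (fastforce simp: eig_def)
qed

end

section \<open>The grading by the additive group of the complex numbers\<close>

definition complex_add_group :: "complex ring" where
  "complex_add_group = \<lparr>carrier = UNIV, mult = (*), one = 1, zero = 0, add = (+)\<rparr>"

lemma complex_add_group_simps [simp]:
  "carrier complex_add_group = UNIV" "zero complex_add_group = 0"
  "x \<oplus>\<^bsub>complex_add_group\<^esub> y = x + y"
  by (simp_all add: complex_add_group_def)

lemma abelian_group_complex: "abelian_group complex_add_group"
proof (rule abelian_groupI)
  fix x :: complex
  show "\<exists>y\<in>carrier complex_add_group. y \<oplus>\<^bsub>complex_add_group\<^esub> x = \<zero>\<^bsub>complex_add_group\<^esub>"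
    by (intro bexI[of _ "- x"]) auto
qed auto

lemma complex_add_group_pow: "[k] \<cdot>\<^bsub>complex_add_group\<^esub> x = of_nat k * x" for k :: nat
proof -
  interpret abelian_group complex_add_group by (rule abelian_group_complex)
  show ?thesis by (induction k) (simp_all add: add.nat_pow_Suc algebra_simps)
qed

lemma arithmetically_free_complex:
  assumes "finite X" "0 \<notin> X"
  shows "arithmetically_free complex_add_group X"
  unfolding arithmetically_free_def
proof (intro conjI notI)
  assume "\<exists>\<alpha>\<in>X. \<exists>\<beta>\<in>X. \<forall>k::nat. \<alpha> \<oplus>\<^bsub>complex_add_group\<^esub> [k] \<cdot>\<^bsub>complex_add_group\<^esub> \<beta> \<in> X"
  then obtain \<alpha> \<beta> where b: "\<beta> \<in> X" "\<And>k :: nat. \<alpha> + of_nat k * \<beta> \<in> X"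
    by (auto simp: complex_add_group_pow)
  have "inj (\<lambda>k :: nat. \<alpha> + of_nat k * \<beta>)" using b(1) assms(2) by (auto simp: inj_on_def)
  moreover have "range (\<lambda>k :: nat. \<alpha> + of_nat k * \<beta>) \<subseteq> X" using b(2) by blast
  ultimately show False using assms(1) by (metis finite_imageD finite_subset infinite_UNIV_nat)
qed simp

text \<open>\<open>R\<close> stands for the scaled roots and \<open>e\<close> for a common bound on
  their multiplicities. The two regularity assumptions are the form in which the torsion hypothesis
  for \<open>delta r\<close> and \<open>sigma r\<close> enters.\<close>

locale split_order_lie_ring = order_lie_ring +
  fixes R :: "complex set" and e :: nat
  assumes finite_R: "finite R" and R_nonempty: "R \<noteq> {}" and R_in: "R \<subseteq> S" and zero_notin_R: "0 \<notin> R"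
    and annihilated: "v \<in> carrier M \<Longrightarrow> act (\<Prod>\<mu>\<in>R. lin \<mu> ^ e) v = \<zero>"
    and diff_regular: "\<lbrakk>\<rho> \<in> R; \<mu> \<in> R; \<rho> \<noteq> \<mu>\<rbrakk> \<Longrightarrow> \<rho> - \<mu> \<in> regular"
    and sum_regular: "\<lbrakk>\<rho> \<in> R; \<mu> \<in> R; \<rho> + \<mu> \<notin> R; \<kappa> \<in> R\<rbrakk> \<Longrightarrow> \<rho> + \<mu> - \<kappa> \<in> regular"
begin

text \<open>At \<open>\<rho> + \<mu>\<close> the annihilating polynomial takes a value composed of
  the regular factors \<open>\<rho> + \<mu> - \<kappa>\<close>, so a vector that is also killed by a
  power of \<open>lin (\<rho> + \<mu>)\<close> is 0.\<close>

lemma eig_sum_trivial: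
  assumes "\<rho> \<in> R" "\<mu> \<in> R" "\<rho> + \<mu> \<notin> R" "v \<in> eig (\<rho> + \<mu>)"
  shows "v = \<zero>"
proof -
  obtain K where K: "v \<in> carrier M" "act (lin (\<rho> + \<mu>) ^ K) v = \<zero>" using assms(4) by (auto simp: eig_def)
  have "poly (\<Prod>\<kappa>\<in>R. lin \<kappa> ^ e) (\<rho> + \<mu>) = (\<Prod>\<kappa>\<in>R. (\<rho> + \<mu> - \<kappa>) ^ e)" by (simp add: poly_prod)
  also have "\<dots> \<in> regular" using assms by (intro regular_prod regular_power sum_regular)
  finally have reg: "poly (\<Prod>\<kappa>\<in>R. lin \<kappa> ^ e) (\<rho> + \<mu>) \<in> regular" .
  show ?thesis
    by (rule killed_by_coprime[OF _ annihilated[OF K(1)] _ K(2) reg K(1)])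
      (use assms R_in in \<open>auto intro!: polys_prod lin_polys\<close>)
qed

text \<open>The product \<open>U\<close> of the other linear factors, each to a common power
  \<open>K\<close>, kills all summands but the one at \<open>\<nu>\<close>, hence by the relation
  that one as well. It is also killed by a power of \<open>lin \<nu>\<close>, whereas
  \<open>U(\<nu>)\<close> is regular.\<close>

lemma eig_independent:
  assumes I: "I \<subseteq> R" and f: "f \<in> Pi I eig" and sum: "(\<Oplus>i\<in>I. f i) = \<zero>" and nu: "\<nu> \<in> I"
  shows "f \<nu> = \<zero>"
proof -
  have finI: "finite I" using I finite_R finite_subset by blast
  have fc: "f \<in> I \<rightarrow> carrier M" using f eig_closed by blast
  have "\<exists>K. \<forall>i\<in>J. act (lin i ^ K) (f i) = \<zero>" if "finite J" "J \<subseteq> I" for J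
    using that
  proof (induction J)
    case (insert j J)
    then obtain K where K: "\<And>i. i \<in> J \<Longrightarrow> act (lin i ^ K) (f i) = \<zero>" by auto
    have "f j \<in> eig j" using f insert.prems by auto
    then obtain K' where K': "act (lin j ^ K') (f j) = \<zero>" by (auto simp: eig_def)
    have "act (lin i ^ (K + K')) (f i) = \<zero>" if i: "i \<in> insert j J" for i
    proof -
      have i': "i \<in> S" "f i \<in> carrier M" using i insert.prems I R_in fc by auto
      show ?thesis
      proof (cases "i = j")
        case True
        show ?thesis using act_lin_power_mono[OF i', of K'] K' True by simp
      next
        case False
        show ?thesis using act_lin_power_mono[OF i', of K] K[of i] i False by simp
      qed
    qed
    thus ?case by blast
  qed simp
  from this[OF finI order_refl] obtain K where "\<forall>i\<in>I. act (lin i ^ K) (f i) = \<zero>" ..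
  hence K: "act (lin i ^ K) (f i) = \<zero>" if "i \<in> I" for i using that by (rule bspec)
  define U where "U = (\<Prod>j\<in>I - {\<nu>}. lin j ^ K)"
  have IS: "I \<subseteq> S" using I R_in by blast
  have U: "U \<in> polys_over S" unfolding U_def using IS by (intro polys_prod lin_polys) auto
  have kill: "act U (f i) = \<zero>" if i: "i \<in> I - {\<nu>}" for i
  proof -
    have fi: "f i \<in> carrier M" using fc i by blast
    have "U = (\<Prod>j\<in>I - {\<nu>} - {i}. lin j ^ K) * lin i ^ K"
      unfolding U_def using prod.remove[of "I - {\<nu>}" i "\<lambda>j. lin j ^ K"] finI i by (simp only: finite_Diff mult.commute)
    hence "act U (f i) = act (\<Prod>j\<in>I - {\<nu>} - {i}. lin j ^ K) (act (lin i ^ K) (f i))"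
      using fi IS i by (auto simp only: intro!: act_mult polys_prod lin_polys)
    also have "\<dots> = \<zero>" using K i IS by (auto intro!: act_zero_vec polys_prod lin_polys)
    finally show ?thesis .
  qed
  have "\<zero> = act U (\<Oplus>i\<in>I. f i)" using sum U by simp
  also have "\<dots> = (\<Oplus>i\<in>I. act U (f i))" using finI fc U by (rule act_finsum)
  also have "\<dots> = (\<Oplus>i\<in>insert \<nu> (I - {\<nu>}). act U (f i))" using nu by (simp add: insert_absorb)
  also have "\<dots> = act U (f \<nu>) \<oplus> (\<Oplus>i\<in>I - {\<nu>}. act U (f i))"
    using finI fc U act_closed nu by (intro finsum_insert) auto
  also have "(\<Oplus>i\<in>I - {\<nu>}. act U (f i)) = (\<Oplus>i\<in>I - {\<nu>}. \<zero>)"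
    by (rule finsum_cong') (use kill in auto)
  also have "\<dots> = \<zero>" by simp
  finally have Unu: "act U (f \<nu>) = \<zero>" using fc nu U act_closed by (auto simp: Pi_iff)
  have "poly U \<nu> = (\<Prod>j\<in>I - {\<nu>}. (\<nu> - j) ^ K)" by (simp add: U_def poly_prod)
  also have "\<dots> \<in> regular" using I nu by (intro regular_prod regular_power diff_regular) auto
  finally show ?thesis
    using killed_by_coprime[OF U Unu _ K[OF nu]] nu IS fc by auto
qed

definition H :: "'a set" where
  "H = add_span M (\<Union>\<mu>\<in>R. eig \<mu>)"

lemma eig_union_closed: "(\<Union>\<mu>\<in>R. eig \<mu>) \<subseteq> carrier M"
  using eig_closed by blast

lemma H_closed: "H \<subseteq> carrier M"
  unfolding H_def using add_span_closed[OF _ eig_union_closed] by blast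

lemma H_bracket: "\<lbrakk>x \<in> H; y \<in> H\<rbrakk> \<Longrightarrow> x \<otimes> y \<in> H"
proof -
  have hom: "v \<otimes> w \<in> H" if vw: "\<rho> \<in> R" "\<mu> \<in> R" "v \<in> eig \<rho>" "w \<in> eig \<mu>" for v w \<rho> \<mu>
  proof -
    have "v \<otimes> w \<in> eig (\<rho> + \<mu>)" using vw R_in by (intro eig_bracket) auto
    thus ?thesis
    proof (cases "\<rho> + \<mu> \<in> R")
      case False
      hence "v \<otimes> w = \<zero>" using \<open>v \<otimes> w \<in> eig (\<rho> + \<mu>)\<close> vw(1,2) by (intro eig_sum_trivial)
      thus ?thesis by (simp add: H_def add_span.zero)
    qed (auto simp: H_def intro: add_span.base)
  qed
  assume x: "x \<in> H" and y: "y \<in> H"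
  show "x \<otimes> y \<in> H"
    unfolding H_def
  proof (rule add_span_bracket_left[OF x[unfolded H_def] eig_union_closed])
    show "y \<in> carrier M" using y H_closed by blast
    fix v assume v: "v \<in> (\<Union>\<mu>\<in>R. eig \<mu>)"
    show "v \<otimes> y \<in> add_span M (\<Union>\<mu>\<in>R. eig \<mu>)"
      by (rule add_span_bracket_right[OF y[unfolded H_def] eig_union_closed])
        (use v hom eig_union_closed in \<open>auto simp: H_def\<close>)
  qed
qed

abbreviation "K \<equiv> M\<lparr>carrier := H\<rparr>"

lemmas subring_H = lie_subring[OF H_closed _ _ H_bracket]

lemma H_zero: "\<zero> \<in> H"
  by (simp add: H_def add_span.zero)

lemma H_diff: "\<lbrakk>x \<in> H; y \<in> H\<rbrakk> \<Longrightarrow> x \<ominus> y \<in> H"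
  by (simp add: H_def add_span.diff)

lemma lie_ring_K: "lie_ring K"
  by (rule subring_H(1)) (auto intro: H_zero H_diff)

lemma K_diff: "\<lbrakk>x \<in> H; y \<in> H\<rbrakk> \<Longrightarrow> x \<ominus>\<^bsub>K\<^esub> y = x \<ominus> y"
  by (rule subring_H(2)) (auto intro: H_zero H_diff)

lemma K_finsum: "f \<in> F \<rightarrow> H \<Longrightarrow> (\<Oplus>\<^bsub>K\<^esub>a\<in>F. f a) = (\<Oplus>a\<in>F. f a)"
  by (rule subring_H(3)) (auto intro: H_zero H_diff)

lemma H_decompose: "x \<in> H \<Longrightarrow> \<exists>f\<in>Pi R eig. x = (\<Oplus>\<mu>\<in>R. f \<mu>)"
  unfolding H_def
proof (induction rule: add_span.induct)
  case zero
  show ?case using R_in zero_in_eig by (intro bexI[of _ "\<lambda>_. \<zero>"]) auto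
next
  case (base x)
  then obtain \<nu> where nu: "\<nu> \<in> R" "x \<in> eig \<nu>" by blast
  have xc: "x \<in> carrier M" using nu eig_closed by blast
  define f where "f \<mu> = (if \<nu> = \<mu> then x else \<zero>)" for \<mu>
  have "(\<Oplus>\<mu>\<in>R. f \<mu>) = x"
    unfolding f_def using finsum_singleton[OF nu(1) finite_R, of "\<lambda>_. x"] xc by simp
  moreover have "f \<in> Pi R eig" using nu R_in zero_in_eig by (auto simp: f_def)
  ultimately show ?case by blast
next
  case (diff x y)
  then obtain f g where f: "f \<in> Pi R eig" "x = (\<Oplus>\<mu>\<in>R. f \<mu>)" and g: "g \<in> Pi R eig" "y = (\<Oplus>\<mu>\<in>R. g \<mu>)"
    by blast
  have fc: "f \<in> R \<rightarrow> carrier M" "g \<in> R \<rightarrow> carrier M" using f g eig_closed by blast+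
  have neg: "(\<lambda>\<mu>. \<ominus> g \<mu>) \<in> R \<rightarrow> carrier M" using fc by auto
  have "(\<Oplus>\<mu>\<in>R. f \<mu> \<ominus> g \<mu>) \<oplus> (\<Oplus>\<mu>\<in>R. g \<mu>) = (\<Oplus>\<mu>\<in>R. (f \<mu> \<ominus> g \<mu>) \<oplus> g \<mu>)"
    by (rule finsum_addf[symmetric]) (use fc in auto)
  also have "\<dots> = (\<Oplus>\<mu>\<in>R. f \<mu>)"
    by (rule finsum_cong') (use fc in \<open>auto simp: a_minus_def a_assoc l_neg Pi_iff\<close>)
  finally have "(\<Oplus>\<mu>\<in>R. f \<mu> \<ominus> g \<mu>) = x \<ominus> y"
    unfolding f(2) g(2) by (rule eq_minusI) (use fc in \<open>auto simp: Pi_iff\<close>)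
  moreover have "(\<lambda>\<mu>. f \<mu> \<ominus> g \<mu>) \<in> Pi R eig" using f(1) g(1) R_in
    by (intro Pi_I eig_diff) auto
  ultimately show ?case by metis
qed

text \<open>A grading by all complex numbers has to specify every component, but the laws that
  govern \<open>eig a\<close> hold for \<open>a\<close> in \<open>S\<close> only; so the components
  off \<open>R\<close> are set to zero.\<close>

definition comp :: "complex \<Rightarrow> 'a set" where
  "comp a = (if a \<in> R then eig a else {\<zero>})"

lemma comp_H: "comp a \<subseteq> H"
  by (auto simp: comp_def H_def intro: add_span.base add_span.zero)

lemma comp_zero: "\<zero> \<in> comp a"
  using zero_in_eig R_in by (auto simp: comp_def)

lemma comp_diff: "\<lbrakk>x \<in> comp a; y \<in> comp a\<rbrakk> \<Longrightarrow> x \<ominus> y \<in> comp a"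
  using eig_diff R_in by (auto simp: comp_def split: if_splits)

lemma comp_bracket: "\<lbrakk>x \<in> comp a; y \<in> comp b\<rbrakk> \<Longrightarrow> x \<otimes> y \<in> comp (a + b)"
proof -
  assume x: "x \<in> comp a" and y: "y \<in> comp b"
  have xy: "x \<in> carrier M" "y \<in> carrier M" using x y comp_H H_closed by blast+
  show "x \<otimes> y \<in> comp (a + b)"
  proof (cases "a \<in> R \<and> b \<in> R")
    case True
    hence "x \<otimes> y \<in> eig (a + b)" using x y R_in by (intro eig_bracket) (auto simp: comp_def)
    thus ?thesis using True eig_sum_trivial by (auto simp: comp_def)
  next
    case False
    hence "x = \<zero> \<or> y = \<zero>" using x y by (auto simp: comp_def split: if_splits)
    thus ?thesis using xy comp_zero by auto
  qed
qed

lemma graded_K: "finitely_graded_lie_ring K R comp"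
proof -
  interpret K: lie_ring K by (rule lie_ring_K)
  have span: "x \<in> add_span K (\<Union>a\<in>R. comp a)" if "x \<in> H" for x
    using that[unfolded H_def]
  proof (induction rule: add_span.induct)
    case zero
    show ?case using add_span.zero[of K] by simp
  next
    case (base b)
    thus ?case by (intro add_span.base) (auto simp: comp_def)
  next
    case (diff x y)
    thus ?case using add_span.diff[OF diff.IH] K_diff by (simp add: H_def)
  qed
  show ?thesis
  proof (unfold_locales; (rule finite_R zero_notin_R)?)
    show "comp a \<subseteq> carrier K" for a using comp_H by simp
    show "\<zero>\<^bsub>K\<^esub> \<in> comp a" for a using comp_zero by simp
    show "x \<ominus>\<^bsub>K\<^esub> y \<in> comp a" if "x \<in> comp a" "y \<in> comp a" for x y a
      using that comp_diff comp_H K_diff by (metis subsetD)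
    show "comp a = {\<zero>\<^bsub>K\<^esub>}" if "a \<notin> R" for a using that by (simp add: comp_def)
    show "x \<otimes>\<^bsub>K\<^esub> y \<in> comp (a + b)" if "x \<in> comp a" "y \<in> comp b" for x y a b
      using comp_bracket[OF that] by simp
    show "carrier K \<subseteq> add_span K (\<Union>a\<in>R. comp a)" using span by auto
  qed
qed

lemma higman_graded_K:
  assumes "card R \<le> n"
  shows "higman_graded n K complex_add_group comp"
proof -
  interpret K: lie_ring K by (rule lie_ring_K)
  have "lie_grading K complex_add_group comp"
    unfolding lie_grading_def
  proof (intro conjI ballI allI impI)
    fix a
    show "subgroup (comp a) (add_monoid K)"
    proof (rule K.add.subgroupI)
      show "comp a \<subseteq> carrier K" using comp_H by simp
      show "comp a \<noteq> {}" using comp_zero by blast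
      have inv: "\<ominus>\<^bsub>K\<^esub> x \<in> comp a" if "x \<in> comp a" for x
      proof -
        have "\<zero> \<ominus>\<^bsub>K\<^esub> x = \<zero> \<ominus> x" using that comp_H comp_zero[of a] by (intro K_diff) auto
        moreover have "\<zero>\<^bsub>K\<^esub> \<ominus>\<^bsub>K\<^esub> x = \<ominus>\<^bsub>K\<^esub> x"
          using that comp_H unfolding a_minus_def by (intro K.l_zero K.a_inv_closed) auto
        ultimately show ?thesis using comp_diff[OF comp_zero that] by simp
      qed
      thus "\<ominus>\<^bsub>K\<^esub> x \<in> comp a" if "x \<in> comp a" for x using that .
      show "x \<oplus>\<^bsub>K\<^esub> y \<in> comp a" if xy: "x \<in> comp a" "y \<in> comp a" for x y
      proof -
        have "x \<ominus>\<^bsub>K\<^esub> (\<ominus>\<^bsub>K\<^esub> y) \<in> comp a"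
        proof -
          have "x \<ominus>\<^bsub>K\<^esub> (\<ominus>\<^bsub>K\<^esub> y) = x \<ominus> (\<ominus>\<^bsub>K\<^esub> y)"
            using xy inv comp_H by (intro K_diff) auto
          thus ?thesis using comp_diff[OF xy(1) inv[OF xy(2)]] by simp
        qed
        moreover have "x \<ominus>\<^bsub>K\<^esub> (\<ominus>\<^bsub>K\<^esub> y) = x \<oplus>\<^bsub>K\<^esub> y"
        proof -
          have "y \<in> carrier K" using xy(2) comp_H by auto
          thus ?thesis unfolding a_minus_def by (simp only: K.minus_minus)
        qed
        ultimately show ?thesis by simp
      qed
    qed
  next
    fix x assume "x \<in> carrier K"
    then obtain f where f: "f \<in> Pi R eig" "x = (\<Oplus>\<mu>\<in>R. f \<mu>)" using H_decompose by auto
    have fC: "f \<in> Pi R comp" using f(1) by (auto simp: comp_def)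
    hence fH: "f \<in> R \<rightarrow> H" using comp_H by blast
    have "x = (\<Oplus>\<^bsub>K\<^esub>\<mu>\<in>R. f \<mu>)" unfolding K_finsum[OF fH] by (rule f(2))
    thus "\<exists>F f. finite F \<and> F \<subseteq> carrier complex_add_group \<and> f \<in> Pi F comp \<and> x = (\<Oplus>\<^bsub>K\<^esub>a\<in>F. f a)"
      using finite_R fC by (intro exI[of _ R] exI[of _ f]) auto
  next
    fix F f a
    assume F: "finite F" "f \<in> Pi F comp" "(\<Oplus>\<^bsub>K\<^esub>a\<in>F. f a) = \<zero>\<^bsub>K\<^esub>" "a \<in> F"
    have fH: "f \<in> F \<rightarrow> H" using F(2) comp_H by blast
    have out: "f b = \<zero>" if "b \<in> F" "b \<notin> R" for b
      using Pi_mem[OF F(2) that(1)] that(2) by (simp add: comp_def)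
    have "(\<Oplus>b\<in>F \<inter> R. f b) = (\<Oplus>b\<in>F. f b)"
      by (rule add.finprod_mono_neutral_cong_left) (use F(1) out fH H_closed in auto)
    also have "\<dots> = \<zero>" using F(3) K_finsum[OF fH] by simp
    finally have sum: "(\<Oplus>b\<in>F \<inter> R. f b) = \<zero>" .
    show "f a = \<zero>\<^bsub>K\<^esub>"
    proof (cases "a \<in> R")
      case True
      have "f \<in> Pi (F \<inter> R) eig"
      proof (rule Pi_I)
        fix b assume "b \<in> F \<inter> R"
        thus "f b \<in> eig b" using Pi_mem[OF F(2), of b] by (simp add: comp_def)
      qed
      thus ?thesis using eig_independent[OF _ _ sum, of a] F(4) True by simp
    qed (use out F(4) in simp)
  next
    fix a b x y assume "x \<in> comp a" "y \<in> comp b"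
    thus "x \<otimes>\<^bsub>K\<^esub> y \<in> comp (a \<oplus>\<^bsub>complex_add_group\<^esub> b)" using comp_bracket by simp
  qed
  moreover have "grading_support K complex_add_group comp \<subseteq> R"
    by (auto simp: grading_support_def comp_def)
  ultimately show ?thesis
    unfolding higman_graded_def
    using lie_ring_K abelian_group_complex arithmetically_free_complex[OF finite_R zero_notin_R] finite_R assms
    by blast
qed

section \<open>Comparison of \<open>M\<close> with the sum of its eigenspaces\<close>

text \<open>The comaximality identity, applied to \<open>v\<close>, writes \<open>scal c v\<close>
  as a sum over \<open>R\<close>. The summand at \<open>i\<close> contains all linear powers except
  \<open>lin i ^ e\<close>, so this power completes the annihilating polynomial.\<close>

lemma regular_multiple_in_H: "\<exists>c\<in>regular. \<forall>v\<in>carrier M. scal c v \<in> H"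
proof -
  obtain c p where c: "c \<in> regular" and p: "\<And>i. i \<in> R \<Longrightarrow> p i \<in> polys_over S"
    "(\<Sum>i\<in>R. p i * (\<Prod>j\<in>R - {i}. lin j ^ e)) = [:c:]"
    using linear_powers_comaximal[OF finite_R R_nonempty R_in diff_regular] by blast
  have "scal c v \<in> H" if v: "v \<in> carrier M" for v
  proof -
    have poly: "p i * (\<Prod>j\<in>R - {i}. lin j ^ e) \<in> polys_over S" if "i \<in> R" for i
      using that p(1) R_in by (intro polys_mult polys_prod lin_polys) auto
    have eig: "act (p i * (\<Prod>j\<in>R - {i}. lin j ^ e)) v \<in> eig i" if i: "i \<in> R" for i
    proof -
      have eq: "lin i ^ e * (p i * (\<Prod>j\<in>R - {i}. lin j ^ e)) = p i * (\<Prod>j\<in>R. lin j ^ e)"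
        using prod.remove[OF finite_R i, of "\<lambda>j. lin j ^ e"] by (simp only: mult_ac)
      have "i \<in> S" using i R_in by blast
      hence "act (lin i ^ e) (act (p i * (\<Prod>j\<in>R - {i}. lin j ^ e)) v) = act (p i * (\<Prod>j\<in>R. lin j ^ e)) v"
        unfolding eq[symmetric] using poly[OF i] v by (intro act_mult[symmetric] lin_polys)
      also have "\<dots> = act (p i) (act (\<Prod>j\<in>R. lin j ^ e) v)"
        using v R_in p(1)[OF i] by (intro act_mult polys_prod lin_polys) auto
      also have "\<dots> = \<zero>" using annihilated[OF v] p(1)[OF i] by simp
      finally show ?thesis using act_closed[OF poly[OF i] v] by (auto simp: eig_def)
    qed
    have "scal c v = act (\<Sum>i\<in>R. p i * (\<Prod>j\<in>R - {i}. lin j ^ e)) v"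
      unfolding p(2) using v regular_in[OF c] by simp
    also have "\<dots> = (\<Oplus>i\<in>R. act (p i * (\<Prod>j\<in>R - {i}. lin j ^ e)) v)"
      using finite_R poly v by (rule act_sum)
    also have "\<dots> \<in> H"
    proof -
      have "(\<Oplus>i\<in>I. g i) \<in> H" if "finite I" "I \<subseteq> R" "g \<in> Pi I eig" for I g
        using that
      proof (induction I)
        case empty
        thus ?case using H_zero by simp
      next
        case (insert i I)
        have "g i \<in> H" using insert.prems unfolding H_def by (intro add_span.base) auto
        moreover have "g \<in> I \<rightarrow> carrier M" "g i \<in> carrier M" using insert.prems eig_closed by blast+
        ultimately show ?case using insert unfolding H_def
          by (simp add: finsum_insert add_span_add eig_union_closed)
      qed
      from this[OF finite_R order_refl, OF Pi_I, OF eig] show ?thesis .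
    qed
    finally show ?thesis .
  qed
  thus ?thesis using c by blast
qed

text \<open>The \<open>i\<close>-th term of the lower central series is spanned by brackets with
  \<open>i + 1\<close> entries, and moving an entry into \<open>H\<close> costs one factor
  \<open>k\<close>. In the end \<open>k ^ Suc c\<close> is cancelled.\<close>

lemma lower_central_from_K:
  assumes "lower_central K c = {\<zero>}"
  shows "lower_central M c = {\<zero>}"
proof -
  interpret K: lie_ring K by (rule lie_ring_K)
  obtain k where k: "k \<in> regular" "\<And>v. v \<in> carrier M \<Longrightarrow> scal k v \<in> H"
    using regular_multiple_in_H by blast
  have kS: "k ^ i \<in> S" for i using k(1) regular_in regular_power by blast
  have lcM: "lower_central M i \<subseteq> carrier M" for i by (rule lower_central_closed)
  have lcK: "lower_central K i \<subseteq> H" for i using K.lower_central_closed by simp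
  have main: "scal (k ^ Suc i) x \<in> lower_central K i" if "x \<in> lower_central M i" for i x
    using that
  proof (induction i arbitrary: x)
    case 0
    thus ?case using k(2) by simp
  next
    case (Suc i)
    let ?B = "{x \<otimes> y | x y. x \<in> lower_central M i \<and> y \<in> carrier M}"
    let ?B' = "{x \<otimes>\<^bsub>K\<^esub> y | x y. x \<in> lower_central K i \<and> y \<in> carrier K}"
    have Bc: "?B \<subseteq> carrier M" using lcM by (rule brackets_closed)
    note eq = K.lower_central_Suc_eq_add_span[of i]
    have "x \<in> add_span M ?B" using Suc.prems by (simp only: lower_central_Suc_eq_add_span)
    thus "scal (k ^ Suc (Suc i)) x \<in> lower_central K (Suc i)"
    proof induction
      case zero
      show ?case unfolding eq scal_zero_vec[OF kS] using add_span.zero[of K ?B'] by simp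
    next
      case (base b)
      then obtain x y where b: "b = x \<otimes> y" "x \<in> lower_central M i" "y \<in> carrier M" by blast
      have x: "x \<in> carrier M" using b(2) lcM by blast
      have "scal (k ^ Suc (Suc i)) b = scal k (scal (k ^ Suc i) b)"
        unfolding power_Suc[of k "Suc i"] using kS[of 1] kS[of "Suc i"] x b bracket_closed
        by (intro scal_mult) simp_all
      also have "\<dots> = scal (k ^ Suc i) x \<otimes> scal k y"
        unfolding b(1) scal_bracket[OF kS x b(3)]
        using kS[of 1] by (intro scal_bracket_right scal_closed[OF kS x] b(3)) simp
      also have "\<dots> \<in> add_span K ?B'"
        using Suc.IH[OF b(2)] k(2)[OF b(3)] by (intro add_span.base) auto
      finally show ?case unfolding eq .
    next
      case (diff x y)
      have xy: "x \<in> carrier M" "y \<in> carrier M" using add_span_closed[OF _ Bc] diff by blast+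
      have "scal (k ^ Suc (Suc i)) (x \<ominus> y) = scal (k ^ Suc (Suc i)) x \<ominus> scal (k ^ Suc (Suc i)) y"
        using xy kS by (intro scal_diff)
      also have "\<dots> = scal (k ^ Suc (Suc i)) x \<ominus>\<^bsub>K\<^esub> scal (k ^ Suc (Suc i)) y"
        using diff.IH lcK[of "Suc i"] by (intro K_diff[symmetric]) blast+
      also have "\<dots> \<in> lower_central K (Suc i)" using diff.IH unfolding eq by (rule add_span.diff)
      finally show ?case .
    qed
  qed
  have "x = \<zero>" if x: "x \<in> lower_central M c" for x
  proof -
    have "scal (k ^ Suc c) x = \<zero>" using main[OF x] assms by auto
    thus ?thesis using regular_power[OF k(1), of "Suc c"] x lcM by (auto simp: regular_def)
  qed
  thus ?thesis using zero_in_lower_central by blast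
qed

theorem nilpotent_of_bounded_class:
  shows "\<exists>c. lower_central M c = {\<zero>}"
    and "\<lbrakk>higman_bound n c; card R \<le> n\<rbrakk> \<Longrightarrow> lower_central M c = {\<zero>}"
proof -
  interpret graded: finitely_graded_lie_ring K R comp by (rule graded_K)
  have "\<exists>c. lower_central K c = {\<zero>}"
    using graded.nilpotent by (simp add: lie_nilpotent_def)
  thus "\<exists>c. lower_central M c = {\<zero>}" using lower_central_from_K by blast
  assume "higman_bound n c" "card R \<le> n"
  hence "lie_nilpotent K \<and> nilpotency_class K \<le> c"
    using higman_bound_all_types higman_graded_K by blast
  hence "lower_central K c = {\<zero>}"
    using lower_central_nilpotency_class[OF lie_ring_K] by simp
  thus "lower_central M c = {\<zero>}" by (rule lower_central_from_K)
qed

end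


section \<open>Extension of scalars\<close>

context abelian_group
begin

lemma additive_map_int_pow:
  assumes f: "\<And>x. x \<in> carrier G \<Longrightarrow> f x \<in> carrier G"
    and add: "\<And>x y. \<lbrakk>x \<in> carrier G; y \<in> carrier G\<rbrakk> \<Longrightarrow> f (x \<oplus> y) = f x \<oplus> f y"
    and x: "x \<in> carrier G"
  shows "f ([(k :: int)] \<cdot> x) = [k] \<cdot> f x"
proof -
  note map = additive_map[where f = f, OF f add]
  have nat: "f ([n] \<cdot> x) = [n] \<cdot> f x" for n :: nat
    by (induction n) (use map(1) x f add in \<open>simp_all add: add.nat_pow_Suc\<close>)
  show ?thesis
  proof (cases "k \<ge> 0")
    case True
    thus ?thesis by (simp add: add_pow_int_ge nat)
  next
    case False
    have "f (\<ominus> ([nat (- k)] \<cdot> x)) = \<ominus> f ([nat (- k)] \<cdot> x)" using x by (intro map(2)) auto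
    thus ?thesis using False by (simp add: add_pow_int_lt nat)
  qed
qed

lemma int_pow_eq_zero_dvd:
  assumes "x \<in> carrier G" "[(k :: int)] \<cdot> x = \<zero>" "k dvd m"
  shows "[m] \<cdot> x = \<zero>"
proof -
  obtain l where l: "m = k * l" using assms(3) by (rule dvdE)
  show ?thesis using add.int_pow_pow[of x l k] assms(1,2) by (simp add: l)
qed

end

lemma (in lie_ring) bracket_int_pow:
  assumes "x \<in> carrier L" "y \<in> carrier L"
  shows "([(k :: int)] \<cdot> x) \<otimes> y = [k] \<cdot> (x \<otimes> y)" "x \<otimes> ([k] \<cdot> y) = [k] \<cdot> (x \<otimes> y)"
proof -
  show "([k] \<cdot> x) \<otimes> y = [k] \<cdot> (x \<otimes> y)"
    using assms bracket_closed bracket_add_left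
    by (intro additive_map_int_pow[where f = "\<lambda>x. x \<otimes> y"]) auto
  show "x \<otimes> ([k] \<cdot> y) = [k] \<cdot> (x \<otimes> y)"
    using assms bracket_closed bracket_add_right
    by (intro additive_map_int_pow[where f = "\<lambda>y. x \<otimes> y"]) auto
qed

text \<open>An order with a chosen basis. By \<open>S_integral\<close>, the rational elements of
  \<open>S\<close> are integers.\<close>

locale based_order = complex_subring S for S +
  fixes N :: nat and b :: "nat \<Rightarrow> complex"
  assumes S_range: "S = range (\<lambda>c :: nat \<Rightarrow> int. \<Sum>i<N. of_int (c i) * b i)"
    and independent: "\<And>(c :: nat \<Rightarrow> int) i. \<lbrakk>(\<Sum>i<N. of_int (c i) * b i) = 0; i < N\<rbrakk> \<Longrightarrow> c i = 0"
    and S_integral: "S \<subseteq> alg_ints"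
begin

definition co :: "complex \<Rightarrow> nat \<Rightarrow> int" where
  "co \<alpha> = (SOME c. \<alpha> = (\<Sum>i<N. of_int (c i) * b i))"

lemma co_sum: "\<alpha> \<in> S \<Longrightarrow> (\<Sum>i<N. of_int (co \<alpha> i) * b i) = \<alpha>"
proof -
  assume "\<alpha> \<in> S"
  hence "\<exists>c :: nat \<Rightarrow> int. \<alpha> = (\<Sum>i<N. of_int (c i) * b i)" using S_range by blast
  from someI_ex[OF this] show ?thesis by (simp add: co_def)
qed

lemma co_eqI:
  assumes "(\<Sum>i<N. of_int (c i) * b i) = \<alpha>" "i < N"
  shows "co \<alpha> i = c i"
proof -
  have "\<alpha> \<in> S" unfolding S_range using assms(1) by blast
  hence "(\<Sum>i<N. of_int (co \<alpha> i - c i) * b i) = 0"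
    using co_sum assms(1) by (simp add: left_diff_distrib sum_subtractf)
  from independent[OF this assms(2)] show ?thesis by simp
qed

lemma co_add: "\<lbrakk>\<alpha> \<in> S; \<beta> \<in> S; i < N\<rbrakk> \<Longrightarrow> co (\<alpha> + \<beta>) i = co \<alpha> i + co \<beta> i"
  by (rule co_eqI) (simp_all add: distrib_right sum.distrib co_sum)

lemma co_scale: "\<lbrakk>\<alpha> \<in> S; i < N\<rbrakk> \<Longrightarrow> co (of_int k * \<alpha>) i = k * co \<alpha> i"
proof (rule co_eqI)
  assume "\<alpha> \<in> S"
  have "(\<Sum>i<N. of_int (k * co \<alpha> i) * b i) = of_int k * (\<Sum>i<N. of_int (co \<alpha> i) * b i)"
    by (simp add: sum_distrib_left mult_ac)
  thus "(\<Sum>i<N. of_int (k * co \<alpha> i) * b i) = of_int k * \<alpha>" using \<open>\<alpha> \<in> S\<close> by (simp only: co_sum)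
qed

lemma basis_sum:
  assumes "j < N"
  shows "(\<Sum>i<N. of_int (if i = j then 1 else 0) * b i) = b j"
proof -
  have "(\<Sum>i<N. of_int (if i = j then 1 else 0) * b i) = (\<Sum>i<N. if i = j then b i else 0)"
    by (intro sum.cong) auto
  thus ?thesis using assms by simp
qed

lemma basis_in: "j < N \<Longrightarrow> b j \<in> S"
  unfolding S_range using basis_sum[of j] by (intro image_eqI[of _ _ "\<lambda>i. if i = j then 1 else 0"]) auto

lemma co_basis: "\<lbrakk>j < N; i < N\<rbrakk> \<Longrightarrow> co (b j) i = (if i = j then 1 else 0)"
  by (rule co_eqI[OF basis_sum])

end

locale scalar_extension = lie_ring L + based_order S N b for L (structure) and S N b
begin

definition A :: "(nat \<Rightarrow> 'a) ring" where
  "A = \<lparr>carrier = {f. \<forall>i. f i \<in> carrier L \<and> (N \<le> i \<longrightarrow> f i = \<zero>)},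
     mult = (\<lambda>_ _ _. \<zero>), one = (\<lambda>_. \<zero>), zero = (\<lambda>_. \<zero>), add = (\<lambda>f g i. f i \<oplus> g i)\<rparr>"

lemma carrier_A: "f \<in> carrier A \<longleftrightarrow> (\<forall>i. f i \<in> carrier L \<and> (N \<le> i \<longrightarrow> f i = \<zero>))"
  by (simp add: A_def)

lemma A_at: "f \<in> carrier A \<Longrightarrow> f i \<in> carrier L"
  by (simp add: carrier_A)

lemma A_outside: "\<lbrakk>f \<in> carrier A; N \<le> i\<rbrakk> \<Longrightarrow> f i = \<zero>"
  by (simp add: carrier_A)


lemma add_A: "f \<oplus>\<^bsub>A\<^esub> g = (\<lambda>i. f i \<oplus> g i)"
  by (simp add: A_def)

lemma zero_A: "\<zero>\<^bsub>A\<^esub> = (\<lambda>_. \<zero>)"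
  by (simp add: A_def)

lemma abelian_group_A: "abelian_group A"
proof (rule abelian_groupI)
  fix f assume f: "f \<in> carrier A"
  show "\<exists>g\<in>carrier A. g \<oplus>\<^bsub>A\<^esub> f = \<zero>\<^bsub>A\<^esub>"
    using f by (intro bexI[of _ "\<lambda>i. \<ominus> f i"]) (auto simp: carrier_A add_A zero_A l_neg)
qed (auto simp: carrier_A add_A zero_A a_ac fun_eq_iff)

sublocale A: abelian_group A
  by (rule abelian_group_A)

declare A_at [simp]

lemma finsum_A_at:
  "\<lbrakk>finite I; f \<in> I \<rightarrow> carrier A\<rbrakk> \<Longrightarrow> (\<Oplus>\<^bsub>A\<^esub>i\<in>I. f i) j = (\<Oplus>i\<in>I. f i j)"
  by (induction I rule: finite_induct)
    (simp_all add: zero_A add_A A.finsum_insert finsum_insert Pi_iff)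

text \<open>The pure tensor of \<open>\<alpha>\<close> and \<open>x\<close>.\<close>

definition T :: "complex \<Rightarrow> 'a \<Rightarrow> nat \<Rightarrow> 'a" where
  "T \<alpha> x = (\<lambda>i. if i < N then [co \<alpha> i] \<cdot> x else \<zero>)"

lemma T_closed [simp]: "x \<in> carrier L \<Longrightarrow> T \<alpha> x \<in> carrier A"
  by (simp add: T_def carrier_A)

lemma T_add_vec: "\<lbrakk>x \<in> carrier L; y \<in> carrier L\<rbrakk> \<Longrightarrow> T \<alpha> (x \<oplus> y) = T \<alpha> x \<oplus>\<^bsub>A\<^esub> T \<alpha> y"
  by (auto simp: T_def add_A add.int_pow_distrib)

lemma T_add: "\<lbrakk>\<alpha> \<in> S; \<beta> \<in> S; x \<in> carrier L\<rbrakk> \<Longrightarrow> T (\<alpha> + \<beta>) x = T \<alpha> x \<oplus>\<^bsub>A\<^esub> T \<beta> x"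
  by (auto simp: T_def add_A co_add add.int_pow_mult)

lemma T_zero_vec [simp]: "T \<alpha> \<zero> = \<zero>\<^bsub>A\<^esub>"
  by (auto simp: T_def zero_A)

lemma T_scale: "\<lbrakk>\<alpha> \<in> S; x \<in> carrier L\<rbrakk> \<Longrightarrow> T \<alpha> ([k] \<cdot> x) = T (of_int k * \<alpha>) x"
  by (auto simp: T_def co_scale add.int_pow_pow)

text \<open>A tensor \<open>f\<close> is the sum of the pure tensors \<open>T (b m) (f m)\<close>,
  so additive identities need to be checked on pure tensors only.\<close>

lemma tensor_induct [consumes 1, case_names zero tensor add]:
  assumes f: "f \<in> carrier A" and 0: "P \<zero>\<^bsub>A\<^esub>"
    and T: "\<And>\<alpha> x. \<lbrakk>\<alpha> \<in> S; x \<in> carrier L\<rbrakk> \<Longrightarrow> P (T \<alpha> x)"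
    and add: "\<And>f g. \<lbrakk>f \<in> carrier A; g \<in> carrier A; P f; P g\<rbrakk> \<Longrightarrow> P (f \<oplus>\<^bsub>A\<^esub> g)"
  shows "P f"
proof -
  have "P (\<lambda>i. if i < m then f i else \<zero>)" if "m \<le> N" for m
    using that
  proof (induction m)
    case 0
    show ?case using \<open>P \<zero>\<^bsub>A\<^esub>\<close> by (simp add: zero_A)
  next
    case (Suc m)
    have z: "[(0 :: int)] \<cdot> y = \<zero>" for y by (simp add: add_pow_def)
    have "(\<lambda>i. if i < Suc m then f i else \<zero>) = (\<lambda>i. if i < m then f i else \<zero>) \<oplus>\<^bsub>A\<^esub> T (b m) (f m)"
      using f Suc.prems by (auto simp: add_A T_def co_basis fun_eq_iff less_Suc_eq z)
    moreover have "(\<lambda>i. if i < m then f i else \<zero>) \<in> carrier A" using f Suc.prems by (auto simp: carrier_A)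
    ultimately show ?case using Suc f T[OF basis_in, of m "f m"] by (auto intro: add)
  qed
  from this[of N] have "P (\<lambda>i. if i < N then f i else \<zero>)" by simp
  moreover have "(\<lambda>i. if i < N then f i else \<zero>) = f" using A_outside[OF f] by (auto simp: not_less)
  ultimately show ?thesis by simp
qed

text \<open>The universal property in coordinates: \<open>\<psi>\<close> is additive in the scalar
  and lets integers pass from the vector to the scalar, so it is recovered from its values at the
  basis. Thus \<open>scal\<close> and \<open>br\<close>, defined through the basis, have the
  expected values on pure tensors.\<close>

lemma biadditive_expand:
  assumes closed: "\<And>\<beta> x. \<lbrakk>\<beta> \<in> S; x \<in> carrier L\<rbrakk> \<Longrightarrow> \<psi> \<beta> x \<in> carrier A"
    and add: "\<And>\<beta> \<gamma> x. \<lbrakk>\<beta> \<in> S; \<gamma> \<in> S; x \<in> carrier L\<rbrakk> \<Longrightarrow> \<psi> (\<beta> + \<gamma>) x = \<psi> \<beta> x \<oplus>\<^bsub>A\<^esub> \<psi> \<gamma> x"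
    and scale: "\<And>\<beta> x k. \<lbrakk>\<beta> \<in> S; x \<in> carrier L\<rbrakk> \<Longrightarrow> \<psi> \<beta> ([k] \<cdot> x) = \<psi> (of_int k * \<beta>) x"
    and \<alpha>: "\<alpha> \<in> S" and x: "x \<in> carrier L"
  shows "(\<Oplus>\<^bsub>A\<^esub>i\<in>{..<N}. \<psi> (b i) (T \<alpha> x i)) = \<psi> \<alpha> x"
proof -
  have 0: "\<psi> 0 x = \<zero>\<^bsub>A\<^esub>"
    using add[of 0 0 x] closed[of 0 x] x by (simp add: A.add.l_cancel_one)
  have in_S: "of_int (co \<alpha> i) * b i \<in> S" if "i < N" for i using basis_in[OF that] by auto
  have "(\<Oplus>\<^bsub>A\<^esub>i\<in>{..<N}. \<psi> (b i) (T \<alpha> x i)) = (\<Oplus>\<^bsub>A\<^esub>i\<in>{..<N}. \<psi> (of_int (co \<alpha> i) * b i) x)"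
    by (rule A.finsum_cong') (use in_S closed x basis_in scale in \<open>auto simp: T_def\<close>)
  also have "(\<Oplus>\<^bsub>A\<^esub>i\<in>{..<m}. \<psi> (of_int (co \<alpha> i) * b i) x) = \<psi> (\<Sum>i<m. of_int (co \<alpha> i) * b i) x"
    if "m \<le> N" for m
    using that
  proof (induction m)
    case (Suc m)
    have "(\<Sum>i<m. of_int (co \<alpha> i) * b i) \<in> S" using Suc.prems in_S by (intro sum_in) auto
    thus ?case using Suc in_S closed x
      by (simp add: lessThan_Suc A.finsum_insert add A.a_comm Pi_iff)
  qed (simp add: 0)
  from this[of N] have "(\<Oplus>\<^bsub>A\<^esub>i\<in>{..<N}. \<psi> (of_int (co \<alpha> i) * b i) x) = \<psi> \<alpha> x"
    using co_sum[OF \<alpha>] by simp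
  finally show ?thesis .
qed

section \<open>Scalar multiplication and bracket on the tensor product\<close>

definition scal :: "complex \<Rightarrow> (nat \<Rightarrow> 'a) \<Rightarrow> nat \<Rightarrow> 'a" where
  "scal \<alpha> f = (\<Oplus>\<^bsub>A\<^esub>i\<in>{..<N}. T (\<alpha> * b i) (f i))"

definition br :: "(nat \<Rightarrow> 'a) \<Rightarrow> (nat \<Rightarrow> 'a) \<Rightarrow> nat \<Rightarrow> 'a" where
  "br f g = (\<Oplus>\<^bsub>A\<^esub>i\<in>{..<N}. \<Oplus>\<^bsub>A\<^esub>j\<in>{..<N}. T (b i * b j) (f i \<otimes> g j))"

lemma scal_A_closed [simp]: "f \<in> carrier A \<Longrightarrow> scal \<alpha> f \<in> carrier A"
  unfolding scal_def by (intro A.finsum_closed) auto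

lemma br_closed [simp]: "\<lbrakk>f \<in> carrier A; g \<in> carrier A\<rbrakk> \<Longrightarrow> br f g \<in> carrier A"
  unfolding br_def by (intro A.finsum_closed Pi_I T_closed bracket_closed A_at)

lemma scal_A_add:
  assumes "f \<in> carrier A" "g \<in> carrier A"
  shows "scal \<alpha> (f \<oplus>\<^bsub>A\<^esub> g) = scal \<alpha> f \<oplus>\<^bsub>A\<^esub> scal \<alpha> g"
  unfolding scal_def using assms
  by (subst A.finsum_addf[symmetric]) (auto intro!: A.finsum_cong' simp: add_A[of f g] T_add_vec)

lemma br_add_left:
  assumes "f \<in> carrier A" "g \<in> carrier A" "h \<in> carrier A"
  shows "br (f \<oplus>\<^bsub>A\<^esub> g) h = br f h \<oplus>\<^bsub>A\<^esub> br g h"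
proof -
  have cl: "T (b i * b j) (f i \<otimes> h j) \<in> carrier A" if "f \<in> carrier A" for f i j
    using that assms(3) by (intro T_closed bracket_closed A_at)
  have inner: "(\<Oplus>\<^bsub>A\<^esub>j\<in>{..<N}. T (b i * b j) ((f \<oplus>\<^bsub>A\<^esub> g) i \<otimes> h j)) =
      (\<Oplus>\<^bsub>A\<^esub>j\<in>{..<N}. T (b i * b j) (f i \<otimes> h j)) \<oplus>\<^bsub>A\<^esub> (\<Oplus>\<^bsub>A\<^esub>j\<in>{..<N}. T (b i * b j) (g i \<otimes> h j))" for i
    using cl assms bracket_closed
    by (subst A.finsum_addf[symmetric])
      (auto intro!: A.finsum_cong' simp: add_A[of f g] T_add_vec bracket_add_left)
  show ?thesis
    unfolding br_def inner using cl assms by (intro A.finsum_addf Pi_I A.finsum_closed)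
qed

lemma br_add_right:
  assumes "f \<in> carrier A" "g \<in> carrier A" "h \<in> carrier A"
  shows "br h (f \<oplus>\<^bsub>A\<^esub> g) = br h f \<oplus>\<^bsub>A\<^esub> br h g"
proof -
  have cl: "T (b i * b j) (h i \<otimes> f j) \<in> carrier A" if "f \<in> carrier A" for f i j
    using that assms(3) by (intro T_closed bracket_closed A_at)
  have inner: "(\<Oplus>\<^bsub>A\<^esub>j\<in>{..<N}. T (b i * b j) (h i \<otimes> (f \<oplus>\<^bsub>A\<^esub> g) j)) =
      (\<Oplus>\<^bsub>A\<^esub>j\<in>{..<N}. T (b i * b j) (h i \<otimes> f j)) \<oplus>\<^bsub>A\<^esub> (\<Oplus>\<^bsub>A\<^esub>j\<in>{..<N}. T (b i * b j) (h i \<otimes> g j))" for i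
    using cl assms bracket_closed
    by (subst A.finsum_addf[symmetric])
      (auto intro!: A.finsum_cong' simp: add_A[of f g] T_add_vec bracket_add_right)
  show ?thesis
    unfolding br_def inner using cl assms by (intro A.finsum_addf Pi_I A.finsum_closed)
qed

lemma scal_T: "\<lbrakk>\<alpha> \<in> S; \<beta> \<in> S; x \<in> carrier L\<rbrakk> \<Longrightarrow> scal \<alpha> (T \<beta> x) = T (\<alpha> * \<beta>) x"
  unfolding scal_def
  by (rule biadditive_expand[where \<psi> = "\<lambda>\<beta>. T (\<alpha> * \<beta>)"])
    (auto simp: distrib_left T_add mult_in T_scale mult.left_commute)

lemma br_T:
  assumes "\<alpha> \<in> S" "\<beta> \<in> S" "x \<in> carrier L" "y \<in> carrier L"
  shows "br (T \<alpha> x) (T \<beta> y) = T (\<alpha> * \<beta>) (x \<otimes> y)"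
proof -
  have inner: "(\<Oplus>\<^bsub>A\<^esub>j\<in>{..<N}. T (\<gamma> * b j) (z \<otimes> T \<beta> y j)) = T (\<gamma> * \<beta>) (z \<otimes> y)"
    if "\<gamma> \<in> S" "z \<in> carrier L" for \<gamma> z
    by (rule biadditive_expand[where \<psi> = "\<lambda>\<beta> y. T (\<gamma> * \<beta>) (z \<otimes> y)"])
      (use assms that bracket_closed in
        \<open>auto simp: distrib_left T_add mult_in T_scale mult.left_commute bracket_int_pow\<close>)
  have "br (T \<alpha> x) (T \<beta> y) = (\<Oplus>\<^bsub>A\<^esub>i\<in>{..<N}. T (b i * \<beta>) (T \<alpha> x i \<otimes> y))"
    unfolding br_def
    by (rule A.finsum_cong') (use assms inner basis_in bracket_closed in auto)
  also have "\<dots> = T (\<alpha> * \<beta>) (x \<otimes> y)"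
    by (rule biadditive_expand[where \<psi> = "\<lambda>\<alpha> x. T (\<alpha> * \<beta>) (x \<otimes> y)"])
      (use assms bracket_closed in
        \<open>auto simp: distrib_right T_add mult_in T_scale mult.assoc bracket_int_pow\<close>)
  finally show ?thesis .
qed

definition M :: "(nat \<Rightarrow> 'a) ring" where
  "M = A\<lparr>mult := br\<rparr>"

lemma M_simps [simp]: "carrier M = carrier A" "zero M = zero A" "add M = add A" "mult M = br"
  by (simp_all add: M_def)

lemma finsum_M: "finsum M = finsum A"
  by (simp add: finsum_def fun_eq_iff M_def)

lemma abelian_group_M: "abelian_group M"
proof (rule abelian_groupI)
  fix f assume "f \<in> carrier M"
  thus "\<exists>g\<in>carrier M. g \<oplus>\<^bsub>M\<^esub> f = \<zero>\<^bsub>M\<^esub>"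
    by (intro bexI[of _ "\<ominus>\<^bsub>A\<^esub> f"]) (auto simp: A.l_neg)
qed (auto simp: A.a_ac)

lemma br_zero [simp]:
  assumes "f \<in> carrier A"
  shows "br \<zero>\<^bsub>A\<^esub> f = \<zero>\<^bsub>A\<^esub>" "br f \<zero>\<^bsub>A\<^esub> = \<zero>\<^bsub>A\<^esub>"
  using br_add_left[of "\<zero>\<^bsub>A\<^esub>" "\<zero>\<^bsub>A\<^esub>" f] br_add_right[of "\<zero>\<^bsub>A\<^esub>" "\<zero>\<^bsub>A\<^esub>" f] assms
  by (simp_all add: A.add.l_cancel_one)

lemma scal_A_zero [simp]: "scal \<alpha> \<zero>\<^bsub>A\<^esub> = \<zero>\<^bsub>A\<^esub>"
  using scal_A_add[of "\<zero>\<^bsub>A\<^esub>" "\<zero>\<^bsub>A\<^esub>" \<alpha>] by (simp add: A.add.l_cancel_one)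

lemma br_antisym:
  assumes "f \<in> carrier A" "g \<in> carrier A"
  shows "br f g \<oplus>\<^bsub>A\<^esub> br g f = \<zero>\<^bsub>A\<^esub>"
  using assms
proof (induction f rule: tensor_induct)
  case zero
  thus ?case by simp
next
  case (tensor \<alpha> x)
  note ax = tensor(1,2)
  from tensor(3) show ?case
  proof (induction g rule: tensor_induct)
    case (tensor \<beta> y)
    have "y \<otimes> x \<oplus> x \<otimes> y = \<zero>"
      using ax tensor by (simp add: bracket_swap[of x y] l_neg bracket_closed)
    thus ?case using ax tensor
      by (simp add: br_T mult.commute[of \<beta> \<alpha>] T_add_vec[symmetric] bracket_closed a_comm)
  next
    case (add f g)
    have "br (T \<alpha> x) (f \<oplus>\<^bsub>A\<^esub> g) \<oplus>\<^bsub>A\<^esub> br (f \<oplus>\<^bsub>A\<^esub> g) (T \<alpha> x) =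
        (br (T \<alpha> x) f \<oplus>\<^bsub>A\<^esub> br f (T \<alpha> x)) \<oplus>\<^bsub>A\<^esub> (br (T \<alpha> x) g \<oplus>\<^bsub>A\<^esub> br g (T \<alpha> x))"
      using ax add by (simp add: br_add_left br_add_right A.a_ac)
    thus ?case using add by simp
  qed (use ax in simp)
next
  case (add f h)
  have "br (f \<oplus>\<^bsub>A\<^esub> h) g \<oplus>\<^bsub>A\<^esub> br g (f \<oplus>\<^bsub>A\<^esub> h) =
      (br f g \<oplus>\<^bsub>A\<^esub> br g f) \<oplus>\<^bsub>A\<^esub> (br h g \<oplus>\<^bsub>A\<^esub> br g h)"
    using add by (simp add: br_add_left br_add_right A.a_ac)
  thus ?case using add by simp
qed

text \<open>The expression is not additive in \<open>f\<close>, but the cross terms cancel by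
  \<open>br_antisym\<close>. Antisymmetry alone would not do, as \<open>L\<close> may have
  2-torsion.\<close>

lemma br_self: "f \<in> carrier A \<Longrightarrow> br f f = \<zero>\<^bsub>A\<^esub>"
proof (induction f rule: tensor_induct)
  case (tensor \<alpha> x)
  thus ?case by (simp add: br_T bracket_self)
next
  case (add f g)
  have "br (f \<oplus>\<^bsub>A\<^esub> g) (f \<oplus>\<^bsub>A\<^esub> g) = (br f f \<oplus>\<^bsub>A\<^esub> br g g) \<oplus>\<^bsub>A\<^esub> (br f g \<oplus>\<^bsub>A\<^esub> br g f)"
    using add by (simp add: br_add_left br_add_right A.a_ac)
  thus ?case using add br_antisym by simp
qed simp

text \<open>The Jacobi sum. It is additive in its first argument and invariant under rotation, so
  the identity reduces to pure tensors one argument at a time.\<close>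

definition jac :: "(nat \<Rightarrow> 'a) \<Rightarrow> (nat \<Rightarrow> 'a) \<Rightarrow> (nat \<Rightarrow> 'a) \<Rightarrow> nat \<Rightarrow> 'a" where
  "jac f g h = br f (br g h) \<oplus>\<^bsub>A\<^esub> (br g (br h f) \<oplus>\<^bsub>A\<^esub> br h (br f g))"

lemma jac_add:
  assumes "f \<in> carrier A" "f' \<in> carrier A" "g \<in> carrier A" "h \<in> carrier A"
  shows "jac (f \<oplus>\<^bsub>A\<^esub> f') g h = jac f g h \<oplus>\<^bsub>A\<^esub> jac f' g h"
  using assms by (simp add: jac_def br_add_left br_add_right A.a_ac)

lemma jac_rotate:
  "\<lbrakk>f \<in> carrier A; g \<in> carrier A; h \<in> carrier A\<rbrakk> \<Longrightarrow> jac f g h = jac g h f"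
  by (simp add: jac_def A.a_ac)

lemma jac_zero_left: "\<lbrakk>g \<in> carrier A; h \<in> carrier A\<rbrakk> \<Longrightarrow> jac \<zero>\<^bsub>A\<^esub> g h = \<zero>\<^bsub>A\<^esub>"
  by (simp add: jac_def)

lemma jac_T:
  assumes "\<alpha> \<in> S" "\<beta> \<in> S" "\<gamma> \<in> S" "x \<in> carrier L" "y \<in> carrier L" "z \<in> carrier L"
  shows "jac (T \<alpha> x) (T \<beta> y) (T \<gamma> z) = \<zero>\<^bsub>A\<^esub>"
proof -
  have e: "\<beta> * (\<gamma> * \<alpha>) = \<alpha> * (\<beta> * \<gamma>)" "\<gamma> * (\<alpha> * \<beta>) = \<alpha> * (\<beta> * \<gamma>)" by simp_all
  have "jac (T \<alpha> x) (T \<beta> y) (T \<gamma> z) =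
      T (\<alpha> * (\<beta> * \<gamma>)) (x \<otimes> (y \<otimes> z) \<oplus> (y \<otimes> (z \<otimes> x) \<oplus> z \<otimes> (x \<otimes> y)))"
    using assms unfolding jac_def by (simp add: br_T mult_in bracket_closed T_add_vec e)
  thus ?thesis using jacobi[OF assms(4-6)] by simp
qed

lemma jac_eq_zero:
  assumes "f \<in> carrier A" "g \<in> carrier A" "h \<in> carrier A"
  shows "jac f g h = \<zero>\<^bsub>A\<^esub>"
proof -
  have 1: "jac (T \<alpha> x) (T \<beta> y) h = \<zero>\<^bsub>A\<^esub>"
    if "\<alpha> \<in> S" "\<beta> \<in> S" "x \<in> carrier L" "y \<in> carrier L" "h \<in> carrier A" for \<alpha> \<beta> x y h
    using that(5)
  proof (induction h rule: tensor_induct)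
    case zero
    show ?case using that jac_rotate[of "\<zero>\<^bsub>A\<^esub>" "T \<alpha> x" "T \<beta> y"] by (simp add: jac_zero_left)
  next
    case (add f g)
    thus ?case using that jac_rotate[of "f \<oplus>\<^bsub>A\<^esub> g" "T \<alpha> x" "T \<beta> y"]
      jac_rotate[of f "T \<alpha> x" "T \<beta> y"] jac_rotate[of g "T \<alpha> x" "T \<beta> y"] by (simp add: jac_add)
  qed (use that in \<open>simp add: jac_T\<close>)
  have 2: "jac (T \<alpha> x) g h = \<zero>\<^bsub>A\<^esub>"
    if "\<alpha> \<in> S" "x \<in> carrier L" "g \<in> carrier A" "h \<in> carrier A" for \<alpha> x g h
    using that(3)
  proof (induction g rule: tensor_induct)
    case zero
    show ?case using that jac_rotate[of "T \<alpha> x" "\<zero>\<^bsub>A\<^esub>" h] by (simp add: jac_zero_left)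
  next
    case (add f g)
    thus ?case using that jac_rotate[of "T \<alpha> x" "f \<oplus>\<^bsub>A\<^esub> g" h]
      jac_rotate[of "T \<alpha> x" f h] jac_rotate[of "T \<alpha> x" g h] by (simp add: jac_add)
  qed (use that 1 in simp)
  show ?thesis using assms(1)
  proof (induction f rule: tensor_induct)
    case (add f f')
    thus ?case using assms by (simp add: jac_add)
  qed (use assms 2 in \<open>simp_all add: jac_zero_left\<close>)
qed

lemma lie_ring_M: "lie_ring M"
proof (rule lie_ring.intro[OF abelian_group_M], unfold_locales)
qed (use br_add_left br_add_right br_self jac_eq_zero in \<open>simp_all add: jac_def\<close>)

lemma scal_int_at:
  assumes "f \<in> carrier A"
  shows "scal (of_int k) f = (\<lambda>i. [k] \<cdot> f i)"
  using assms
proof (induction f rule: tensor_induct)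
  case zero
  show ?case by (simp add: zero_A[symmetric]) (simp add: zero_A)
next
  case (tensor \<alpha> x)
  hence "scal (of_int k) (T \<alpha> x) = T (of_int k * \<alpha>) x" by (simp add: scal_T)
  thus ?case using tensor by (auto simp: T_def co_scale add.int_pow_pow mult.commute[of k "co \<alpha> _"])
next
  case (add f g)
  thus ?case by (simp add: scal_A_add) (auto simp: add_A add.int_pow_distrib)
qed

lemma T_one_bracket: "\<lbrakk>x \<in> carrier L; y \<in> carrier L\<rbrakk> \<Longrightarrow> br (T 1 x) (T 1 y) = T 1 (x \<otimes> y)"
  by (simp add: br_T)

text \<open>The order contains no rational numbers besides the integers, so \<open>1\<close> is not a proper
  multiple of one of its elements.\<close>

lemma T_one_inj:
  assumes x: "x \<in> carrier L" and T: "T 1 x = \<zero>\<^bsub>A\<^esub>"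
  shows "x = \<zero>"
proof -
  define J where "J k \<longleftrightarrow> [(k :: int)] \<cdot> x = \<zero>" for k
  have J: "J (co 1 i)" if "i < N" for i
    using fun_cong[OF T, of i] that by (simp add: J_def T_def zero_A)
  have Jmult: "J (k * l)" if "J k" for k l
    using that x add.int_pow_pow[of x l k] by (simp add: J_def)
  have Jdiff: "J (k - l)" if "J k" "J l" for k l
    using that x add.int_pow_diff[of x k l] by (simp add: J_def)
  have "\<exists>i<N. co 1 i \<noteq> 0"
  proof (rule ccontr)
    assume "\<not> ?thesis"
    hence "(\<Sum>i<N. of_int (co 1 i) * b i) = 0" by (intro sum.neutral) auto
    thus False using co_sum[OF one_in] by simp
  qed
  then obtain i where i: "i < N" "co 1 i \<noteq> 0" by blast
  have "J \<bar>co 1 i\<bar>"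
    using J[OF i(1)] Jmult[of "co 1 i" "-1"] by (auto simp: abs_if)
  hence ex: "\<exists>n>0. J (int n)" using i(2) by (intro exI[of _ "nat \<bar>co 1 i\<bar>"]) auto
  \<comment> \<open>\<open>J\<close> describes the annihilator of \<open>x\<close> in the integers.
    It contains all coordinates of 1, one of which is nonzero, and \<open>g\<close> is its positive
    generator.\<close>
  define g where "g = (LEAST n. n > 0 \<and> J (int n))"
  have g: "g > 0" "J (int g)" using LeastI_ex[OF ex] by (auto simp: g_def)
  have dvd: "int g dvd k" if "J k" for k
  proof -
    have "J (k mod int g)"
      using Jdiff[OF that Jmult[OF g(2), of "k div int g"]] by (simp add: minus_mult_div_eq_mod)
    moreover have "k mod int g \<ge> 0" "k mod int g < int g" using g(1) by auto
    ultimately have "k mod int g = 0"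
      using not_less_Least[of "nat (k mod int g)" "\<lambda>n. n > 0 \<and> J (int n)"]
      unfolding g_def[symmetric] by (simp add: nat_less_iff)
    thus ?thesis by presburger
  qed
  \<comment> \<open>All coordinates of 1 are multiples of \<open>g\<close>, so \<open>1 / g\<close>
    is an integer combination of the basis.\<close>
  have eq: "(\<Sum>i<N. of_int (co 1 i div int g) * b i) = 1 / of_nat g"
  proof -
    have "of_nat g * (\<Sum>i<N. of_int (co 1 i div int g) * b i) = (\<Sum>i<N. of_int (co 1 i) * b i)"
      unfolding sum_distrib_left
    proof (rule sum.cong)
      fix i assume "i \<in> {..<N}"
      hence "co 1 i = int g * (co 1 i div int g)" using dvd[OF J] by simp
      hence "(of_int (co 1 i) :: complex) = of_nat g * of_int (co 1 i div int g)"
        by (metis of_int_mult of_int_of_nat_eq)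
      thus "of_nat g * (of_int (co 1 i div int g) * b i) = of_int (co 1 i) * b i" by simp
    qed simp
    thus ?thesis using g(1) co_sum[OF one_in] by (simp add: field_simps)
  qed
  have "1 / of_nat g \<in> S" unfolding S_range eq[symmetric] by (rule image_eqI[OF refl UNIV_I])
  hence "(1 / of_nat g :: complex) \<in> \<int>" using S_integral by (intro rational_alg_int_is_int) auto
  then obtain k where "(1 / of_nat g :: complex) = of_int k" by (rule Ints_cases)
  hence "(of_int (k * int g) :: complex) = of_int 1" using g(1) by (simp add: field_simps)
  hence "k * int g = 1" by (simp only: of_int_eq_iff)
  hence "int g dvd 1" by (metis dvd_triv_right)
  hence "g = 1" by simp
  thus ?thesis using g(2) x by (simp add: J_def)
qed

lemma lower_central_T:
  assumes "x \<in> lower_central L i"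
  shows "T 1 x \<in> lower_central M i"
  using assms
proof (induction i arbitrary: x)
  case 0
  thus ?case by simp
next
  case (Suc i)
  interpret M: lie_ring M by (rule lie_ring_M)
  let ?B = "{x \<otimes> y | x y. x \<in> lower_central L i \<and> y \<in> carrier L}"
  let ?B' = "{x \<otimes>\<^bsub>M\<^esub> y | x y. x \<in> lower_central M i \<and> y \<in> carrier M}"
  have Bc: "?B \<subseteq> carrier L" using lower_central_closed by (rule brackets_closed)
  note eq = M.lower_central_Suc_eq_add_span[of i]
  have "x \<in> add_span L ?B" using Suc.prems by (simp only: lower_central_Suc_eq_add_span)
  thus "T 1 x \<in> lower_central M (Suc i)"
  proof induction
    case zero
    show ?case unfolding eq using add_span.zero[of M ?B'] by simp
  next
    case (base c)
    then obtain x y where c: "c = x \<otimes> y" "x \<in> lower_central L i" "y \<in> carrier L" by blast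
    have "T 1 c = T 1 x \<otimes>\<^bsub>M\<^esub> T 1 y" 
      using c lower_central_closed[of i] by (simp add: T_one_bracket subset_iff)
    moreover have "T 1 y \<in> carrier M" using c(3) by simp
    ultimately show ?case unfolding eq using Suc.IH[OF c(2)] by (intro add_span.base) blast
  next
    case (diff x y)
    have xy: "x \<in> carrier L" "y \<in> carrier L" using add_span_closed[OF _ Bc] diff by blast+
    have "T 1 (x \<ominus> y) \<oplus>\<^bsub>M\<^esub> T 1 y = T 1 x"
      using xy T_add_vec[of "x \<ominus> y" y 1] by (simp add: a_minus_def a_assoc l_neg)
    hence "T 1 (x \<ominus> y) = T 1 x \<ominus>\<^bsub>M\<^esub> T 1 y" using xy by (intro M.eq_minusI) auto
    thus ?case using diff.IH unfolding eq by (simp add: add_span.diff)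
  qed
qed

lemma lower_central_from_M:
  assumes "lower_central M c = {\<zero>\<^bsub>M\<^esub>}"
  shows "lower_central L c = {\<zero>}"
proof -
  have "x = \<zero>" if "x \<in> lower_central L c" for x
    using lower_central_T[OF that] assms T_one_inj[of x] lower_central_closed[of c] that by auto
  thus ?thesis using zero_in_lower_central by blast
qed

end

section \<open>Extension of the derivation\<close>

locale scalar_extension_derivation = scalar_extension +
  fixes E :: "'a \<Rightarrow> 'a"
  assumes E_derivation: "lie_derivation L E"
begin

lemma E_closed: "x \<in> carrier L \<Longrightarrow> E x \<in> carrier L"
  and E_add: "\<lbrakk>x \<in> carrier L; y \<in> carrier L\<rbrakk> \<Longrightarrow> E (x \<oplus> y) = E x \<oplus> E y"
  and E_bracket: "\<lbrakk>x \<in> carrier L; y \<in> carrier L\<rbrakk> \<Longrightarrow> E (x \<otimes> y) = (E x \<otimes> y) \<oplus> (x \<otimes> E y)"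
  using E_derivation by (auto simp: lie_derivation_def)

definition dd :: "(nat \<Rightarrow> 'a) \<Rightarrow> nat \<Rightarrow> 'a" where
  "dd f = E \<circ> f"

lemma E_zero: "E \<zero> = \<zero>"
  by (rule additive_map(1)[where f = E]) (simp_all add: E_closed E_add)

lemma E_int_pow: "x \<in> carrier L \<Longrightarrow> E ([(k :: int)] \<cdot> x) = [k] \<cdot> E x"
  by (rule additive_map_int_pow) (simp_all add: E_closed E_add)

lemma dd_A_closed: "f \<in> carrier A \<Longrightarrow> dd f \<in> carrier A"
  by (simp add: carrier_A dd_def E_closed E_zero)

lemma dd_A_add: "\<lbrakk>f \<in> carrier A; g \<in> carrier A\<rbrakk> \<Longrightarrow> dd (f \<oplus>\<^bsub>A\<^esub> g) = dd f \<oplus>\<^bsub>A\<^esub> dd g"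
  by (auto simp: dd_def add_A E_add)

lemma dd_A_zero: "dd \<zero>\<^bsub>A\<^esub> = \<zero>\<^bsub>A\<^esub>"
  by (auto simp: dd_def zero_A E_zero)

lemma dd_T: "x \<in> carrier L \<Longrightarrow> dd (T \<alpha> x) = T \<alpha> (E x)"
  by (auto simp: dd_def T_def E_int_pow E_zero)

lemma dd_br:
  assumes "f \<in> carrier A" "g \<in> carrier A"
  shows "dd (br f g) = br (dd f) g \<oplus>\<^bsub>A\<^esub> br f (dd g)"
  using assms
proof (induction f rule: tensor_induct)
  case zero
  thus ?case by (simp add: dd_A_zero dd_A_closed)
next
  case (tensor \<alpha> x)
  note ax = tensor(1,2)
  from tensor(3) show ?case
  proof (induction g rule: tensor_induct)
    case zero
    thus ?case using ax by (simp add: dd_A_zero dd_A_closed)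
  next
    case (tensor \<beta> y)
    thus ?case using ax
      by (simp add: br_T dd_T E_closed E_bracket bracket_closed T_add_vec)
  next
    case (add f g)
    thus ?case using ax
      by (simp add: br_add_right br_add_left dd_A_add dd_A_closed A.a_ac)
  qed
next
  case (add f h)
  thus ?case by (simp add: br_add_right br_add_left dd_A_add dd_A_closed A.a_ac)
qed

sublocale M: order_lie_ring M S scal dd
proof (intro order_lie_ring.intro lie_ring_M complex_subring_axioms order_lie_ring_axioms.intro)
  fix \<alpha> \<beta> v w
  assume \<alpha>: "\<alpha> \<in> S" and v: "v \<in> carrier M"
  show "scal \<alpha> v \<in> carrier M" using v by simp
  show "dd (scal \<alpha> v) = scal \<alpha> (dd v)"
    using v unfolding M_simps
  proof (induction v rule: tensor_induct)
    case (tensor \<beta> x)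
    thus ?case using \<alpha> by (simp add: scal_T dd_T E_closed)
  next
    case (add f g)
    thus ?case by (simp add: scal_A_add dd_A_add dd_A_closed)
  qed (simp add: dd_A_zero)
  {
    assume \<beta>: "\<beta> \<in> S"
    show "scal (\<alpha> + \<beta>) v = scal \<alpha> v \<oplus>\<^bsub>M\<^esub> scal \<beta> v"
      using v unfolding M_simps
    proof (induction v rule: tensor_induct)
      case (tensor \<gamma> x)
      thus ?case using \<alpha> \<beta> by (simp add: scal_T add_in mult_in distrib_right T_add)
    next
      case (add f g)
      thus ?case by (simp add: scal_A_add A.a_ac)
    qed simp
    show "scal (\<alpha> * \<beta>) v = scal \<alpha> (scal \<beta> v)"
      using v unfolding M_simps
    proof (induction v rule: tensor_induct)
      case (tensor \<gamma> x)
      thus ?case using \<alpha> \<beta> by (simp add: scal_T mult_in mult.assoc)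
    next
      case (add f g)
      thus ?case by (simp add: scal_A_add)
    qed simp
  }
  {
    assume w: "w \<in> carrier M"
    show "scal \<alpha> (v \<oplus>\<^bsub>M\<^esub> w) = scal \<alpha> v \<oplus>\<^bsub>M\<^esub> scal \<alpha> w" using v w by (simp add: scal_A_add)
    show "scal \<alpha> (v \<otimes>\<^bsub>M\<^esub> w) = scal \<alpha> v \<otimes>\<^bsub>M\<^esub> w"
      using v unfolding M_simps
    proof (induction v rule: tensor_induct)
      case zero
      show ?case using w by simp
    next
      case (tensor \<beta> x)
      note bx = tensor
      from w show ?case unfolding M_simps
      proof (induction w rule: tensor_induct)
        case zero
        show ?case using bx by simp
      next
        case (tensor \<gamma> y)
        thus ?case using \<alpha> bx by (simp add: scal_T br_T mult_in mult.assoc bracket_closed)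
      next
        case (add f g)
        thus ?case using bx by (simp add: scal_A_add br_add_right)
      qed
    next
      case (add f g)
      thus ?case using w by (simp add: scal_A_add br_add_left)
    qed
  }
next
  fix v assume v: "v \<in> carrier M"
  show "dd v \<in> carrier M" using v by (simp add: dd_A_closed)
  show "scal 1 v = v"
    using v unfolding M_simps
  proof (induction v rule: tensor_induct)
    case (tensor \<beta> x)
    thus ?case by (simp add: scal_T)
  next
    case (add f g)
    thus ?case by (simp add: scal_A_add)
  qed simp
  fix w assume w: "w \<in> carrier M"
  show "dd (v \<oplus>\<^bsub>M\<^esub> w) = dd v \<oplus>\<^bsub>M\<^esub> dd w" using v w by (simp add: dd_A_add)
  show "dd (v \<otimes>\<^bsub>M\<^esub> w) = (dd v \<otimes>\<^bsub>M\<^esub> w) \<oplus>\<^bsub>M\<^esub> (v \<otimes>\<^bsub>M\<^esub> dd w)" using v w by (simp add: dd_br)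
qed

text \<open>Integers act on tensors coordinate by coordinate, so they are regular as soon as they
  kill no nonzero element of \<open>L\<close>.\<close>

lemma int_regular:
  assumes "\<And>x. \<lbrakk>x \<in> carrier L; [k] \<cdot> x = \<zero>\<rbrakk> \<Longrightarrow> x = \<zero>"
  shows "of_int k \<in> M.regular"
proof -
  have "v = \<zero>\<^bsub>A\<^esub>" if v: "v \<in> carrier A" "scal (of_int k) v = \<zero>\<^bsub>A\<^esub>" for v
  proof -
    have "[k] \<cdot> v i = \<zero>" for i using fun_cong[OF v(2), of i] v(1) by (simp add: scal_int_at zero_A)
    thus ?thesis using assms v(1) by (auto simp: zero_A)
  qed
  thus ?thesis by (auto simp: M.regular_def)
qed

lemma dd_pow_at: "(dd ^^ k) f i = (E ^^ k) (f i)"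
  by (induction k) (simp_all add: dd_def)

end


section \<open>The scaled derivation \<open>a D\<close>\<close>

context nonconstant_int_poly
begin

abbreviation "ord z \<equiv> Polynomial.order z R"

lemma ord_pos: "z \<in> C \<Longrightarrow> ord z > 0"
  using R_nz by (simp add: croots_def order_root)

lemma ord_le: "ord z \<le> d"
  using order_degree[OF R_nz, of z] by simp

lemma max_mult_pos: "max_mult r > 0"
proof -
  obtain z where z: "z \<in> C" using C_nonempty by blast
  have "ord z \<le> max_mult r" unfolding max_mult_def by (rule Max_ge) (use z in auto)
  thus ?thesis using ord_pos[OF z] by simp
qed

definition scaled_roots :: "complex set" where
  "scaled_roots = (\<lambda>z. a * z) ` C"

lemma scaled_roots_integral: "scaled_roots \<subseteq> alg_ints"
  using scaled_root_integral by (auto simp: scaled_roots_def)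

text \<open>A power of \<open>a\<close> turns the differences of roots in \<open>delta r\<close>
  into differences of scaled roots, which lie in \<open>S\<close>. Any one of them splits off
  because \<open>max_mult r\<close> is positive.\<close>

lemma delta_factor:
  assumes S: "complex_subring S" "scaled_roots \<subseteq> S" and z: "z \<in> C" "w \<in> C" "z \<noteq> w"
  shows "\<exists>k. \<exists>\<beta>\<in>S. a ^ k * of_int (delta r) = (a * z - a * w) * \<beta>"
proof -
  interpret complex_subring S by fact
  define F where "F A = (\<Prod>(x, y)\<in>A. a * x - a * y)" for A
  have F_in: "F A \<in> S" if "A \<subseteq> pairs" for A
    unfolding F_def using that S(2) by (intro prod_in) (auto simp: pairs_def scaled_roots_def)
  have F_disc: "F pairs = a ^ card pairs * disc"
    by (simp add: F_def disc_def case_prod_unfold prod.distrib flip: right_diff_distrib)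
  have "(z, w) \<in> pairs" using z by (simp add: pairs_def)
  hence F_rem: "F pairs = (a * z - a * w) * F (pairs - {(z, w)})"
    unfolding F_def using prod.remove[OF finite_pairs, of "(z, w)" "\<lambda>(x, y). a * x - a * y"] by simp
  obtain m where m: "max_mult r = Suc m" using max_mult_pos by (cases "max_mult r") auto
  have "a ^ (card pairs * Suc m) * of_int (delta r)
      = a ^ (1 + 2 * d ^ 2) * fact m * (a ^ card pairs * disc) ^ Suc m"
    unfolding power_mult[of a "card pairs"]
    by (simp only: of_int_delta m diff_Suc_1 power_mult_distrib mult_ac)
  also have "\<dots> = (a * z - a * w) * (a ^ (1 + 2 * d ^ 2) * fact m * F (pairs - {(z, w)}) * F pairs ^ m)"
    unfolding F_disc[symmetric] power_Suc by (subst F_rem) (simp only: mult_ac)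
  finally have eq: "a ^ (card pairs * Suc m) * of_int (delta r)
      = (a * z - a * w) * (a ^ (1 + 2 * d ^ 2) * fact m * F (pairs - {(z, w)}) * F pairs ^ m)" .
  have "fact m \<in> S" using of_nat_in[of "fact m"] by simp
  hence "a ^ (1 + 2 * d ^ 2) * fact m * F (pairs - {(z, w)}) * F pairs ^ m \<in> S"
    using F_in by (intro mult_in power_in of_int_in) auto
  thus ?thesis using eq by blast
qed

text \<open>A power of \<open>a\<close> times \<open>r(t)\<close>, written through scaled roots: if
  \<open>t\<close> is a sum of two roots, every factor lies in \<open>S\<close>.\<close>

definition scaled_value :: "complex \<Rightarrow> complex" where
  "scaled_value t = a * (\<Prod>u\<in>C. (a * t - a * u) ^ ord u)"

lemma scaled_value_eq: "scaled_value t = a ^ (\<Sum>u\<in>C. ord u) * poly R t"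
proof -
  have "poly R t = a * (\<Prod>u\<in>C. (t - u) ^ ord u)"
    by (subst complex_poly_decompose[of R, symmetric]) (simp add: poly_prod croots_def)
  moreover have "(\<Prod>u\<in>C. (a * t - a * u) ^ ord u) = a ^ (\<Sum>u\<in>C. ord u) * (\<Prod>u\<in>C. (t - u) ^ ord u)"
    by (simp add: power_mult_distrib prod.distrib power_sum flip: right_diff_distrib)
  ultimately show ?thesis by (simp add: scaled_value_def)
qed

text \<open>One factor of \<open>sigma r\<close> is \<open>r(z + w)\<close>, which has the linear
  factor \<open>z + w - u\<close> since \<open>u\<close> is a root; powers of \<open>a\<close> bring
  all the cofactors into \<open>S\<close>.\<close>

lemma sigma_factor:
  assumes S: "complex_subring S" "scaled_roots \<subseteq> S"
    and z: "z \<in> C" "w \<in> C" "poly R (z + w) \<noteq> 0" "u \<in> C"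
  shows "\<exists>k. \<exists>\<beta>\<in>S. a ^ k * of_int (sigma r) = (a * z + a * w - a * u) * \<beta>"
proof -
  interpret complex_subring S by fact
  define K where "K = (\<Sum>u\<in>C. ord u)"
  have aC: "a * x \<in> S" if "x \<in> C" for x using that S(2) by (auto simp: scaled_roots_def)
  have aCC: "a * (x + y) - a * v \<in> S" if "x \<in> C" "y \<in> C" "v \<in> C" for x y v
    unfolding distrib_left using that by (intro diff_in add_in aC)
  have value_in: "scaled_value (x + y) \<in> S" if "x \<in> C" "y \<in> C" for x y
    unfolding scaled_value_def using that aCC by (intro mult_in prod_in power_in of_int_in)
  define F where "F A = (\<Prod>(x, y)\<in>A. scaled_value (x + y))" for A
  have F_in: "F A \<in> S" if "A \<subseteq> sum_pairs" for A
    unfolding F_def using that value_in by (intro prod_in) (auto simp: sum_pairs_def)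
  have F_sum: "F sum_pairs = a ^ (K * card sum_pairs) * sum_prod"
    by (simp add: F_def sum_prod_def scaled_value_eq K_def case_prod_unfold prod.distrib power_mult)
  have "(z, w) \<in> sum_pairs" using z by (simp add: sum_pairs_def)
  hence F_rem: "F sum_pairs = scaled_value (z + w) * F (sum_pairs - {(z, w)})"
    unfolding F_def
    using prod.remove[OF finite_sum_pairs, of "(z, w)" "\<lambda>(x, y). scaled_value (x + y)"] by simp
  obtain l where l: "ord u = Suc l" using ord_pos[OF z(4)] by (cases "ord u") auto
  define \<gamma> where "\<gamma> = a * ((a * (z + w) - a * u) ^ l * (\<Prod>v\<in>C - {u}. (a * (z + w) - a * v) ^ ord v))"
  have \<gamma>_in: "\<gamma> \<in> S"
    unfolding \<gamma>_def using z aCC by (intro mult_in prod_in power_in of_int_in) auto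
  have val: "scaled_value (z + w) = (a * z + a * w - a * u) * \<gamma>"
  proof -
    have e: "a * z + a * w - a * u = a * (z + w) - a * u" by (simp only: distrib_left)
    show ?thesis
      unfolding scaled_value_def \<gamma>_def e prod.remove[OF finite_C z(4)] l power_Suc
      by (simp only: mult_ac)
  qed
  have "a ^ (K * card sum_pairs) * of_int (sigma r) = a ^ (2 * d ^ 3) * F sum_pairs"
    by (simp only: of_int_sigma F_sum mult_ac)
  also have "\<dots> = (a * z + a * w - a * u) * (a ^ (2 * d ^ 3) * \<gamma> * F (sum_pairs - {(z, w)}))"
    by (simp only: F_rem val mult_ac)
  finally have "a ^ (K * card sum_pairs) * of_int (sigma r)
      = (a * z + a * w - a * u) * (a ^ (2 * d ^ 3) * \<gamma> * F (sum_pairs - {(z, w)}))" .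
  moreover have "a ^ (2 * d ^ 3) * \<gamma> * F (sum_pairs - {(z, w)}) \<in> S"
    using F_in \<gamma>_in by (intro mult_in power_in of_int_in) auto
  ultimately show ?thesis by blast
qed

text \<open>This is \<open>a\<^sup>d r(t / a)\<close>, which annihilates \<open>a D\<close> when \<open>r\<close> annihilates \<open>D\<close>.\<close>

definition scaled_poly :: "complex poly" where
  "scaled_poly = (\<Sum>i\<le>d. monom (of_int (coeff r i * lead_coeff r ^ (d - i))) i)"

lemma poly_scaled_poly: "poly scaled_poly (a * z) = a ^ d * poly R z"
proof -
  have "poly scaled_poly (a * z) = (\<Sum>i\<le>d. of_int (coeff r i) * a ^ (d - i) * (a * z) ^ i)"
    by (simp add: scaled_poly_def poly_sum poly_monom)
  also have "\<dots> = (\<Sum>i\<le>d. a ^ d * (coeff R i * z ^ i))"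
  proof (rule sum.cong)
    fix i assume "i \<in> {..d}"
    hence "a ^ d = a ^ (d - i) * a ^ i" by (simp flip: power_add)
    thus "of_int (coeff r i) * a ^ (d - i) * (a * z) ^ i = a ^ d * (coeff R i * z ^ i)"
      by (simp add: coeff_map_poly power_mult_distrib mult_ac)
  qed simp
  finally show ?thesis by (simp add: poly_altdef sum_distrib_left)
qed

text \<open>The splitting asks for one exponent common to all roots. \<open>P\<close> carries the
  true multiplicities and \<open>Q\<close> raises them to \<open>d\<close>; powers of
  \<open>a\<close> account for the leading coefficients.\<close>

lemma scaled_poly_factor:
  assumes S: "complex_subring S" "scaled_roots \<subseteq> S"
  shows "\<exists>W\<in>polys_over S. smult (a ^ Suc d) (\<Prod>\<mu>\<in>scaled_roots. [:-\<mu>, 1:] ^ d) = W * scaled_poly"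
proof -
  interpret complex_subring S by fact
  define K where "K = (\<Sum>u\<in>C. ord u)"
  define P where "P = (\<Prod>u\<in>C. [:- (a * u), 1:] ^ ord u)"
  define Q where "Q = (\<Prod>u\<in>C. [:- (a * u), 1:] ^ (d - ord u))"
  have "poly (smult (a ^ K) scaled_poly) x = poly (smult (a ^ Suc d) P) x" for x
  proof -
    have x: "x = a * (x / a)" using a_nz by simp
    have "poly (smult (a ^ K) scaled_poly) (a * z) = poly (smult (a ^ Suc d) P) (a * z)" for z
    proof -
      have "poly (smult (a ^ K) scaled_poly) (a * z) = a ^ d * scaled_value z"
        by (simp add: poly_scaled_poly scaled_value_eq K_def)
      thus ?thesis by (simp add: scaled_value_def P_def poly_prod)
    qed
    from this[of "x / a"] show ?thesis using x by simp
  qed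
  hence "poly (smult (a ^ K) scaled_poly) = poly (smult (a ^ Suc d) P)" by (rule ext)
  hence eq: "smult (a ^ K) scaled_poly = smult (a ^ Suc d) P" by (simp only: poly_eq_poly_eq_iff)
  have inj: "inj_on (\<lambda>z. a * z) C" using a_nz by (auto simp: inj_on_def)
  have "(\<Prod>\<mu>\<in>scaled_roots. [:-\<mu>, 1:] ^ d) = (\<Prod>u\<in>C. [:- (a * u), 1:] ^ d)"
    unfolding scaled_roots_def by (subst prod.reindex[OF inj]) simp
  also have "\<dots> = (\<Prod>u\<in>C. [:- (a * u), 1:] ^ ord u * [:- (a * u), 1:] ^ (d - ord u))"
    using ord_le by (simp flip: power_add)
  also have "\<dots> = P * Q" by (simp only: prod.distrib P_def Q_def)
  finally have "smult (a ^ Suc d) (\<Prod>\<mu>\<in>scaled_roots. [:-\<mu>, 1:] ^ d) = smult (a ^ Suc d) P * Q"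
    by (simp only: mult_smult_left)
  also have "\<dots> = smult (a ^ K) Q * scaled_poly"
    unfolding eq[symmetric] by (simp add: mult.commute)
  finally have "smult (a ^ Suc d) (\<Prod>\<mu>\<in>scaled_roots. [:-\<mu>, 1:] ^ d) = smult (a ^ K) Q * scaled_poly" .
  moreover have "a * u \<in> S" if "u \<in> C" for u using that S(2) by (auto simp: scaled_roots_def)
  hence "Q \<in> polys_over S"
    unfolding Q_def by (intro polys_prod polys_power polys_pCons uminus_in) auto
  hence "smult (a ^ K) Q \<in> polys_over S" by (intro polys_smult power_in of_int_in)
  ultimately show ?thesis by blast
qed

end

lemma (in abelian_group) additive_map_finsum:
  assumes f: "\<And>x. x \<in> carrier G \<Longrightarrow> f x \<in> carrier G"
    and add: "\<And>x y. \<lbrakk>x \<in> carrier G; y \<in> carrier G\<rbrakk> \<Longrightarrow> f (x \<oplus> y) = f x \<oplus> f y"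
    and I: "finite I" "g \<in> I \<rightarrow> carrier G"
  shows "f (\<Oplus>i\<in>I. g i) = (\<Oplus>i\<in>I. f (g i))"
  using I
proof (induction I)
  case empty
  show ?case using additive_map(1)[where f = f, OF f add] by simp
next
  case (insert i I)
  thus ?case using f by (simp add: finsum_insert add Pi_iff)
qed

section \<open>Polynomials of positive degree\<close>

lemma nonconstant_case:
  fixes L :: "('a, 'm) ring_scheme"
  assumes L: "lie_ring L" and D: "lie_derivation L D" and deg: "degree r > 0"
    and ann: "\<forall>x\<in>carrier L. poly_operator L r D x = \<zero>\<^bsub>L\<^esub>"
    and r0: "poly r 0 \<noteq> 0" and tors: "no_torsion L (delta r * sigma r)"
  shows "\<exists>c. lower_central L c = {\<zero>\<^bsub>L\<^esub>}"
    and "higman_bound (degree r) c \<Longrightarrow> lower_central L c = {\<zero>\<^bsub>L\<^esub>}"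
proof -
  interpret L: lie_ring L by (rule L)
  interpret r: nonconstant_int_poly r by unfold_locales (rule deg)
  let ?a = "lead_coeff r" and ?d = "degree r"
  have D_closed: "D x \<in> carrier L" if "x \<in> carrier L" for x
    using D that by (auto simp: lie_derivation_def)
  have D_add: "D (x \<oplus>\<^bsub>L\<^esub> y) = D x \<oplus>\<^bsub>L\<^esub> D y" if "x \<in> carrier L" "y \<in> carrier L" for x y
    using D that by (auto simp: lie_derivation_def)
  have D_br: "D (x \<otimes>\<^bsub>L\<^esub> y) = (D x \<otimes>\<^bsub>L\<^esub> y) \<oplus>\<^bsub>L\<^esub> (x \<otimes>\<^bsub>L\<^esub> D y)"
    if "x \<in> carrier L" "y \<in> carrier L" for x y
    using D that by (auto simp: lie_derivation_def)
  have D_pow_closed: "(D ^^ i) x \<in> carrier L" if "x \<in> carrier L" for x i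
    using that D_closed by (induction i) auto
  \<comment> \<open>The scaled roots, which are integral, take the place of the roots as the
    eigenvalues of this multiple of \<open>D\<close>.\<close>
  define E where "E x = [?a] \<cdot>\<^bsub>L\<^esub> D x" for x
  have E: "lie_derivation L E"
    unfolding lie_derivation_def E_def using D_closed L.bracket_closed
    by (auto simp: D_add D_br L.add.int_pow_distrib L.bracket_int_pow)
  have no_tors: "x = \<zero>\<^bsub>L\<^esub>" if "k dvd delta r * sigma r" "x \<in> carrier L" "[k] \<cdot>\<^bsub>L\<^esub> x = \<zero>\<^bsub>L\<^esub>" for k x
  proof -
    have "[((delta r * sigma r) ^ 1)] \<cdot>\<^bsub>L\<^esub> x = \<zero>\<^bsub>L\<^esub>"
      using L.int_pow_eq_zero_dvd[OF that(2,3,1)] by simp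
    thus ?thesis using tors that(2) unfolding no_torsion_def by blast
  qed
  obtain S where S: "complex_order S" "r.scaled_roots \<subseteq> S"
    using alg_ints_common_order[of r.scaled_roots] r.scaled_roots_integral by (auto simp: r.scaled_roots_def)
  note subring = complex_order_subring[OF S(1)]
  obtain N b where basis: "S = range (\<lambda>c :: nat \<Rightarrow> int. \<Sum>i<N. of_int (c i) * b i)"
    "\<And>(c :: nat \<Rightarrow> int) i. \<lbrakk>(\<Sum>i<N. of_int (c i) * b i) = 0; i < N\<rbrakk> \<Longrightarrow> c i = 0"
    using complex_order_basis[OF S(1)] by blast
  have S_int: "S \<subseteq> alg_ints" using S(1) by (auto simp: alg_ints_def)
  interpret ext: scalar_extension_derivation L S N b E
    by (intro scalar_extension_derivation.intro scalar_extension.intro L based_order.intro subring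
        based_order_axioms.intro scalar_extension_derivation_axioms.intro E basis(1) S_int)
      (rule basis(2))
  have regular: "of_int k \<in> ext.M.regular" if "k dvd delta r * sigma r" for k
    using no_tors[OF that] by (rule ext.int_regular)
  \<comment> \<open>This is the spare factor \<open>a\<close> in \<open>sigma r\<close>.\<close>
  have a_dvd: "?a dvd delta r * sigma r" using r.of_int_sigma(2) by simp
  note a_reg = ext.M.regular_power[OF regular[OF a_dvd]]
  have diff: "a - a' \<in> ext.M.regular" if *: "a \<in> r.scaled_roots" "a' \<in> r.scaled_roots" "a \<noteq> a'" for a a'
  proof -
    obtain z w where zw: "z \<in> croots r" "w \<in> croots r" "a = of_int ?a * z" "a' = of_int ?a * w"
      using *(1,2) by (auto simp: r.scaled_roots_def)
    obtain k \<beta> where k: "\<beta> \<in> S" "of_int ?a ^ k * of_int (delta r) = (a - a') * \<beta>"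
      using r.delta_factor[OF subring S(2) zw(1,2)] *(3) zw by auto
    have "of_int ?a ^ k * of_int (delta r) \<in> ext.M.regular"
      by (intro ext.M.regular_mult a_reg regular) simp
    hence "(a - a') * \<beta> \<in> ext.M.regular" by (simp only: k(2))
    moreover have "a - a' \<in> S" using *(1,2) S(2) by (intro ext.diff_in) blast+
    ultimately show ?thesis using k(1) by (rule ext.M.regular_divisor)
  qed
  have sum: "a + a' - a'' \<in> ext.M.regular"
    if *: "a \<in> r.scaled_roots" "a' \<in> r.scaled_roots" "a + a' \<notin> r.scaled_roots" "a'' \<in> r.scaled_roots"
    for a a' a''
  proof -
    obtain z w u where zw: "z \<in> croots r" "w \<in> croots r" "u \<in> croots r"
      "a = of_int ?a * z" "a' = of_int ?a * w" "a'' = of_int ?a * u"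
      using *(1,2,4) by (auto simp: r.scaled_roots_def)
    have "z + w \<notin> croots r" using *(3) zw by (auto simp: r.scaled_roots_def simp flip: distrib_left)
    hence "poly (cpoly r) (z + w) \<noteq> 0" by (simp add: croots_def)
    then obtain k \<beta> where k: "\<beta> \<in> S" "of_int ?a ^ k * of_int (sigma r) = (a + a' - a'') * \<beta>"
      using r.sigma_factor[OF subring S(2) zw(1,2) _ zw(3)] zw(4-6) by auto
    have "of_int ?a ^ k * of_int (sigma r) \<in> ext.M.regular"
      by (intro ext.M.regular_mult a_reg regular) simp
    hence "(a + a' - a'') * \<beta> \<in> ext.M.regular" by (simp only: k(2))
    moreover have "a + a' - a'' \<in> S" using *(1,2,4) S(2) by (intro ext.diff_in ext.add_in) blast+
    ultimately show ?thesis using k(1) by (rule ext.M.regular_divisor)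
  qed
  have E_pow: "(E ^^ i) x = [(?a ^ i)] \<cdot>\<^bsub>L\<^esub> (D ^^ i) x" if x: "x \<in> carrier L" for i x
  proof (induction i)
    case (Suc i)
    have "(E ^^ Suc i) x = [(?a ^ i)] \<cdot>\<^bsub>L\<^esub> E ((D ^^ i) x)"
      using Suc ext.E_int_pow[OF D_pow_closed[OF x]] by simp
    also have "\<dots> = [(?a ^ Suc i)] \<cdot>\<^bsub>L\<^esub> (D ^^ Suc i) x"
      using D_closed[OF D_pow_closed[OF x]] by (simp add: E_def L.add.int_pow_pow)
    finally show ?case .
  qed (use x in simp)
  have G_zero: "ext.M.act r.scaled_poly v = \<zero>\<^bsub>ext.M\<^esub>" if v: "v \<in> carrier ext.M" for v
  proof -
    have vA: "v \<in> carrier ext.A" using v by simp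
    have ddA: "(ext.dd ^^ i) v \<in> carrier ext.A" for i
      by (induction i) (use vA ext.dd_A_closed in auto)
    define c where "c i = coeff r i * ?a ^ (?d - i)" for i
    have "ext.M.act r.scaled_poly v = (\<Oplus>\<^bsub>ext.M\<^esub>i\<in>{..?d}. ext.M.act (monom (of_int (c i)) i) v)"
      unfolding r.scaled_poly_def c_def
      by (rule ext.M.act_sum[OF _ _ v]) auto
    also have "\<dots> = (\<Oplus>\<^bsub>ext.A\<^esub>i\<in>{..?d}. ext.scal (of_int (c i)) ((ext.dd ^^ i) v))"
      using v by (simp add: ext.finsum_M ext.M.act_monom)
    finally have act: "ext.M.act r.scaled_poly v
        = (\<Oplus>\<^bsub>ext.A\<^esub>i\<in>{..?d}. ext.scal (of_int (c i)) ((ext.dd ^^ i) v))" .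
    have "ext.M.act r.scaled_poly v j = \<zero>\<^bsub>L\<^esub>" for j
    proof -
      have x: "v j \<in> carrier L" using vA by simp
      have "ext.M.act r.scaled_poly v j = (\<Oplus>\<^bsub>L\<^esub>i\<in>{..?d}. ext.scal (of_int (c i)) ((ext.dd ^^ i) v) j)"
        unfolding act using ddA by (intro ext.finsum_A_at) auto
      \<comment> \<open>\<open>E ^^ i\<close> contributes \<open>a ^ i\<close> and the
        \<open>i\<close>-th coefficient of \<open>scaled_poly\<close> contributes
        \<open>a ^ (d - i)\<close>, so \<open>a ^ d\<close> factors out of every term and
        \<open>r(D)\<close> remains.\<close>
      also have "\<dots> = (\<Oplus>\<^bsub>L\<^esub>i\<in>{..?d}. [(?a ^ ?d)] \<cdot>\<^bsub>L\<^esub> ([coeff r i] \<cdot>\<^bsub>L\<^esub> (D ^^ i) (v j)))"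
      proof (rule L.finsum_cong')
        fix i assume "i \<in> {..?d}"
        hence e: "?a ^ ?d = ?a ^ i * ?a ^ (?d - i)" by (simp flip: power_add)
        have "ext.scal (of_int (c i)) ((ext.dd ^^ i) v) j = [c i] \<cdot>\<^bsub>L\<^esub> ([(?a ^ i)] \<cdot>\<^bsub>L\<^esub> (D ^^ i) (v j))"
          using ddA[of i] by (simp add: ext.scal_int_at ext.dd_pow_at E_pow[OF x])
        also have "\<dots> = [(?a ^ i * c i)] \<cdot>\<^bsub>L\<^esub> (D ^^ i) (v j)"
          using D_pow_closed[OF x] by (simp add: L.add.int_pow_pow)
        also have "?a ^ i * c i = coeff r i * ?a ^ ?d" unfolding c_def e by (simp only: mult_ac)
        finally show "ext.scal (of_int (c i)) ((ext.dd ^^ i) v) j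
            = [(?a ^ ?d)] \<cdot>\<^bsub>L\<^esub> ([coeff r i] \<cdot>\<^bsub>L\<^esub> (D ^^ i) (v j))"
          using D_pow_closed[OF x] by (simp add: L.add.int_pow_pow)
      qed (use D_pow_closed[OF x] in auto)
      also have "\<dots> = [(?a ^ ?d)] \<cdot>\<^bsub>L\<^esub> poly_operator L r D (v j)"
        unfolding poly_operator_def using D_pow_closed[OF x]
        by (intro L.additive_map_finsum[symmetric]) (auto simp: L.add.int_pow_distrib)
      also have "\<dots> = \<zero>\<^bsub>L\<^esub>" using ann x by simp
      finally show ?thesis .
    qed
    thus ?thesis by (auto simp: ext.zero_A)
  qed
  obtain W where W: "W \<in> polys_over S"
    "smult (of_int ?a ^ Suc ?d) (\<Prod>\<mu>\<in>r.scaled_roots. [:-\<mu>, 1:] ^ ?d) = W * r.scaled_poly"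
    using r.scaled_poly_factor[OF subring S(2)] by blast
  have ann_M: "ext.M.act (\<Prod>\<mu>\<in>r.scaled_roots. [:-\<mu>, 1:] ^ ?d) v = \<zero>\<^bsub>ext.M\<^esub>" if v: "v \<in> carrier ext.M" for v
  proof -
    let ?P = "\<Prod>\<mu>\<in>r.scaled_roots. [:-\<mu>, 1:] ^ ?d"
    have P: "?P \<in> polys_over S" using S(2) by (intro ext.polys_prod ext.M.lin_polys) auto
    have G: "r.scaled_poly \<in> polys_over S"
      unfolding r.scaled_poly_def by (intro ext.polys_sum ext.polys_monom ext.of_int_in)
    \<comment> \<open>After multiplication by this regular scalar the product becomes a multiple of
      \<open>scaled_poly\<close>, which acts as zero.\<close>
    have "ext.scal (of_int ?a ^ Suc ?d) (ext.M.act ?P v) = ext.M.act (smult (of_int ?a ^ Suc ?d) ?P) v"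
      using P v by (intro ext.M.act_smult[symmetric] ext.power_in ext.of_int_in)
    also have "\<dots> = ext.M.act W (ext.M.act r.scaled_poly v)"
      unfolding W(2) using W(1) G v by (rule ext.M.act_mult)
    also have "\<dots> = \<zero>\<^bsub>ext.M\<^esub>" unfolding G_zero[OF v] using W(1) by (rule ext.M.act_zero_vec)
    finally show ?thesis
      using a_reg[of "Suc ?d"] ext.M.act_closed[OF P v] unfolding ext.M.regular_def by blast
  qed
  have zero: "0 \<notin> r.scaled_roots"
  proof
    assume "0 \<in> r.scaled_roots"
    hence "0 \<in> croots r" using r.a_nz by (auto simp: r.scaled_roots_def)
    thus False using r0 by (simp add: croots_def poly_0_coeff_0 coeff_map_poly)
  qed
  interpret split: split_order_lie_ring ext.M S ext.scal ext.dd r.scaled_roots ?d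
    by unfold_locales
      (use r.C_nonempty S(2) zero ann_M diff sum in \<open>auto simp: r.scaled_roots_def\<close>)
  have card: "card r.scaled_roots \<le> ?d"
    using card_image_le[OF r.finite_C] r.card_C le_trans unfolding r.scaled_roots_def by blast
  show "\<exists>c. lower_central L c = {\<zero>\<^bsub>L\<^esub>}"
    using split.nilpotent_of_bounded_class(1) ext.lower_central_from_M by blast
  show "lower_central L c = {\<zero>\<^bsub>L\<^esub>}" if "higman_bound ?d c"
    using split.nilpotent_of_bounded_class(2)[OF that card] by (rule ext.lower_central_from_M)
qed

theorem theorem4p3:
  fixes L :: "('a, 'm) ring_scheme" and D :: "'a \<Rightarrow> 'a" and r :: "int poly" and n :: nat
  assumes "lie_ring L"
    and "lie_derivation L D"
    and "degree r = n"
    and "\<forall>x\<in>carrier L. poly_operator L r D x = \<zero>\<^bsub>L\<^esub>"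
    and "poly r 0 \<noteq> 0"
    and "no_torsion L (delta r * sigma r)"
  shows "lie_nilpotent L \<and> enat (nilpotency_class L) \<le> higman n"
proof -
  have bound: "(\<exists>c. lower_central L c = {\<zero>\<^bsub>L\<^esub>}) \<and>
      (\<forall>c. higman_bound n c \<longrightarrow> lower_central L c = {\<zero>\<^bsub>L\<^esub>})"
  proof (cases "n = 0")
    case True
    interpret lie_ring L by fact
    \<comment> \<open>For constant \<open>r\<close> the integer \<open>delta r\<close> is
      \<open>r(0)\<close> and \<open>sigma r\<close> is 1. Then \<open>r(D) = 0\<close> says that
      \<open>r(0)\<close> annihilates \<open>L\<close>, so \<open>L\<close> is zero.\<close>
    have "x = \<zero>\<^bsub>L\<^esub>" if x: "x \<in> carrier L" for x
    proof -
      have "[coeff r 0] \<cdot>\<^bsub>L\<^esub> x = \<zero>\<^bsub>L\<^esub>"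
        using assms(3,4) True x by (simp add: poly_operator_def)
      hence "[((delta r * sigma r) ^ 1)] \<cdot>\<^bsub>L\<^esub> x = \<zero>\<^bsub>L\<^esub>"
        using assms(3) True by (simp add: delta_def sigma_def)
      thus ?thesis using assms(6) x unfolding no_torsion_def by blast
    qed
    hence "lower_central L 0 = {\<zero>\<^bsub>L\<^esub>}" by auto
    thus ?thesis using lower_central_zero_mono[OF assms(1)] by blast
  next
    case False
    hence deg: "degree r > 0" using assms(3) by simp
    show ?thesis
      using nonconstant_case[OF assms(1,2) deg assms(4-6)] assms(3) by blast
  qed
  have "enat (nilpotency_class L) \<le> higman n"
    unfolding higman_def nilpotency_class_def
  \<comment> \<open>The class is compared with each bound \<open>c\<close> separately.\<close>
  proof (rule Inf_greatest)
    fix y assume "y \<in> enat ` {c. higman_bound n c}"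
    then obtain c where c: "y = enat c" "higman_bound n c" by blast
    hence "(LEAST c. lower_central L c = {\<zero>\<^bsub>L\<^esub>}) \<le> c" using bound by (intro Least_le) blast
    thus "enat (LEAST c. lower_central L c = {\<zero>\<^bsub>L\<^esub>}) \<le> y" using c(1) by simp
  qed
  thus ?thesis using bound by (simp add: lie_nilpotent_def)
qed

end
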